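(* Let $m\ge4$ be an integer and let $\bar X\subset\mathbb{P}^{3m-1}$ be the (closure of the) image of the rational map $\bar\varphi_m:\mathbb{P}^2\dashrightarrow\mathbb{P}^{3m-1}$ whose coordinates are $G_x,G_y,G_z$ together with all forms $xyz\lambda$, where $\lambda$ is a monomial of degree $m-1$ in $x,y,z$ not divisible by $xyz$. Then: (a) the homogeneous ideal $I(\bar X)$ is generated by $\frac12(5m^2-m-12)$ quadrics and a unique cubic $C_m$, where for $m$ odd $$C_m:\quad 2H_xH_yH_z+G_xH_yH_z+H_xG_yH_z+H_xH_yG_z-G_xG_yG_z,$$ and for $m$ even $$C_m:\quad G_xH_yH_z+H_xG_yH_z+H_xH_yG_z+G_xG_yG_z;$$ (b) $\deg(\bar X)=m^2+m+1$; (c) $\bar X$ is not arithmetically Cohen-Macaulay.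
   Context: We work over $\mathbb{C}$. The forms are $G_x=yz(y^m-(-z)^m)$, $G_y=zx(z^m-(-x)^m)$, $G_z=xy(x^m-(-y)^m)$, and $H_x=x^myz$, $H_y=xy^mz$, $H_z=xyz^m$. In the formulas for $C_m$, the symbols $G_x,G_y,G_z,H_x,H_y,H_z$ denote the homogeneous coordinates of $\mathbb{P}^{3m-1}$ corresponding to these forms. Equivalently, $\bar X$ is the projection of the surface $X\subset\mathbb{P}^N$, $N=\frac12(m^2+m)+2$, which is the image of the map given by $G_x,G_y,G_z$ and all $xyz\lambda$ with $\lambda$ any monomial of degree $m-1$, obtained by discarding the coordinates corresponding to $(xyz)^2$ times monomials of degree $m-4$. Arithmetically Cohen-Macaulay means that the homogeneous coordinate ring is Cohen-Macaulay. *)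

theory Defs
  imports Complex_Main "HOL-Library.Poly_Mapping" "HOL-Library.Extended_Nat"
    "HOL-Computational_Algebra.Polynomial" "HOL-Algebra.QuotRing" "HOL-Algebra.Ring_Divisibility"
begin

section \<open>Cohen--Macaulay rings\<close>

definition regular_sequence :: "('a, 'b) ring_scheme \<Rightarrow> 'a list \<Rightarrow> bool" where
  "regular_sequence R xs \<longleftrightarrow>
     set xs \<subseteq> carrier R \<and>
     (\<forall>i<length xs. \<forall>r\<in>carrier R.
        xs ! i \<otimes>\<^bsub>R\<^esub> r \<in> genideal R (set (take i xs)) \<longrightarrow> r \<in> genideal R (set (take i xs))) \<and>
     genideal R (set xs) \<noteq> carrier R"

definition ideal_depth :: "('a, 'b) ring_scheme \<Rightarrow> 'a set \<Rightarrow> enat" where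
  "ideal_depth R I = Sup {enat (length xs) | xs. set xs \<subseteq> I \<and> regular_sequence R xs}"

definition prime_height :: "('a, 'b) ring_scheme \<Rightarrow> 'a set \<Rightarrow> enat" where
  "prime_height R P = Sup {enat n | n. \<exists>p :: nat \<Rightarrow> 'a set.
     (\<forall>i\<le>n. primeideal (p i) R) \<and> (\<forall>i<n. p i \<subset> p (Suc i)) \<and> p n = P}"

(* Eisenbud's definition: depth M = codim M for every maximal ideal M.  For a Noetherian ring
   both sides are unchanged by localizing at M, so this says that all the local rings are
   Cohen--Macaulay. *)
definition cohen_macaulay :: "('a, 'b) ring_scheme \<Rightarrow> bool" where
  "cohen_macaulay R \<longleftrightarrow> cring R \<and> noetherian_ring R \<and>
     (\<forall>M. maximalideal M R \<longrightarrow> ideal_depth R M = prime_height R M)"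

section \<open>Polynomials in a set of variables\<close>

(* A polynomial is a finitely supported function from exponent vectors to coefficients. *)
type_synonym 'v mpoly = "('v \<Rightarrow>\<^sub>0 nat) \<Rightarrow>\<^sub>0 complex"

definition cnst :: "complex \<Rightarrow> 'v mpoly" where
  "cnst c = Poly_Mapping.single 0 c"

definition mmonom :: "('v \<Rightarrow>\<^sub>0 nat) \<Rightarrow> 'v mpoly" where
  "mmonom t = Poly_Mapping.single t 1"

definition var :: "'v \<Rightarrow> 'v mpoly" where
  "var v = mmonom (Poly_Mapping.single v 1)"

definition mdegree :: "('v \<Rightarrow>\<^sub>0 nat) \<Rightarrow> nat" where
  "mdegree t = (\<Sum>v\<in>Poly_Mapping.keys t. Poly_Mapping.lookup t v)"

definition variables :: "'v mpoly \<Rightarrow> 'v set" where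
  "variables p = (\<Union>t\<in>Poly_Mapping.keys p. Poly_Mapping.keys t)"

definition eval_mpoly :: "('v \<Rightarrow> complex) \<Rightarrow> 'v mpoly \<Rightarrow> complex" where
  "eval_mpoly a p = (\<Sum>t\<in>Poly_Mapping.keys p.
     Poly_Mapping.lookup p t * (\<Prod>v\<in>Poly_Mapping.keys t. a v ^ Poly_Mapping.lookup t v))"

definition mpoly_ring :: "'v set \<Rightarrow> 'v mpoly ring" where
  "mpoly_ring V = \<lparr>carrier = {p. variables p \<subseteq> V}, monoid.mult = (*), one = 1,
                   ring.zero = 0, add = (+)\<rparr>"

(* The degree-d graded piece of the polynomial ring; it contains 0. *)
definition forms :: "'v set \<Rightarrow> nat \<Rightarrow> 'v mpoly set" where
  "forms V d = {p \<in> carrier (mpoly_ring V). \<forall>t\<in>Poly_Mapping.keys p. mdegree t = d}"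

definition cdim :: "'v mpoly set \<Rightarrow> nat" where
  "cdim = vector_space.dim (\<lambda>c p. cnst c * p)"

definition minimally_generates :: "('a, 'b) ring_scheme \<Rightarrow> 'a set \<Rightarrow> 'a set \<Rightarrow> bool" where
  "minimally_generates R B I \<longleftrightarrow>
     B \<subseteq> carrier R \<and> genideal R B = I \<and> (\<forall>B'. B' \<subset> B \<longrightarrow> genideal R B' \<noteq> I)"

section \<open>Projective space with coordinates indexed by a finite set\<close>

definition proj_point :: "('v \<Rightarrow> complex) \<Rightarrow> ('v \<Rightarrow> complex) set" where
  "proj_point a = {(\<lambda>v. c * a v) | c. c \<noteq> 0}"

definition proj_space :: "'v set \<Rightarrow> ('v \<Rightarrow> complex) set set" where
  "proj_space V = {proj_point a | a. (\<forall>v. v \<notin> V \<longrightarrow> a v = 0) \<and> (\<exists>v\<in>V. a v \<noteq> 0)}"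

definition vanishes_on :: "'v mpoly \<Rightarrow> ('v \<Rightarrow> complex) set set \<Rightarrow> bool" where
  "vanishes_on F A \<longleftrightarrow> (\<forall>P\<in>A. \<forall>a\<in>P. eval_mpoly a F = 0)"

definition zariski_closure ::
    "'v set \<Rightarrow> ('v \<Rightarrow> complex) set set \<Rightarrow> ('v \<Rightarrow> complex) set set" where
  "zariski_closure V A = {P \<in> proj_space V.
     \<forall>d. \<forall>F\<in>forms V d. vanishes_on F A \<longrightarrow> vanishes_on F {P}}"

definition homogeneous_ideal ::
    "'v set \<Rightarrow> ('v \<Rightarrow> complex) set set \<Rightarrow> 'v mpoly set" where
  "homogeneous_ideal V W =
     genideal (mpoly_ring V) {F. (\<exists>d. F \<in> forms V d) \<and> vanishes_on F W}"

definition coordinate_ring ::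
    "'v set \<Rightarrow> ('v \<Rightarrow> complex) set set \<Rightarrow> 'v mpoly set ring" where
  "coordinate_ring V W = FactRing (mpoly_ring V) (homogeneous_ideal V W)"

definition arithmetically_cohen_macaulay ::
    "'v set \<Rightarrow> ('v \<Rightarrow> complex) set set \<Rightarrow> bool" where
  "arithmetically_cohen_macaulay V W \<longleftrightarrow> cohen_macaulay (coordinate_ring V W)"

definition hilbert_function ::
    "'v set \<Rightarrow> ('v \<Rightarrow> complex) set set \<Rightarrow> nat \<Rightarrow> nat" where
  "hilbert_function V W d = cdim (forms V d) - cdim (homogeneous_ideal V W \<inter> forms V d)"

definition hilbert_polynomial ::
    "'v set \<Rightarrow> ('v \<Rightarrow> complex) set set \<Rightarrow> rat poly" where
  "hilbert_polynomial V W =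
     (THE P. \<forall>\<^sub>F d in sequentially. of_nat (hilbert_function V W d) = poly P (of_nat d))"

(* r! times the leading coefficient of the Hilbert polynomial, whose degree r is dim W *)
definition proj_degree :: "'v set \<Rightarrow> ('v \<Rightarrow> complex) set set \<Rightarrow> rat" where
  "proj_degree V W =
     fact (degree (hilbert_polynomial V W)) * lead_coeff (hilbert_polynomial V W)"

section \<open>The rational map and its image\<close>

datatype axis = Vx | Vy | Vz

(* Homogeneous coordinates of the target: \<open>CoordG a\<close> is the coordinate belonging to the form
   G_a, and \<open>CoordL t\<close> the one belonging to xyz times the monomial with exponent vector t. *)
datatype coord = CoordG axis | CoordL "axis \<Rightarrow>\<^sub>0 nat"

definition coords :: "nat \<Rightarrow> coord set" where
  "coords m = {CoordG Vx, CoordG Vy, CoordG Vz} \<union>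
     {CoordL t | t. mdegree t = m - 1 \<and> \<not> var Vx * var Vy * var Vz dvd mmonom t}"

fun coord_form :: "nat \<Rightarrow> coord \<Rightarrow> axis mpoly" where
  "coord_form m (CoordG Vx) = var Vy * var Vz * (var Vy ^ m - (- var Vz) ^ m)"
| "coord_form m (CoordG Vy) = var Vz * var Vx * (var Vz ^ m - (- var Vx) ^ m)"
| "coord_form m (CoordG Vz) = var Vx * var Vy * (var Vx ^ m - (- var Vy) ^ m)"
| "coord_form m (CoordL t) = var Vx * var Vy * var Vz * mmonom t"

definition phi :: "nat \<Rightarrow> (axis \<Rightarrow> complex) \<Rightarrow> coord \<Rightarrow> complex" where
  "phi m a = (\<lambda>c. if c \<in> coords m then eval_mpoly a (coord_form m c) else 0)"

definition phi_image :: "nat \<Rightarrow> (coord \<Rightarrow> complex) set set" where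
  "phi_image m = {proj_point (phi m a) | a. proj_point a \<in> proj_space UNIV \<and>
                    (\<exists>c\<in>coords m. phi m a c \<noteq> 0)}"

definition Xbar :: "nat \<Rightarrow> (coord \<Rightarrow> complex) set set" where
  "Xbar m = zariski_closure (coords m) (phi_image m)"

(* The coordinate of H_a = a^m * (xyz / a), which is xyz * a^(m-1). *)
definition coordH :: "nat \<Rightarrow> axis \<Rightarrow> coord" where
  "coordH m a = CoordL (Poly_Mapping.single a (m - 1))"

definition cubic_C :: "nat \<Rightarrow> coord mpoly" where
  "cubic_C m =
    (let gx = var (CoordG Vx); gy = var (CoordG Vy); gz = var (CoordG Vz);
         hx = var (coordH m Vx); hy = var (coordH m Vy); hz = var (coordH m Vz)
     in if odd m
        then 2 * hx * hy * hz + gx * hy * hz + hx * gy * hz + hx * hy * gz - gx * gy * gz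
        else gx * hy * hz + hx * gy * hz + hx * hy * gz + gx * gy * gz)"

end

theory Submission
  imports Defs
begin

text \<open>A product of coordinates is a monomial in the three \<open>G\<close>'s times coordinates \<open>xyz\<lambda>\<close> with \<open>\<lambda>\<close> on the
  boundary of the triangle of exponents.  Modulo quadrics, products of the \<open>xyz\<lambda>\<close> only depend on
  their number and on the product of the \<open>\<lambda>\<close>'s: some power \<open>x_v\<^bsup>m-1\<^esup>\<close> can be split off by exchanging
  pairs as soon as there are three factors.  Quadrics also remove \<open>G_v \<sqdot> xyz\<lambda>\<close> with \<open>x_v | \<lambda>\<close>, and the cubic
  removes \<open>G_x G_y G_z\<close>.  The remaining normal forms are linearly independent as forms in \<open>x, y, z\<close>:
  compare lowest-order terms in \<open>x_v\<close> among those with the highest power of \<open>G_v\<close>.  Hence the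
  quadrics and the cubic generate the ideal, and counting normal forms gives the Hilbert function.

  All quadrics of the ideal vanish at the point where every \<open>G\<close> is 1 and every \<open>xyz\<lambda>\<close> is 0, since
  \<open>\<bar>X\<close> contains the three lines through two coordinate points of \<open>G\<close>'s; the cubic does not vanish there.

  Finally, \<open>(xyz)\<^sup>2 x\<^bsup>m-4\<^esup>\<close> is not in the coordinate ring, but its products with all elements of the
  irrelevant ideal are.  So that ideal has depth at most 1, whereas its height is at least 2.\<close>

section \<open>Polynomials in a set of variables\<close>

text \<open>The ring of forms in x, y, z is never formed. A class of the coordinate ring is handled
  as the function \<open>pull m F\<close> on C^3, and arguments about independence, primality or
  cancellation substitute until only univariate polynomials remain. Reduction to normal forms is
  carried out modulo an arbitrary ideal J containing the quadrics and the cubic (locale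
  \<open>presentation\<close>), and is used twice. With J generated by them, independence of the
  normal forms yields the equations. With J the whole kernel, the normal forms become a basis of
  each graded piece, so that one count gives both the Hilbert polynomial and the number of quadrics,
  which is binom(3m+1, 2) minus the number of normal forms of degree 2. For two factors no
  connectivity argument arises, as exchanging a pair for another with equal product is itself a
  quadric. The threshold of three factors is a pigeonhole: three exponents with sum at least 3(m-1)
  include one that is at least m-1. In (c), the bound m >= 4 makes x^(m-4) meaningful and keeps the
  orders 2m+3 and 2m+4 of terms of the G's on the test curve away from m+6.\<close>

abbreviation lkp :: "('a \<Rightarrow>\<^sub>0 'b::zero) \<Rightarrow> 'a \<Rightarrow> 'b" where "lkp \<equiv> Poly_Mapping.lookup"
abbreviation kys :: "('a \<Rightarrow>\<^sub>0 'b::zero) \<Rightarrow> 'a set" where "kys \<equiv> Poly_Mapping.keys"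

lemma mdegree_superset:
  assumes "finite A" "kys t \<subseteq> A"
  shows "mdegree t = (\<Sum>v\<in>A. lkp t v)"
  unfolding mdegree_def using assms
  by (intro sum.mono_neutral_left) (auto simp: in_keys_iff)

lemma mdegree_add: "mdegree (s + t) = mdegree s + mdegree t"
proof -
  have "mdegree (s + t) = (\<Sum>v\<in>kys s \<union> kys t. lkp (s + t) v)"
    by (rule mdegree_superset) (use keys_add in fastforce)+
  also have "\<dots> = (\<Sum>v\<in>kys s \<union> kys t. lkp s v) + (\<Sum>v\<in>kys s \<union> kys t. lkp t v)"
    by (simp add: lookup_add sum.distrib)
  also have "\<dots> = mdegree s + mdegree t"
    by (simp add: mdegree_superset [of "kys s \<union> kys t" s] mdegree_superset [of "kys s \<union> kys t" t])
  finally show ?thesis .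
qed

lemma mdegree_zero [simp]: "mdegree 0 = 0"
  by (simp add: mdegree_def)

lemma mdegree_single [simp]: "mdegree (Poly_Mapping.single v n) = n"
  by (simp add: mdegree_def)

lemma mdegree_eq_0_iff: "mdegree t = 0 \<longleftrightarrow> t = 0"
proof
  assume "mdegree t = 0"
  then have "\<forall>v\<in>kys t. lkp t v = 0" by (simp add: mdegree_def)
  then have "lkp t v = 0" for v by (auto simp: in_keys_iff)
  then show "t = 0" by (intro poly_mapping_eqI) simp
qed simp

lemma split_key:
  fixes t :: "'v \<Rightarrow>\<^sub>0 nat"
  assumes "t \<noteq> 0"
  obtains c t' where "c \<in> kys t" "kys t' \<subseteq> kys t" "t = Poly_Mapping.single c 1 + t'"
proof -
  obtain c where c: "c \<in> kys t" using assms by (metis Poly_Mapping.keys_eq_empty ex_in_conv)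
  define t' where "t' = t - Poly_Mapping.single c 1"
  have "t = Poly_Mapping.single c 1 + t'"
    using c by (intro poly_mapping_eqI)
      (auto simp: t'_def lookup_add lookup_minus lookup_single when_def in_keys_iff)
  moreover have "kys t' \<subseteq> kys t" by (auto simp: t'_def in_keys_iff lookup_minus)
  ultimately show thesis using c that by blast
qed

lemma mmonom_add: "mmonom (s + t) = mmonom s * mmonom t"
  by (simp add: mmonom_def mult_single)

lemma mmonom_0 [simp]: "mmonom 0 = 1"
  by (simp add: mmonom_def)

lemma cnst_add: "cnst (a + b) = cnst a + cnst b"
  by (simp add: cnst_def single_add)

lemma cnst_mult: "cnst (a * b) = cnst a * cnst b"
  by (simp add: cnst_def mult_single)

lemma cnst_0 [simp]: "cnst 0 = 0" by (simp add: cnst_def)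
lemma cnst_1 [simp]: "cnst 1 = 1" by (simp add: cnst_def)
lemma cnst_uminus: "cnst (- a) = - cnst a" by (simp add: cnst_def single_uminus)

lemma single_eq_cnst_mult: "Poly_Mapping.single t c = cnst c * mmonom t"
  by (simp add: cnst_def mmonom_def mult_single)

lemma lookup_cnst_mult: "lkp (cnst c * p) t = c * lkp p t"
proof -
  have "cnst c * p = Poly_Mapping.map ((*) c) p"
    by (simp add: cnst_def mult_map_scale_conv_mult)
  then show ?thesis by (simp add: map.rep_eq when_def)
qed

lemma keys_cnst_mult: "kys (cnst c * p) \<subseteq> kys p"
  by (auto simp: in_keys_iff lookup_cnst_mult)

lemma mpoly_expand: "p = (\<Sum>t\<in>kys p. cnst (lkp p t) * mmonom t)"
proof (rule poly_mapping_eqI)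
  fix s
  have "lkp (\<Sum>t\<in>kys p. cnst (lkp p t) * mmonom t) s = (\<Sum>t\<in>kys p. lkp p t * (1 when t = s))"
    by (simp add: lookup_sum lookup_cnst_mult mmonom_def lookup_single)
  also have "\<dots> = (\<Sum>t\<in>kys p. if t = s then lkp p t else 0)"
    by (intro sum.cong) (auto simp: when_def)
  also have "\<dots> = lkp p s"
    by (auto simp: sum.delta in_keys_iff)
  finally show "lkp p s = lkp (\<Sum>t\<in>kys p. cnst (lkp p t) * mmonom t) s" by simp
qed

subsection \<open>Evaluation\<close>

text \<open>Defined over any commutative monoid: exponent vectors are evaluated both at complex
  points and at univariate polynomials.\<close>

definition mval :: "('v \<Rightarrow> 'r::comm_monoid_mult) \<Rightarrow> ('v \<Rightarrow>\<^sub>0 nat) \<Rightarrow> 'r" where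
  "mval a t = (\<Prod>v\<in>kys t. a v ^ lkp t v)"

lemma mval_superset:
  assumes "finite A" "kys t \<subseteq> A"
  shows "mval a t = (\<Prod>v\<in>A. a v ^ lkp t v)"
  unfolding mval_def using assms
  by (intro prod.mono_neutral_left) (auto simp: in_keys_iff)

lemma mval_add: "mval a (s + t) = mval a s * mval a t"
proof -
  have "mval a (s + t) = (\<Prod>v\<in>kys s \<union> kys t. a v ^ lkp (s + t) v)"
    by (rule mval_superset) (use keys_add in fastforce)+
  also have "\<dots> = (\<Prod>v\<in>kys s \<union> kys t. a v ^ lkp s v) * (\<Prod>v\<in>kys s \<union> kys t. a v ^ lkp t v)"
    by (simp add: lookup_add power_add prod.distrib)
  also have "\<dots> = mval a s * mval a t"
    by (simp add: mval_superset [of "kys s \<union> kys t" s] mval_superset [of "kys s \<union> kys t" t])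
  finally show ?thesis .
qed

lemma mval_0 [simp]: "mval a 0 = 1" by (simp add: mval_def)
lemma mval_single [simp]: "mval a (Poly_Mapping.single v n) = a v ^ n"
  by (simp add: mval_def)

lemma eval_mpoly_superset:
  assumes "finite A" "kys p \<subseteq> A"
  shows "eval_mpoly a p = (\<Sum>t\<in>A. lkp p t * mval a t)"
  unfolding eval_mpoly_def mval_def using assms
  by (intro sum.mono_neutral_left) (auto simp: in_keys_iff)

lemma eval_mpoly_single: "eval_mpoly a (Poly_Mapping.single t c) = c * mval a t"
  by (simp add: eval_mpoly_def mval_def)

lemma eval_mpoly_add: "eval_mpoly a (p + q) = eval_mpoly a p + eval_mpoly a q"
proof -
  have "eval_mpoly a (p + q) = (\<Sum>t\<in>kys p \<union> kys q. lkp (p + q) t * mval a t)"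
    by (rule eval_mpoly_superset) (use keys_add in fastforce)+
  also have "\<dots> = (\<Sum>t\<in>kys p \<union> kys q. lkp p t * mval a t) + (\<Sum>t\<in>kys p \<union> kys q. lkp q t * mval a t)"
    by (simp add: lookup_add algebra_simps sum.distrib)
  also have "\<dots> = eval_mpoly a p + eval_mpoly a q"
    by (simp add: eval_mpoly_superset [of "kys p \<union> kys q" p] eval_mpoly_superset [of "kys p \<union> kys q" q])
  finally show ?thesis .
qed

lemma eval_mpoly_0 [simp]: "eval_mpoly a 0 = 0" by (simp add: eval_mpoly_def)

lemma eval_mpoly_sum: "eval_mpoly a (\<Sum>i\<in>I. f i) = (\<Sum>i\<in>I. eval_mpoly a (f i))"
  by (induction I rule: infinite_finite_induct) (auto simp: eval_mpoly_add)

lemma eval_mpoly_cnst [simp]: "eval_mpoly a (cnst c) = c"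
  by (simp add: cnst_def eval_mpoly_single)

lemma eval_mpoly_1 [simp]: "eval_mpoly a 1 = 1"
  using eval_mpoly_cnst [of a 1] by simp

lemma eval_mpoly_mmonom: "eval_mpoly a (mmonom t) = mval a t"
  by (simp add: mmonom_def eval_mpoly_single)

lemma eval_mpoly_var [simp]: "eval_mpoly a (var v) = a v"
  by (simp add: var_def eval_mpoly_mmonom)

lemma eval_mpoly_mult: "eval_mpoly a (p * q) = eval_mpoly a p * eval_mpoly a q"
proof -
  have 1: "p * q = (\<Sum>s\<in>kys p. \<Sum>t\<in>kys q. Poly_Mapping.single (s + t) (lkp p s * lkp q t))"
    by (subst (1) mpoly_expand [of p], subst (1) mpoly_expand [of q])
       (simp add: sum_product flip: single_eq_cnst_mult, simp add: mult_single)
  show ?thesis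
    unfolding 1 eval_mpoly_sum eval_mpoly_single mval_add
    by (simp add: eval_mpoly_superset [of "kys p" p] eval_mpoly_superset [of "kys q" q] sum_product algebra_simps)
qed

lemma eval_mpoly_uminus [simp]: "eval_mpoly a (- p) = - eval_mpoly a p"
  using eval_mpoly_add [of a p "- p"] by (simp add: eq_neg_iff_add_eq_0 add.commute)

lemma eval_mpoly_diff: "eval_mpoly a (p - q) = eval_mpoly a p - eval_mpoly a q"
  using eval_mpoly_add [of a p "- q"] by simp

lemma eval_mpoly_power: "eval_mpoly a (p ^ n) = eval_mpoly a p ^ n"
  by (induction n) (auto simp: eval_mpoly_mult)

lemma eval_mpoly_prod_mset: "eval_mpoly a (\<Prod>x\<in>#X. f x) = (\<Prod>x\<in>#X. eval_mpoly a (f x))"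
  by (induction X) (auto simp: eval_mpoly_mult)

lemma eval_mpoly_prod: "eval_mpoly a (\<Prod>x\<in>X. f x) = (\<Prod>x\<in>X. eval_mpoly a (f x))"
  by (induction X rule: infinite_finite_induct) (auto simp: eval_mpoly_mult)

lemma eval_mpoly_numeral [simp]: "eval_mpoly a (numeral n) = numeral n"
proof -
  have "numeral n = cnst (numeral n)" by (simp add: cnst_def)
  then show ?thesis by (metis eval_mpoly_cnst)
qed

lemmas eval_mpoly_hom = eval_mpoly_add eval_mpoly_mult eval_mpoly_diff eval_mpoly_power
  eval_mpoly_sum eval_mpoly_prod eval_mpoly_prod_mset

text \<open>Restriction of a polynomial to a polynomially parametrized curve, kept as a univariate
  polynomial so that coefficients can be compared.\<close>

definition peval :: "('v \<Rightarrow> complex poly) \<Rightarrow> 'v mpoly \<Rightarrow> complex poly" where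
  "peval \<alpha> p = (\<Sum>t\<in>kys p. Polynomial.smult (lkp p t) (mval \<alpha> t))"

lemma poly_mval: "poly (mval \<alpha> t) s = mval (\<lambda>v. poly (\<alpha> v) s) t"
  by (simp add: mval_def poly_prod)

lemma poly_peval: "poly (peval \<alpha> p) s = eval_mpoly (\<lambda>v. poly (\<alpha> v) s) p"
  by (simp add: peval_def eval_mpoly_def poly_sum poly_mval, simp add: mval_def)

subsection \<open>The ring and its ideals\<close>

lemma carrier_mpoly: "carrier (mpoly_ring V) = {p. variables p \<subseteq> V}"
  by (simp add: mpoly_ring_def)

lemma mpoly_ring_simps [simp]:
  "monoid.mult (mpoly_ring V) = (*)" "one (mpoly_ring V) = 1" "ring.zero (mpoly_ring V) = 0"
  "add (mpoly_ring V) = (+)"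
  by (simp_all add: mpoly_ring_def)

lemma carrier_mpoly_iff: "p \<in> carrier (mpoly_ring V) \<longleftrightarrow> (\<forall>t\<in>kys p. kys t \<subseteq> V)"
  by (auto simp: carrier_mpoly variables_def)

lemma mpoly_closed:
  shows mpoly_add_closed: "p \<in> carrier (mpoly_ring V) \<Longrightarrow> q \<in> carrier (mpoly_ring V) \<Longrightarrow> p + q \<in> carrier (mpoly_ring V)"
    and mpoly_mult_closed: "p \<in> carrier (mpoly_ring V) \<Longrightarrow> q \<in> carrier (mpoly_ring V) \<Longrightarrow> p * q \<in> carrier (mpoly_ring V)"
    and mpoly_uminus_closed: "p \<in> carrier (mpoly_ring V) \<Longrightarrow> - p \<in> carrier (mpoly_ring V)"
    and mpoly_zero_closed: "0 \<in> carrier (mpoly_ring V)"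
    and mpoly_one_closed: "1 \<in> carrier (mpoly_ring V)"
    and mpoly_cnst_closed: "cnst c \<in> carrier (mpoly_ring V)"
    and mpoly_var_closed: "v \<in> V \<Longrightarrow> var v \<in> carrier (mpoly_ring V)"
    and mpoly_mmonom_closed: "kys t \<subseteq> V \<Longrightarrow> mmonom t \<in> carrier (mpoly_ring V)"
proof -
  show "p + q \<in> carrier (mpoly_ring V)" if "p \<in> carrier (mpoly_ring V)" "q \<in> carrier (mpoly_ring V)" for p q
    using that keys_add [of p q] unfolding carrier_mpoly_iff by blast
  show "p * q \<in> carrier (mpoly_ring V)" if "p \<in> carrier (mpoly_ring V)" "q \<in> carrier (mpoly_ring V)" for p q
    unfolding carrier_mpoly_iff
  proof
    fix t assume "t \<in> kys (p * q)"
    then obtain a b where "t = a + b" "a \<in> kys p" "b \<in> kys q"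
      using keys_mult [of p q] by blast
    then show "kys t \<subseteq> V"
      using that keys_add [of a b] unfolding carrier_mpoly_iff by blast
  qed
  show "- p \<in> carrier (mpoly_ring V)" if "p \<in> carrier (mpoly_ring V)" for p
    using that unfolding carrier_mpoly_iff by (simp add: in_keys_iff)
qed (auto simp: carrier_mpoly_iff cnst_def var_def mmonom_def split: if_splits)

lemma mpoly_diff_closed:
  "p \<in> carrier (mpoly_ring V) \<Longrightarrow> q \<in> carrier (mpoly_ring V) \<Longrightarrow> p - q \<in> carrier (mpoly_ring V)"
  using mpoly_add_closed [of p V "- q"] mpoly_uminus_closed by fastforce

lemma mpoly_cring: "cring (mpoly_ring V)"
proof (rule cringI)
  show "abelian_group (mpoly_ring V)"
  proof (rule abelian_groupI)
    show "\<exists>y\<in>carrier (mpoly_ring V). y \<oplus>\<^bsub>mpoly_ring V\<^esub> x = \<zero>\<^bsub>mpoly_ring V\<^esub>"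
      if "x \<in> carrier (mpoly_ring V)" for x
      using that by (intro bexI [of _ "- x"]) (auto intro: mpoly_uminus_closed)
  qed (auto intro: mpoly_closed)
  show "comm_monoid (mpoly_ring V)"
    by (rule comm_monoidI) (auto intro: mpoly_closed)
qed (auto simp: algebra_simps)

lemma mpoly_a_inv: "p \<in> carrier (mpoly_ring V) \<Longrightarrow> \<ominus>\<^bsub>mpoly_ring V\<^esub> p = - p"
proof -
  assume p: "p \<in> carrier (mpoly_ring V)"
  interpret cring "mpoly_ring V" by (rule mpoly_cring)
  have "p \<oplus>\<^bsub>mpoly_ring V\<^esub> (- p) = \<zero>\<^bsub>mpoly_ring V\<^esub>" by simp
  then show ?thesis using p mpoly_uminus_closed [OF p]
    by (metis a_comm minus_equality)
qed

lemma mpoly_idealI: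
  assumes "I \<subseteq> carrier (mpoly_ring V)" "0 \<in> I"
    "\<And>p q. p \<in> I \<Longrightarrow> q \<in> I \<Longrightarrow> p + q \<in> I"
    "\<And>p r. p \<in> I \<Longrightarrow> r \<in> carrier (mpoly_ring V) \<Longrightarrow> r * p \<in> I"
  shows "ideal I (mpoly_ring V)"
proof -
  interpret cring "mpoly_ring V" by (rule mpoly_cring)
  have neg: "- p \<in> I" if "p \<in> I" for p
    using assms(4) [OF that mpoly_cnst_closed [of "-1"]] by (simp add: cnst_uminus)
  have ainv: "inv\<^bsub>add_monoid (mpoly_ring V)\<^esub> p = - p" if "p \<in> I" for p
    using mpoly_a_inv [of p V] that assms(1) by (auto simp: a_inv_def)
  show ?thesis
  proof (rule idealI)
    show "ring (mpoly_ring V)" by unfold_locales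
    show "subgroup I (add_monoid (mpoly_ring V))"
      by unfold_locales (use assms neg ainv in auto)
  qed (use assms in \<open>auto simp: mult.commute\<close>)
qed

lemma mpoly_ideal_props:
  assumes "ideal I (mpoly_ring V)"
  shows mpoly_ideal_carrier: "p \<in> I \<Longrightarrow> p \<in> carrier (mpoly_ring V)"
    and mpoly_ideal_zero: "0 \<in> I"
    and mpoly_ideal_add: "p \<in> I \<Longrightarrow> q \<in> I \<Longrightarrow> p + q \<in> I"
    and mpoly_ideal_mult: "p \<in> I \<Longrightarrow> r \<in> carrier (mpoly_ring V) \<Longrightarrow> r * p \<in> I"
    and mpoly_ideal_cnst: "p \<in> I \<Longrightarrow> cnst c * p \<in> I"
    and mpoly_ideal_uminus: "p \<in> I \<Longrightarrow> - p \<in> I"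
    and mpoly_ideal_diff: "p \<in> I \<Longrightarrow> q \<in> I \<Longrightarrow> p - q \<in> I"
proof -
  interpret ideal I "mpoly_ring V" by fact
  show "p \<in> I \<Longrightarrow> p \<in> carrier (mpoly_ring V)" by (rule a_Hcarr)
  show "0 \<in> I" using additive_subgroup.zero_closed [OF additive_subgroup_axioms] by simp
  show add: "p \<in> I \<Longrightarrow> q \<in> I \<Longrightarrow> p + q \<in> I" for p q
    using additive_subgroup.a_closed [OF additive_subgroup_axioms, of p q] by simp
  show mult: "p \<in> I \<Longrightarrow> r \<in> carrier (mpoly_ring V) \<Longrightarrow> r * p \<in> I" for p r
    using I_l_closed [of p r] by simp
  show cn: "p \<in> I \<Longrightarrow> cnst c * p \<in> I" for p c using mult mpoly_cnst_closed by blast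
  show neg: "p \<in> I \<Longrightarrow> - p \<in> I" for p using cn [of p "-1"] by (simp add: cnst_uminus)
  show "p \<in> I \<Longrightarrow> q \<in> I \<Longrightarrow> p - q \<in> I" using add [of p "-q"] neg by simp
qed

lemma mpoly_ideal_sum:
  assumes "ideal I (mpoly_ring V)" "\<And>x. x \<in> X \<Longrightarrow> f x \<in> I"
  shows "(\<Sum>x\<in>X. f x) \<in> I"
  using assms(2)
  by (induction X rule: infinite_finite_induct)
     (auto intro: mpoly_ideal_add [OF assms(1)] mpoly_ideal_zero [OF assms(1)])

lemma mpoly_genideal_ideal: "S \<subseteq> carrier (mpoly_ring V) \<Longrightarrow> ideal (genideal (mpoly_ring V) S) (mpoly_ring V)"
  using ring.genideal_ideal cring.axioms(1) mpoly_cring by blast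

lemma mpoly_genideal_self: "S \<subseteq> carrier (mpoly_ring V) \<Longrightarrow> S \<subseteq> genideal (mpoly_ring V) S"
  using ring.genideal_self cring.axioms(1) mpoly_cring by blast

lemma mpoly_genideal_minimal: "ideal I (mpoly_ring V) \<Longrightarrow> S \<subseteq> I \<Longrightarrow> genideal (mpoly_ring V) S \<subseteq> I"
  using ring.genideal_minimal cring.axioms(1) mpoly_cring by blast

subsection \<open>Forms as a vector space\<close>

global_interpretation mpv: vector_space "\<lambda>c (p::'v mpoly). cnst c * p"
  defines mpspan = mpv.span
  by unfold_locales (auto simp: algebra_simps cnst_add cnst_mult)

lemma forms_iff: "p \<in> forms V d \<longleftrightarrow> (\<forall>t\<in>kys p. kys t \<subseteq> V \<and> mdegree t = d)"
  by (auto simp: forms_def carrier_mpoly_iff)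

lemma forms_subspace: "mpv.subspace (forms V d)"
  unfolding mpv.subspace_def forms_iff
proof (intro conjI ballI allI)
  fix p q t assume "p \<in> forms V d" "q \<in> forms V d" "t \<in> kys (p + q)"
  then show "kys t \<subseteq> V" "mdegree t = d"
    using keys_add [of p q] unfolding forms_iff by blast+
next
  fix c and p :: "'a mpoly" and t assume "p \<in> forms V d" "t \<in> kys (cnst c * p)"
  then show "kys t \<subseteq> V" "mdegree t = d"
    using keys_cnst_mult [of c p] unfolding forms_iff by blast+
qed auto

lemma forms_carrier: "p \<in> forms V d \<Longrightarrow> p \<in> carrier (mpoly_ring V)"
  by (simp add: forms_def)

lemma mmonom_in_forms: "kys t \<subseteq> V \<Longrightarrow> mdegree t = d \<Longrightarrow> mmonom t \<in> forms V d"
  by (simp add: forms_iff mmonom_def)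

lemma var_in_forms: "v \<in> V \<Longrightarrow> var v \<in> forms V 1"
  by (simp add: var_def mmonom_in_forms)

lemma forms_mult:
  assumes "p \<in> forms V d" "q \<in> forms V e"
  shows "p * q \<in> forms V (d + e)"
  unfolding forms_iff
proof
  fix t assume "t \<in> kys (p * q)"
  then obtain a b where "t = a + b" "a \<in> kys p" "b \<in> kys q"
    using keys_mult [of p q] by blast
  then show "kys t \<subseteq> V \<and> mdegree t = d + e"
    using assms keys_add [of a b] unfolding forms_iff by (auto simp: mdegree_add, blast)
qed

lemma forms_span_mmonom: "forms V d = mpspan (mmonom ` {t. kys t \<subseteq> V \<and> mdegree t = d})"
proof
  show "forms V d \<subseteq> mpspan (mmonom ` {t. kys t \<subseteq> V \<and> mdegree t = d})"
  proof
    fix p assume p: "p \<in> forms V d"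
    show "p \<in> mpspan (mmonom ` {t. kys t \<subseteq> V \<and> mdegree t = d})"
      by (subst mpoly_expand) (intro mpv.span_sum mpv.span_scale mpv.span_base imageI, use p [unfolded forms_iff] in auto)
  qed
  show "mpspan (mmonom ` {t. kys t \<subseteq> V \<and> mdegree t = d}) \<subseteq> forms V d"
    by (rule mpv.span_minimal) (auto intro: mmonom_in_forms forms_subspace)
qed

lemma lookup_mmonom: "lkp (mmonom s) t = (if s = t then 1 else 0)"
  by (simp add: mmonom_def lookup_single when_def)

lemma mmonom_eq_iff: "mmonom s = mmonom t \<longleftrightarrow> s = t"
  by (metis lookup_mmonom zero_neq_one)

lemma inj_mmonom: "inj_on mmonom A"
  by (simp add: inj_on_def mmonom_eq_iff)

lemma independent_mmonom: "mpv.independent (mmonom ` A)"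
proof (subst mpv.independent_explicit_finite_subsets, intro allI impI ballI)
  fix S u p
  assume S: "S \<subseteq> mmonom ` A" "finite S" "(\<Sum>v\<in>S. cnst (u v) * v) = 0" and p: "p \<in> S"
  obtain t where t: "p = mmonom t" using S p by auto
  have "0 = lkp (\<Sum>v\<in>S. cnst (u v) * v) t" by (simp add: S)
  also have "\<dots> = (\<Sum>v\<in>S. u v * lkp v t)" by (simp add: lookup_sum lookup_cnst_mult)
  also have "\<dots> = (\<Sum>v\<in>S. if v = p then u v else 0)"
  proof (rule sum.cong [OF refl])
    fix v assume "v \<in> S"
    then obtain s where "v = mmonom s" using S by auto
    then show "u v * lkp v t = (if v = p then u v else 0)"
      by (auto simp: t lookup_mmonom mmonom_eq_iff)
  qed
  also have "\<dots> = u p" using p S by simp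
  finally show "u p = 0" by simp
qed

lemma cdim_eq: "cdim = mpv.dim"
  by (simp add: cdim_def)

lemma cdim_forms: "cdim (forms V d) = card {t. kys t \<subseteq> V \<and> mdegree t = d}"
  unfolding cdim_eq forms_span_mmonom mpv.dim_span_eq_card_independent [OF independent_mmonom]
  by (simp add: card_image inj_mmonom)

section \<open>Boundary monomials\<close>

abbreviation sg :: "'a \<Rightarrow> 'b \<Rightarrow> 'a \<Rightarrow>\<^sub>0 'b::zero" where "sg \<equiv> Poly_Mapping.single"

fun nxt :: "axis \<Rightarrow> axis" where
  "nxt Vx = Vy" | "nxt Vy = Vz" | "nxt Vz = Vx"

lemma UNIV_axis: "UNIV = {Vx, Vy, Vz}"
  using axis.exhaust by blast

instance axis :: finite
  by standard (simp add: UNIV_axis)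

lemma axis_cases_distinct: "distinct [v, w, u] \<Longrightarrow> k = v \<or> k = w \<or> k = (u :: axis)"
  by (cases k; cases v; cases w; cases u) auto

lemma axis_sum: "distinct [v, w, u] \<Longrightarrow> (\<Sum>k\<in>UNIV. f k) = f v + f w + f (u :: axis)"
proof -
  assume d: "distinct [v, w, u]"
  have *: "UNIV = {v, w, u}" using axis_cases_distinct [OF d] by auto
  show ?thesis unfolding * using d by (simp add: add.assoc)
qed

lemma axis_prod: "distinct [v, w, u] \<Longrightarrow> (\<Prod>k\<in>UNIV. f k) = f v * f w * f (u :: axis)"
proof -
  assume d: "distinct [v, w, u]"
  have *: "UNIV = {v, w, u}" using axis_cases_distinct [OF d] by auto
  show ?thesis unfolding * using d by (simp add: mult.assoc)
qed

lemma distinct_nxt [simp]: "distinct [v, nxt v, nxt (nxt v)]"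
  by (cases v) auto

lemma ex_distinct_axes: "v \<noteq> w \<Longrightarrow> \<exists>u. distinct [v, w, u :: axis]"
proof -
  assume "v \<noteq> w"
  then have "distinct [v, w, Vx] \<or> distinct [v, w, Vy] \<or> distinct [v, w, Vz]"
    by (cases v; cases w) auto
  then show ?thesis by blast
qed

lemma axis_ext:
  assumes "distinct [v, w, u :: axis]" "lkp s v = lkp t v" "lkp s w = lkp t w" "lkp s u = lkp t u"
  shows "s = t"
proof (rule poly_mapping_eqI)
  fix k show "lkp s k = lkp t k"
    using axis_cases_distinct [OF assms(1), of k] assms(2-4) by auto
qed

lemma mdegree_axis: "distinct [v, w, u] \<Longrightarrow> mdegree t = lkp t v + lkp t w + lkp t (u :: axis)"
  using mdegree_superset [of UNIV t] axis_sum [of v w u "lkp t"] by (simp del: distinct.simps)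

definition bnd :: "nat \<Rightarrow> (axis \<Rightarrow>\<^sub>0 nat) \<Rightarrow> bool" where
  "bnd D t \<longleftrightarrow> mdegree t = D \<and> (\<exists>v. lkp t v = 0)"

lemma bnd_edge: "v \<noteq> w \<Longrightarrow> p + q = D \<Longrightarrow> bnd D (sg v p + sg w q)"
proof -
  assume "v \<noteq> w" "p + q = D"
  moreover obtain u where "distinct [v, w, u]" using ex_distinct_axes \<open>v \<noteq> w\<close> by blast
  ultimately show ?thesis
    by (auto simp: bnd_def mdegree_add lookup_add lookup_single when_def intro!: exI [of _ u])
qed

lemma bnd_vertex: "bnd D (sg v D)"
  using bnd_edge [of v "nxt v" D 0 D] by (cases v) auto

lemma bnd_edge_le: "v \<noteq> w \<Longrightarrow> p \<le> D \<Longrightarrow> bnd D (sg v p + sg w (D - p))"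
  by (rule bnd_edge) auto

lemma bnd_le: "bnd D t \<Longrightarrow> lkp t v \<le> D"
  using mdegree_axis [OF distinct_nxt, of t v] by (simp add: bnd_def)

lemma bnd_form:
  assumes "bnd D t" "distinct [v, w, u]"
  obtains "lkp t u = 0" "t = sg v (lkp t v) + sg w (D - lkp t v)"
  | "lkp t w = 0" "t = sg v (lkp t v) + sg u (D - lkp t v)"
  | "lkp t v = 0" "t = sg w (lkp t w) + sg u (D - lkp t w)"
proof -
  have deg: "lkp t v + lkp t w + lkp t u = D"
    using assms mdegree_axis [OF assms(2), of t] by (simp add: bnd_def)
  obtain k where k: "lkp t k = 0" using assms by (auto simp: bnd_def)
  have d: "v \<noteq> w" "w \<noteq> v" "u \<noteq> w" "w \<noteq> u" "u \<noteq> v" "v \<noteq> u" using assms by auto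
  show ?thesis
    using axis_cases_distinct [OF assms(2), of k]
  proof (elim disjE)
    assume "k = v"
    then show ?thesis using deg k d
      by (intro that(3) axis_ext [OF assms(2)]) (auto simp: lookup_add lookup_single)
  next
    assume "k = w"
    then show ?thesis using deg k d
      by (intro that(2) axis_ext [OF assms(2)]) (auto simp: lookup_add lookup_single)
  next
    assume "k = u"
    then show ?thesis using deg k d
      by (intro that(1) axis_ext [OF assms(2)]) (auto simp: lookup_add lookup_single)
  qed
qed

lemma bnd_form_pos:
  assumes "bnd D t" "lkp t v > 0"
  obtains w where "w \<noteq> v" "t = sg v (lkp t v) + sg w (D - lkp t v)"
proof -
  have n: "nxt v \<noteq> v" "nxt (nxt v) \<noteq> v" using distinct_nxt [of v] by auto
  show ?thesis
    by (rule bnd_form [OF assms(1) distinct_nxt [of v]])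
       (use that [OF n(1)] that [OF n(2)] assms(2) in \<open>blast | linarith\<close>)+
qed

lemma bnd_full: "bnd D t \<Longrightarrow> lkp t v = D \<Longrightarrow> t = sg v D"
proof -
  assume t: "bnd D t" "lkp t v = D"
  show "t = sg v D"
  proof (cases "D = 0")
    case True
    then show ?thesis using t by (simp add: bnd_def mdegree_eq_0_iff)
  next
    case False
    then obtain w where "t = sg v (lkp t v) + sg w (D - lkp t v)"
      using t bnd_form_pos [of D t v] by auto
    then show ?thesis using t by simp
  qed
qed

text \<open>Interior vectors are allowed. If one exponent reaches D, the other two sum to at most D
  and each goes to its own edge at that vertex. Otherwise the xy-edge takes all of x, topped up with
  y, and the rest of y fits with z on the yz-edge because x + y > D.\<close>

lemma decompose_two:
  assumes "mdegree s = 2 * D"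
  shows "\<exists>a b. bnd D a \<and> bnd D b \<and> a + b = s"
proof (cases "\<exists>v. lkp s v \<ge> D")
  case True
  then obtain v where v: "lkp s v \<ge> D" by blast
  define w u where "w = nxt v" and "u = nxt w"
  have d: "distinct [v, w, u]" unfolding u_def w_def by (rule distinct_nxt)
  then have d': "v \<noteq> w" "w \<noteq> v" "u \<noteq> w" "w \<noteq> u" "u \<noteq> v" "v \<noteq> u" by auto
  have deg: "lkp s v + lkp s w + lkp s u = 2 * D"
    using assms mdegree_axis [OF d, of s] by simp
  show ?thesis
  proof (intro exI conjI)
    show "bnd D (sg v (D - lkp s w) + sg w (lkp s w))"
      by (rule bnd_edge) (use d' deg v in auto)
    show "bnd D (sg v (D - lkp s u) + sg u (lkp s u))"
      by (rule bnd_edge) (use d' deg v in auto)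
    show "sg v (D - lkp s w) + sg w (lkp s w) + (sg v (D - lkp s u) + sg u (lkp s u)) = s"
      by (rule axis_ext [OF d]) (use d' deg v in \<open>auto simp: lookup_add lookup_single\<close>)
  qed
next
  case False
  then have lt: "lkp s v < D" for v by (meson not_le)
  have deg: "lkp s Vx + lkp s Vy + lkp s Vz = 2 * D"
    using assms mdegree_axis [of Vx Vy Vz s] by simp
  show ?thesis
  proof (intro exI conjI)
    show "bnd D (sg Vx (lkp s Vx) + sg Vy (D - lkp s Vx))"
      by (rule bnd_edge) (use lt [of Vx] in auto)
    show "bnd D (sg Vy (lkp s Vy - (D - lkp s Vx)) + sg Vz (lkp s Vz))"
      by (rule bnd_edge) (use deg lt [of Vx] lt [of Vz] in auto)
    show "sg Vx (lkp s Vx) + sg Vy (D - lkp s Vx) + (sg Vy (lkp s Vy - (D - lkp s Vx)) + sg Vz (lkp s Vz)) = s"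
      by (rule axis_ext [of Vx Vy Vz]) (use deg lt [of Vx] lt [of Vz] in \<open>auto simp: lookup_add lookup_single\<close>)
  qed
qed

lemma ex_large_exponent:
  fixes s :: "axis \<Rightarrow>\<^sub>0 nat"
  assumes "mdegree s = k * D" "k \<ge> 3"
  shows "\<exists>v. lkp s v \<ge> (D::nat)"
proof (rule ccontr)
  assume "\<not> ?thesis"
  then have lt: "lkp s v < D" for v by (meson not_le)
  have "3 * D \<le> k * D" using assms by (intro mult_right_mono) auto
  also have "k * D = lkp s Vx + lkp s Vy + lkp s Vz"
    using assms mdegree_axis [of Vx Vy Vz s] by simp
  finally show False using lt [of Vx] lt [of Vy] lt [of Vz] by linarith
qed

text \<open>For k = 1 the vector itself has to be a boundary vector; for k = 2 every vector
  decomposes. From k = 3 on a vertex can be removed, and k - 1 >= 2 never meets the restricted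
  case.\<close>

lemma decompose:
  assumes "mdegree s = k * D" "k = 1 \<longrightarrow> bnd D s"
  shows "\<exists>A. size A = k \<and> (\<forall>t\<in>#A. bnd D t) \<and> \<Sum>\<^sub># A = s"
  using assms
proof (induction k arbitrary: s rule: less_induct)
  case (less k)
  consider "k = 0" | "k = 1" | "k = 2" | "k \<ge> 3" by linarith
  then show ?case
  proof cases
    case 1
    then show ?thesis using less.prems by (auto simp: mdegree_eq_0_iff)
  next
    case 2
    then show ?thesis using less.prems by (intro exI [of _ "{#s#}"]) auto
  next
    case 3
    then obtain a b where "bnd D a" "bnd D b" "a + b = s"
      using less.prems decompose_two by blast
    then show ?thesis using 3 by (intro exI [of _ "{#a, b#}"]) auto
  next
    case 4
    then obtain v where v: "lkp s v \<ge> D" using ex_large_exponent less.prems by blast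
    define s' where "s' = s - sg v D"
    have s: "s = sg v D + s'"
      using v by (intro poly_mapping_eqI) (auto simp: s'_def lookup_add lookup_minus lookup_single when_def)
    have deg: "mdegree s' = (k - 1) * D"
      using less.prems s 4 by (simp add: mdegree_add diff_mult_distrib)
    have "k - 1 < k" "k - 1 = 1 \<longrightarrow> bnd D s'" using 4 by auto
    then obtain A where "size A = k - 1" "\<forall>t\<in>#A. bnd D t" "\<Sum>\<^sub># A = s'"
      using less.IH deg by blast
    moreover have "bnd D (sg v D)" by (rule bnd_vertex)
    ultimately show ?thesis using 4 s by (intro exI [of _ "add_mset (sg v D) A"]) auto
  qed
qed

subsection \<open>Connectivity by pairwise exchanges\<close>

text \<open>Moves on the fibres of the toric parametrization by the boundary monomials; each move
  corresponds to a binomial quadric in the coordinates. Connected fibres mean that these quadrics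
  generate all binomial relations.\<close>

inductive conn :: "nat \<Rightarrow> (axis \<Rightarrow>\<^sub>0 nat) multiset \<Rightarrow> (axis \<Rightarrow>\<^sub>0 nat) multiset \<Rightarrow> bool" for D where
  conn_refl: "conn D A A"
| conn_swap: "bnd D a \<Longrightarrow> bnd D b \<Longrightarrow> bnd D c \<Longrightarrow> bnd D d \<Longrightarrow> a + b = c + d
    \<Longrightarrow> conn D (add_mset c (add_mset d X)) B \<Longrightarrow> conn D (add_mset a (add_mset b X)) B"

lemma conn_trans: "conn D A B \<Longrightarrow> conn D B C \<Longrightarrow> conn D A C"
  by (induction rule: conn.induct) (auto intro: conn.intros)

lemma conn_swap1:
  "bnd D a \<Longrightarrow> bnd D b \<Longrightarrow> bnd D c \<Longrightarrow> bnd D d \<Longrightarrow> a + b = c + d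
    \<Longrightarrow> conn D (add_mset a (add_mset b X)) (add_mset c (add_mset d X))"
  by (rule conn_swap [OF _ _ _ _ _ conn_refl])

lemma conn_sym: "conn D A B \<Longrightarrow> conn D B A"
proof (induction rule: conn.induct)
  case (conn_swap a b c d X B)
  then show ?case using conn_trans conn_swap1 [of D c d a b X] by metis
qed (rule conn_refl)

lemma conn_add_mset: "conn D A B \<Longrightarrow> conn D (add_mset x A) (add_mset x B)"
proof (induction rule: conn.induct)
  case (conn_swap a b c d X B)
  show ?case
    using conn.conn_swap [of D a b c d "add_mset x X" "add_mset x B"] conn_swap
    by (simp add: add_mset_commute)
qed (rule conn_refl)

lemma conn_invariants:
  "conn D A B \<Longrightarrow> size A = size B \<and> \<Sum>\<^sub># A = \<Sum>\<^sub># B \<and> ((\<forall>t\<in>#A. bnd D t) \<longrightarrow> (\<forall>t\<in>#B. bnd D t))"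
proof (induction rule: conn.induct)
  case (conn_swap a b c d X B)
  have "\<Sum>\<^sub># (add_mset a (add_mset b X)) = (a + b) + \<Sum>\<^sub># X" by (simp add: add.assoc)
  also have "\<dots> = \<Sum>\<^sub># (add_mset c (add_mset d X))"
    unfolding conn_swap.hyps(5) by (simp add: add.assoc)
  finally have "\<Sum>\<^sub># (add_mset a (add_mset b X)) = \<Sum>\<^sub># B" using conn_swap.IH by metis
  then show ?case using conn_swap.IH conn_swap.hyps(1-4) by auto
qed simp

section \<open>Splitting off a vertex monomial by exchanges\<close>

definition reach :: "nat \<Rightarrow> axis \<Rightarrow> (axis \<Rightarrow>\<^sub>0 nat) multiset \<Rightarrow> bool" where
  "reach D v A \<longleftrightarrow> (\<exists>A'. conn D A (add_mset (sg v D) A'))"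

lemma reach_conn: "conn D A B \<Longrightarrow> reach D v B \<Longrightarrow> reach D v A"
  unfolding reach_def using conn_trans by blast

lemma reach_member: "sg v D \<in># A \<Longrightarrow> reach D v A"
  unfolding reach_def by (metis conn_refl multi_member_split)

lemma reach_swap:
  "bnd D a \<Longrightarrow> bnd D b \<Longrightarrow> bnd D c \<Longrightarrow> bnd D d \<Longrightarrow> a + b = c + d
    \<Longrightarrow> reach D v (add_mset c (add_mset d X)) \<Longrightarrow> reach D v (add_mset a (add_mset b X))"
  by (rule reach_conn [OF conn_swap1])

text \<open>Along one edge the exponents move freely between two factors: one is filled up to D and
  the other keeps p + j - D.\<close>

lemma reach_same_edge:
  assumes "v \<noteq> w" "p \<le> D" "j \<le> D" "p + j \<ge> D"
  shows "reach D v (add_mset (sg v p + sg w (D - p)) (add_mset (sg v j + sg w (D - j)) X))"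
proof (rule reach_swap)
  show "sg v p + sg w (D - p) + (sg v j + sg w (D - j)) =
    sg v D + (sg v (p + j - D) + sg w (D - (p + j - D)))"
    using assms by (intro poly_mapping_eqI) (auto simp: lookup_add lookup_single when_def)
  show "bnd D (sg v D)" by (rule bnd_vertex)
qed (use assms in \<open>auto intro: bnd_edge reach_member\<close>)

text \<open>Factors on different edges at v cannot be combined directly, since the remainder
  v^(p+i-D) w^(D-p) u^(D-i) may be interior. The factor with exponent j provides the missing
  freedom.\<close>

lemma reach_three:
  assumes d: "distinct [v, w, u]" and le: "p \<le> D" "i \<le> D" "j \<le> D" "p + i \<ge> D"
  shows "reach D v (add_mset (sg v p + sg w (D - p)) (add_mset (sg v j + sg w (D - j))
    (add_mset (sg v i + sg u (D - i)) X)))"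
proof (cases "p + j \<ge> D")
  case True
  then show ?thesis using le d by (intro reach_same_edge) auto
next
  case False
  have n: "v \<noteq> w" "w \<noteq> v" "u \<noteq> w" "w \<noteq> u" "u \<noteq> v" "v \<noteq> u" using d by auto
  show ?thesis
  proof (rule reach_swap)
    \<comment> \<open>Collecting the v-exponents p + j in one factor frees a full w^D, which then
      serves to move v^i from the edge vu to the edge vw.\<close>
    show "sg v p + sg w (D - p) + (sg v j + sg w (D - j)) =
        (sg v (p + j) + sg w (D - (p + j))) + sg w D"
      using False le n by (intro axis_ext [OF d]) (auto simp: lookup_add lookup_single)
    show "bnd D (sg w D)" by (rule bnd_vertex)
    have "reach D v (add_mset (sg w D) (add_mset (sg v i + sg u (D - i))
            (add_mset (sg v (p + j) + sg w (D - (p + j))) X)))"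
    proof (rule reach_swap)
      show "sg w D + (sg v i + sg u (D - i)) = (sg v i + sg w (D - i)) + (sg w i + sg u (D - i))"
        using le n by (intro axis_ext [OF d]) (auto simp: lookup_add lookup_single)
      show "bnd D (sg w D)" by fact
      have "reach D v (add_mset (sg v (p + j) + sg w (D - (p + j))) (add_mset (sg v i + sg w (D - i))
              (add_mset (sg w i + sg u (D - i)) X)))"
        using le False n by (intro reach_same_edge) auto
      then show "reach D v (add_mset (sg v i + sg w (D - i)) (add_mset (sg w i + sg u (D - i))
              (add_mset (sg v (p + j) + sg w (D - (p + j))) X)))"
        by (simp add: add_mset_commute)
    qed (use le n in \<open>auto intro: bnd_edge_le\<close>)
    then show "reach D v (add_mset (sg v (p + j) + sg w (D - (p + j)))
        (add_mset (sg w D) (add_mset (sg v i + sg u (D - i)) X)))"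
      by (simp add: add_mset_commute)
  qed (use le n False in \<open>auto intro: bnd_edge_le\<close>)
qed

text \<open>The third factor lies on the edge opposite to v and has enough u to trade u^(D-p) for
  w^(D-p). This brings the first factor onto the edge of v^i u^(D-i).\<close>

lemma reach_three_opposite:
  assumes d: "distinct [v, w, u]" and le: "p \<le> D" "i \<le> D" "q \<le> D" "p + i \<ge> D" "D - q \<ge> D - p"
  shows "reach D v (add_mset (sg v p + sg w (D - p)) (add_mset (sg w q + sg u (D - q))
    (add_mset (sg v i + sg u (D - i)) X)))"
proof (rule reach_swap)
  have n: "v \<noteq> w" "w \<noteq> v" "u \<noteq> w" "w \<noteq> u" "u \<noteq> v" "v \<noteq> u" using d by auto
  show "sg v p + sg w (D - p) + (sg w q + sg u (D - q)) =
     (sg v p + sg u (D - p)) + (sg w (D - p + q) + sg u (D - (D - p + q)))"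
    using le n by (intro axis_ext [OF d]) (auto simp: lookup_add lookup_single)
  have "reach D v (add_mset (sg v p + sg u (D - p)) (add_mset (sg v i + sg u (D - i))
      (add_mset (sg w (D - p + q) + sg u (D - (D - p + q))) X)))"
    using le n by (intro reach_same_edge) auto
  then show "reach D v (add_mset (sg v p + sg u (D - p)) (add_mset (sg w (D - p + q) + sg u (D - (D - p + q)))
      (add_mset (sg v i + sg u (D - i)) X)))"
    by (simp add: add_mset_commute)
qed (use d le in \<open>auto intro: bnd_edge\<close>)

lemma reach_pair:
  assumes b: "bnd D a" "bnd D b" "bnd D c" and ge: "lkp a v + lkp b v \<ge> D"
  shows "reach D v (add_mset a (add_mset b (add_mset c X)))"
proof (cases "lkp a v = D \<or> lkp b v = D")
  case True
  then show ?thesis using b bnd_full by (intro reach_member) auto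
next
  case False
  define p i where "p = lkp a v" and "i = lkp b v"
  have le: "p \<le> D" "i \<le> D" and pos: "0 < lkp a v" "0 < lkp b v"
    using False ge bnd_le [of D a v] bnd_le [of D b v] b by (auto simp: p_def i_def)
  obtain w where w: "w \<noteq> v" "a = sg v p + sg w (D - p)"
    using bnd_form_pos [OF b(1) pos(1)] unfolding p_def by blast
  obtain w' where w': "w' \<noteq> v" "b = sg v i + sg w' (D - i)"
    using bnd_form_pos [OF b(2) pos(2)] unfolding i_def by blast
  have ge': "p + i \<ge> D" using ge by (simp add: p_def i_def)
  show ?thesis
  proof (cases "w = w'")
    case True
    then show ?thesis using w w' le ge' reach_same_edge [of v w p D i] by auto
  next
    case False
    have d: "distinct [v, w, w']" and d': "distinct [v, w', w]" using False w w' by auto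
    show ?thesis
    proof (rule bnd_form [OF b(3) d])
      assume "c = sg v (lkp c v) + sg w (D - lkp c v)"
      then have "reach D v (add_mset a (add_mset c (add_mset b X)))"
        using reach_three [OF d le bnd_le [OF b(3), of v] ge', of X] w w' by simp
      then show ?thesis by (simp add: add_mset_commute)
    next
      assume "c = sg v (lkp c v) + sg w' (D - lkp c v)"
      then have "reach D v (add_mset b (add_mset c (add_mset a X)))"
        using reach_three [OF d' le(2,1) bnd_le [OF b(3), of v], of X] ge' w w' by (simp add: add.commute)
      then show ?thesis by (simp add: add_mset_commute)
    next
      assume c: "c = sg w (lkp c w) + sg w' (D - lkp c w)"
      define q where "q = lkp c w"
      have q: "q \<le> D" using b(3) bnd_le q_def by blast
      have c: "c = sg w q + sg w' (D - q)" using c by (simp add: q_def)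
      show ?thesis
      \<comment> \<open>Either the \<open>w'\<close>-part of c suffices to move a onto the edge of
        b, or q > p >= D - i and the \<open>w\<close>-part of c moves b onto the edge of a.\<close>
      proof (cases "D - q \<ge> D - p")
        case True
        then have "reach D v (add_mset a (add_mset c (add_mset b X)))"
          using reach_three_opposite [OF d le q ge', of X] w w' c by simp
        then show ?thesis by (simp add: add_mset_commute)
      next
        case False
        then have "D - (D - q) \<ge> D - i" using ge' le q by auto
        moreover have "c = sg w' (D - q) + sg w (D - (D - q))" using c q by (simp add: add.commute)
        ultimately have "reach D v (add_mset b (add_mset c (add_mset a X)))"
          using reach_three_opposite [OF d' le(2,1), of "D - q" X] ge' q w w' by (simp add: add.commute)
        then show ?thesis by (simp add: add_mset_commute)
      qed
    qed
  qed
qed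

text \<open>The v-exponent is accumulated in one factor \<open>a\<close>. While its sum with that of
  another factor stays below D, an exchange hands over the other one's whole v-exponent; once the
  sum reaches D, \<open>reach_pair\<close> finishes with any third factor.\<close>

lemma reach_sum:
  assumes "\<forall>t\<in>#A. bnd D t" "size A \<ge> 3" "lkp (\<Sum>\<^sub># A) v \<ge> D"
  shows "reach D v A"
proof (cases "D = 0")
  case True
  obtain a where a: "a \<in># A" using assms(2) by (metis gr_zeroI multiset_nonemptyE not_numeral_le_zero size_empty)
  then have "a = 0" using True assms by (auto simp: bnd_def mdegree_eq_0_iff)
  then show ?thesis using a True by (intro reach_member) simp
next
  case False
  have lsum: "lkp (\<Sum>\<^sub># X) v = (\<Sum>t\<in>#X. lkp t v)" for X :: "(axis \<Rightarrow>\<^sub>0 nat) multiset"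
    by (induction X) (auto simp: lookup_add)
  have "\<exists>a\<in>#A. lkp a v > 0"
  proof (rule ccontr)
    assume "\<not> ?thesis"
    then have "(\<Sum>t\<in>#A. lkp t v) = 0" by (induction A) auto
    moreover have "(\<Sum>t\<in>#A. lkp t v) \<ge> D" using assms(3) by (simp only: lsum)
    ultimately show False using False by linarith
  qed
  then obtain a where "a \<in># A" "lkp a v > 0" by blast
  then show ?thesis using assms
  proof (induction "D - lkp a v" arbitrary: a A rule: less_induct)
    case less
    have ba: "bnd D a" using less by auto
    show ?case
    proof (cases "lkp a v = D")
      case True
      then show ?thesis using less ba bnd_full reach_member by metis
    next
      case False
      define p where "p = lkp a v"
      have p: "p < D" "p > 0" using False bnd_le [OF ba, of v] less by (auto simp: p_def)
      obtain A1 where A1: "A = add_mset a A1" using less multi_member_split by metis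
      have "\<exists>b\<in>#A1. lkp b v > 0"
      proof (rule ccontr)
        assume "\<not> ?thesis"
        then have "(\<Sum>t\<in>#A1. lkp t v) = 0" by (induction A1) auto
        moreover have "p + (\<Sum>t\<in>#A1. lkp t v) \<ge> D"
          using less.prems(5) by (simp add: A1 lookup_add p_def lsum)
        ultimately show False using p by linarith
      qed
      then obtain b where b: "b \<in># A1" "lkp b v > 0" by blast
      define i where "i = lkp b v"
      obtain A2 where A2: "A1 = add_mset b A2" using b multi_member_split by metis
      have bb: "bnd D b" using less.prems A1 A2 by auto
      have i: "i \<le> D" "i > 0" using bb bnd_le b by (auto simp: i_def)
      have "A2 \<noteq> {#}" using less.prems A1 A2 by auto
      then obtain c A3 where A3: "A2 = add_mset c A3" by (metis multiset_cases)
      have bc: "bnd D c" using less.prems A1 A2 A3 by auto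
      show ?thesis
      proof (cases "p + i \<ge> D")
        case True
        then show ?thesis using reach_pair [OF ba bb bc, of v A3] A1 A2 A3 by (simp add: p_def i_def)
      next
        case small: False
        obtain w where w: "w \<noteq> v" "a = sg v p + sg w (D - p)"
          using bnd_form_pos [OF ba less.prems(2)] unfolding p_def by blast
        obtain w' where w': "w' \<noteq> v" "b = sg v i + sg w' (D - i)"
          using bnd_form_pos [OF bb b(2)] unfolding i_def by blast
        have "\<exists>y z. bnd D y \<and> bnd D z \<and> a + b = y + z \<and> lkp y v = p + i"
        proof (cases "w = w'")
          case True
          have "a + b = (sg v (p + i) + sg w (D - (p + i))) + sg w D"
            using w w' True small
            by (intro poly_mapping_eqI) (auto simp: lookup_add lookup_single when_def)
          moreover have "bnd D (sg w D)" by (rule bnd_vertex)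
          moreover have "bnd D (sg v (p + i) + sg w (D - (p + i)))"
            using small w by (intro bnd_edge_le) auto
          moreover have "lkp (sg v (p + i) + sg w (D - (p + i))) v = p + i"
            using w by (simp add: lookup_add lookup_single)
          ultimately show ?thesis by blast
        next
          case False
          have n: "v \<noteq> w" "w \<noteq> v" "w' \<noteq> w" "w \<noteq> w'" "w' \<noteq> v" "v \<noteq> w'" using w w' False by auto
          \<comment> \<open>The collected v-exponent stays on the edge of \<open>w'\<close>; the
            remainder w^(D-p) w'^p lies on the edge opposite to v.\<close>
          have "a + b = (sg v (p + i) + sg w' (D - (p + i))) + (sg w (D - p) + sg w' p)"
            using w w' n small p
            by (intro axis_ext [of v w w']) (auto simp: lookup_add lookup_single)
          moreover have "bnd D (sg v (p + i) + sg w' (D - (p + i)))"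
            using small n by (intro bnd_edge_le) auto
          moreover have "bnd D (sg w (D - p) + sg w' p)"
            using p n by (intro bnd_edge) auto
          moreover have "lkp (sg v (p + i) + sg w' (D - (p + i))) v = p + i"
            using n by (simp add: lookup_add lookup_single)
          ultimately show ?thesis by blast
        qed
        then obtain y z where yz: "bnd D y" "bnd D z" "a + b = y + z" "lkp y v = p + i" by blast
        have "reach D v (add_mset y (add_mset z A2))"
        proof (rule less.hyps [of y])
          show "D - lkp y v < D - lkp a v" using yz(4) i p small by (simp add: p_def)
          show "lkp (\<Sum>\<^sub># (add_mset y (add_mset z A2))) v \<ge> D"
            using less.prems(5) yz(3) A1 A2 by (simp add: add.assoc [symmetric])
        qed (use less.prems(3,4) yz(1,2,4) A1 A2 p in auto)
        then show ?thesis
          unfolding A1 A2 by (rule reach_swap [OF ba bb yz(1-3)])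
      qed
    qed
  qed
qed

text \<open>Two factors are one exchange apart. With more, the common sum has an exponent of at
  least D at some v, so both multisets can be brought to contain x_v^D; removing it leaves smaller
  multisets with equal sums.\<close>

theorem conn_iff_same_sum:
  assumes "\<forall>t\<in>#A. bnd D t" "\<forall>t\<in>#B. bnd D t" "size A = size B" "\<Sum>\<^sub># A = \<Sum>\<^sub># B"
  shows "conn D A B"
  using assms
proof (induction "size A" arbitrary: A B)
  case 0
  then show ?case by (simp add: conn_refl)
next
  case (Suc n)
  consider "n = 0" | "n = 1" | "n \<ge> 2" by linarith
  then show ?case
  proof cases
    case 1
    then obtain a b where "A = {#a#}" "B = {#b#}"
      using Suc.hyps(2) Suc.prems(3) size_1_singleton_mset by (metis One_nat_def)
    then show ?thesis using Suc.prems by (simp add: conn_refl)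
  next
    case 2
    have pair: "\<exists>a b. X = {#a, b#}" if X: "size X = Suc 1" for X :: "(axis \<Rightarrow>\<^sub>0 nat) multiset"
    proof -
      obtain a X' where "X = add_mset a X'" "size X' = 1"
        using size_eq_Suc_imp_eq_union [OF X] X by auto
      then show ?thesis using size_1_singleton_mset by blast
    qed
    have "size A = Suc 1" "size B = Suc 1" using 2 Suc.hyps(2) Suc.prems(3) by auto
    then obtain a b c d where "A = {#a, b#}" "B = {#c, d#}"
      using pair by meson
    then show ?thesis using Suc.prems by (auto intro: conn_swap1)
  next
    case 3
    have "mdegree (\<Sum>\<^sub># A) = size A * D"
      using Suc.prems(1) by (induction A) (auto simp: mdegree_add bnd_def)
    then obtain v where v: "lkp (\<Sum>\<^sub># A) v \<ge> D" using 3 Suc.hyps(2) ex_large_exponent [of _ "size A" D] by force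
    have "reach D v A" "reach D v B"
      using v Suc 3 by (auto intro!: reach_sum)
    then obtain A' B' where AB: "conn D A (add_mset (sg v D) A')" "conn D B (add_mset (sg v D) B')"
      unfolding reach_def by blast
    have "conn D A' B'"
    proof (rule Suc.hyps(1))
    qed (use conn_invariants [OF AB(1)] conn_invariants [OF AB(2)] Suc in auto)
    then show ?thesis using AB conn_add_mset conn_sym conn_trans by metis
  qed
qed

section \<open>The parametrization and normal forms\<close>

abbreviation cring_of :: "nat \<Rightarrow> coord mpoly ring" where
  "cring_of m \<equiv> mpoly_ring (coords m)"

text \<open>Defined over any commutative ring, so that the parametrization also applies to
  polynomial curves; the cyclic \<open>nxt\<close> covers the three G's by one formula.\<close>

fun cval :: "nat \<Rightarrow> (axis \<Rightarrow> 'a::comm_ring_1) \<Rightarrow> coord \<Rightarrow> 'a" where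
  "cval m a (CoordG v) =
     a (nxt v) * a (nxt (nxt v)) * (a (nxt v) ^ m - (- a (nxt (nxt v))) ^ m)"
| "cval m a (CoordL t) = (\<Prod>v\<in>UNIV. a v) * mval a t"

definition pull :: "nat \<Rightarrow> coord mpoly \<Rightarrow> (axis \<Rightarrow> complex) \<Rightarrow> complex" where
  "pull m F a = eval_mpoly (cval m a) F"

lemmas pull_hom = eval_mpoly_hom [of "cval m a" for m a, folded pull_def]

lemma pull_cnst [simp]: "pull m (cnst c) a = c" by (simp add: pull_def)
lemma pull_0 [simp]: "pull m 0 a = 0" by (simp add: pull_def)
lemma pull_1 [simp]: "pull m 1 a = 1" by (simp add: pull_def)
lemma pull_var [simp]: "pull m (var c) a = cval m a c" by (simp add: pull_def)
lemma pull_numeral [simp]: "pull m (numeral n) a = numeral n" by (simp add: pull_def)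

lemma UNIV_prod_axis: "(\<Prod>v\<in>UNIV. f v) = f Vx * f Vy * f Vz"
  by (rule axis_prod) simp

lemma mval_axis: "mval a t = (\<Prod>v\<in>(UNIV::axis set). a v ^ lkp t v)"
  by (rule mval_superset) auto

lemma xyz_dvd_iff: "var Vx * var Vy * var Vz dvd mmonom t \<longleftrightarrow> (\<forall>v. lkp t v \<noteq> 0)"
proof
  assume "var Vx * var Vy * var Vz dvd mmonom t"
  then obtain q where q: "mmonom t = var Vx * var Vy * var Vz * q" by (auto simp: dvd_def)
  show "\<forall>v. lkp t v \<noteq> 0"
  proof (rule allI, rule notI)
    fix v assume v: "lkp t v = 0"
    define a :: "axis \<Rightarrow> complex" where "a = (\<lambda>w. if w = v then 0 else 1)"
    have "eval_mpoly a (mmonom t) = 1"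
      unfolding eval_mpoly_mmonom mval_axis by (rule prod.neutral) (auto simp: a_def v)
    moreover have "eval_mpoly a (var Vx * var Vy * var Vz * q) = 0"
      by (cases v) (auto simp: eval_mpoly_mult a_def)
    ultimately show False using q by simp
  qed
next
  assume "\<forall>v. lkp t v \<noteq> 0"
  then have "t = sg Vx 1 + sg Vy 1 + sg Vz 1 + (t - (sg Vx 1 + sg Vy 1 + sg Vz 1))"
    by (intro axis_ext [of Vx Vy Vz]) (auto simp: lookup_add lookup_minus lookup_single Suc_leI)
  then have "mmonom t = var Vx * var Vy * var Vz * mmonom (t - (sg Vx 1 + sg Vy 1 + sg Vz 1))"
    unfolding var_def by (metis mmonom_add)
  then show "var Vx * var Vy * var Vz dvd mmonom t" by simp
qed

lemma CoordG_in_coords [simp]: "CoordG v \<in> coords m"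
  by (cases v) (auto simp: coords_def)

lemma CoordL_in_coords: "CoordL t \<in> coords m \<longleftrightarrow> bnd (m - 1) t"
  by (auto simp: coords_def bnd_def xyz_dvd_iff)

lemma coord_form_eval: "eval_mpoly a (coord_form m c) = cval m a c"
proof (cases c)
  case (CoordG v)
  then show ?thesis by (cases v) (auto simp: eval_mpoly_hom)
next
  case (CoordL t)
  then show ?thesis by (simp add: eval_mpoly_hom eval_mpoly_mmonom UNIV_prod_axis)
qed

lemma phi_eq: "c \<in> coords m \<Longrightarrow> phi m a c = cval m a c"
  by (simp add: phi_def coord_form_eval)

lemma eval_mpoly_cong:
  assumes "F \<in> carrier (mpoly_ring V)" "\<And>v. v \<in> V \<Longrightarrow> a v = b v"
  shows "eval_mpoly a F = eval_mpoly b F"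
proof -
  have "a v = b v" if "t \<in> kys F" "v \<in> kys t" for t v
    using that assms by (auto simp: carrier_mpoly_iff)
  then show ?thesis
    unfolding eval_mpoly_def by (intro sum.cong arg_cong2 [of _ _ _ _ "(*)"] refl prod.cong) auto
qed

lemma eval_phi: "F \<in> carrier (cring_of m) \<Longrightarrow> eval_mpoly (phi m a) F = pull m F a"
  unfolding pull_def by (rule eval_mpoly_cong) (auto simp: phi_eq)

lemma eval_form_scale:
  assumes "F \<in> forms V d"
  shows "eval_mpoly (\<lambda>v. c * a v) F = c ^ d * eval_mpoly a F"
proof -
  have "mval (\<lambda>v. c * a v) t = c ^ mdegree t * mval a t" for t
    by (simp add: mval_def mdegree_def power_mult_distrib prod.distrib power_sum)
  then show ?thesis
    using assms by (simp add: eval_mpoly_superset [OF finite_keys order_refl] forms_iff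
      sum_distrib_left algebra_simps cong: sum.cong)
qed

lemma finite_mdegree: "finite V \<Longrightarrow> finite {t. kys t \<subseteq> V \<and> mdegree t = d}"
proof -
  assume V: "finite V"
  have "{t. kys t \<subseteq> V \<and> mdegree t = d} \<subseteq> Abs_poly_mapping ` {f. \<forall>v. (v \<in> V \<longrightarrow> f v \<in> {..d}) \<and> (v \<notin> V \<longrightarrow> f v = 0)}"
  proof
    fix t :: "'a \<Rightarrow>\<^sub>0 nat" assume t: "t \<in> {t. kys t \<subseteq> V \<and> mdegree t = d}"
    have le: "lkp t v \<le> mdegree t" for v
      unfolding mdegree_def by (cases "v \<in> kys t") (auto intro: member_le_sum simp: in_keys_iff)
    have "lkp t v = 0" if "v \<notin> V" for v using t that by (auto simp: in_keys_iff)
    then show "t \<in> Abs_poly_mapping ` {f. \<forall>v. (v \<in> V \<longrightarrow> f v \<in> {..d}) \<and> (v \<notin> V \<longrightarrow> f v = 0)}"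
      using t le by (intro image_eqI [of _ _ "lkp t"]) auto
  qed
  then show ?thesis
    by (rule finite_surj [OF finite_set_of_finite_funs [OF V finite_atMost]])
qed

lemma finite_coords: "finite (coords m)"
proof -
  have "finite {t::axis \<Rightarrow>\<^sub>0 nat. mdegree t = m - 1}"
    using finite_mdegree [of "UNIV :: axis set"] by simp
  then have "finite (CoordL ` {t. mdegree t = m - 1})" by simp
  moreover have "coords m \<subseteq> CoordG ` UNIV \<union> CoordL ` {t. mdegree t = m - 1}"
    by (auto simp: coords_def)
  ultimately show ?thesis using finite_subset by (metis finite finite_UnI finite_imageI)
qed

subsection \<open>Products of coordinates\<close>

definition gmon :: "axis multiset \<Rightarrow> coord mpoly" where
  "gmon g = (\<Prod>v\<in>#g. var (CoordG v))"

definition lmon :: "(axis \<Rightarrow>\<^sub>0 nat) multiset \<Rightarrow> coord mpoly" where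
  "lmon A = (\<Prod>t\<in>#A. var (CoordL t))"

lemma gmon_simps [simp]: "gmon {#} = 1" "gmon (add_mset v g) = var (CoordG v) * gmon g"
  by (simp_all add: gmon_def)

lemma lmon_simps [simp]: "lmon {#} = 1" "lmon (add_mset t A) = var (CoordL t) * lmon A"
  by (simp_all add: lmon_def)

lemma gmon_form: "gmon g \<in> forms (coords m) (size g)"
proof (induction g)
  case (add v g)
  then show ?case using forms_mult [OF var_in_forms [OF CoordG_in_coords [of v m]]] by simp
qed (use mmonom_in_forms [of 0] in simp)

lemma lmon_form: "\<forall>t\<in>#A. bnd (m - 1) t \<Longrightarrow> lmon A \<in> forms (coords m) (size A)"
proof (induction A)
  case (add t A)
  then show ?case using forms_mult [OF var_in_forms [of "CoordL t" "coords m"]]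
    by (simp add: CoordL_in_coords)
qed (use mmonom_in_forms [of 0] in simp)

lemma glmon_form:
  "\<forall>t\<in>#A. bnd (m - 1) t \<Longrightarrow> gmon g * lmon A \<in> forms (coords m) (size g + size A)"
  by (intro forms_mult gmon_form lmon_form)

lemma pull_gmon: "pull m (gmon g) a = (\<Prod>v\<in>#g. cval m a (CoordG v))"
  by (induction g) (auto simp: pull_hom)

lemma pull_lmon: "pull m (lmon A) a = (\<Prod>v\<in>UNIV. a v) ^ size A * mval a (\<Sum>\<^sub># A)"
  by (induction A) (auto simp: pull_hom mval_add)

lemma mmonom_as_product:
  assumes "kys t \<subseteq> coords m" "mdegree t = d"
  shows "\<exists>g A. mmonom t = gmon g * lmon A \<and> size g + size A = d \<and> (\<forall>t\<in>#A. bnd (m - 1) t)"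
  using assms
proof (induction d arbitrary: t)
  case 0
  then show ?case by (auto simp: mdegree_eq_0_iff intro!: exI [of _ "{#}"])
next
  case (Suc d)
  then have "t \<noteq> 0" by auto
  then obtain c t' where c: "c \<in> kys t" "kys t' \<subseteq> kys t" and t: "t = sg c 1 + t'"
    by (rule split_key)
  then obtain g A where gA: "mmonom t' = gmon g * lmon A" "size g + size A = d" "\<forall>t\<in>#A. bnd (m - 1) t"
    using Suc.IH [of t'] Suc.prems t by (auto simp: mdegree_add)
  have mt: "mmonom t = var c * (gmon g * lmon A)"
    using t gA(1) by (simp add: mmonom_add var_def)
  show ?case
  proof (cases c)
    case (CoordG v)
    then show ?thesis using gA mt by (intro exI [of _ "add_mset v g"] exI [of _ A]) auto
  next
    case (CoordL s)
    then have "bnd (m - 1) s" using c(1) Suc.prems CoordL_in_coords by blast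
    then show ?thesis using CoordL gA mt
      by (intro exI [of _ g] exI [of _ "add_mset s A"]) (auto simp: algebra_simps)
  qed
qed

subsection \<open>Normal forms\<close>

text \<open>\<open>g\<close> lists the G-factors, and of the \<open>d - size g\<close> factors xyz
  lambda only the total exponent \<open>s\<close> is kept, since by \<open>conn_iff_same_sum\<close>
  the factorization is irrelevant. A single such factor imposes the boundary condition; from two on
  every \<open>s\<close> factors, by \<open>decompose\<close>. The last two conditions exclude G_x
  G_y G_z and the products G_v xyz lambda with x_v dividing lambda.\<close>

definition nkeys :: "nat \<Rightarrow> nat \<Rightarrow> (axis multiset \<times> (axis \<Rightarrow>\<^sub>0 nat)) set" where
  "nkeys m d = {(g, s). size g \<le> d \<and> mdegree s = (d - size g) * (m - 1) \<and>
     (d - size g = 1 \<longrightarrow> bnd (m - 1) s) \<and> (\<exists>v. v \<notin># g) \<and> (\<forall>v\<in>#g. lkp s v = 0)}"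

definition lrep :: "nat \<Rightarrow> nat \<Rightarrow> (axis \<Rightarrow>\<^sub>0 nat) \<Rightarrow> (axis \<Rightarrow>\<^sub>0 nat) multiset" where
  "lrep m k s = (SOME A. size A = k \<and> (\<forall>t\<in>#A. bnd (m - 1) t) \<and> \<Sum>\<^sub># A = s)"

definition nrep :: "nat \<Rightarrow> nat \<Rightarrow> axis multiset \<times> (axis \<Rightarrow>\<^sub>0 nat) \<Rightarrow> coord mpoly" where
  "nrep m d = (\<lambda>(g, s). gmon g * lmon (lrep m (d - size g) s))"

lemma lrep:
  assumes "(g, s) \<in> nkeys m d"
  shows size_lrep: "size (lrep m (d - size g) s) = d - size g"
    and bnd_lrep: "\<forall>t\<in>#lrep m (d - size g) s. bnd (m - 1) t"
    and sum_lrep: "\<Sum>\<^sub># (lrep m (d - size g) s) = s"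
  using someI_ex [OF decompose [of s "d - size g" "m - 1"]] assms
  by (auto simp: nkeys_def lrep_def)

lemma nrep_form: "k \<in> nkeys m d \<Longrightarrow> nrep m d k \<in> forms (coords m) d"
proof (cases k)
  fix g s assume k: "k \<in> nkeys m d" "k = (g, s)"
  then have "size g + (d - size g) = d" by (auto simp: nkeys_def)
  then show ?thesis
    using glmon_form [OF bnd_lrep, of g s m d g] k size_lrep [of g s m d] by (simp add: nrep_def)
qed

lemma pull_nrep:
  assumes "(g, s) \<in> nkeys m d"
  shows "pull m (nrep m d (g, s)) a =
    (\<Prod>v\<in>#g. cval m a (CoordG v)) * (\<Prod>v\<in>UNIV. a v) ^ (d - size g) * mval a s"
  using assms by (simp add: nrep_def pull_hom pull_gmon pull_lmon size_lrep sum_lrep)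

text \<open>Writing x^m as x times x^(m-1) and treating x^(m-1), y^(m-1), z^(m-1) as letters removes
  the exponent. What is left is, for each parity, a polynomial identity in six letters.\<close>

lemma cubic_C_vanishes: assumes "m \<ge> 1" shows "pull m (cubic_C m) a = 0"
proof -
  obtain n where m: "m = Suc n" using assms by (cases m) auto
  define x y z where "x = a Vx" and "y = a Vy" and "z = a Vz"
  define X Y Z where "X = x ^ n" and "Y = y ^ n" and "Z = z ^ n"
  have pw: "x ^ m = x * X" "y ^ m = y * Y" "z ^ m = z * Z"
    by (simp_all add: m X_def Y_def Z_def)
  have H: "cval m a (coordH m Vx) = x * y * z * X" "cval m a (coordH m Vy) = x * y * z * Y"
    "cval m a (coordH m Vz) = x * y * z * Z"
    by (simp_all add: coordH_def UNIV_prod_axis m X_def Y_def Z_def x_def y_def z_def)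
  show ?thesis
  proof (cases "odd m")
    case True
    then have G: "cval m a (CoordG Vx) = y * z * (y * Y + z * Z)" "cval m a (CoordG Vy) = z * x * (z * Z + x * X)"
      "cval m a (CoordG Vz) = x * y * (x * X + y * Y)"
      by (simp_all add: power_minus_odd pw flip: x_def y_def z_def)
    have "pull m (cubic_C m) a =
      2 * (x * y * z * X) * (x * y * z * Y) * (x * y * z * Z)
      + (y * z * (y * Y + z * Z)) * (x * y * z * Y) * (x * y * z * Z)
      + (x * y * z * X) * (z * x * (z * Z + x * X)) * (x * y * z * Z)
      + (x * y * z * X) * (x * y * z * Y) * (x * y * (x * X + y * Y))
      - (y * z * (y * Y + z * Z)) * (z * x * (z * Z + x * X)) * (x * y * (x * X + y * Y))"
      using True by (simp only: cubic_C_def Let_def if_True not_False_eq_True pull_hom pull_var pull_numeral H G)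
    also have "\<dots> = 0" by (simp add: algebra_simps)
    finally show ?thesis .
  next
    case False
    then have G: "cval m a (CoordG Vx) = y * z * (y * Y - z * Z)" "cval m a (CoordG Vy) = z * x * (z * Z - x * X)"
      "cval m a (CoordG Vz) = x * y * (x * X - y * Y)"
      by (simp_all add: pw flip: x_def y_def z_def)
    have "pull m (cubic_C m) a =
      (y * z * (y * Y - z * Z)) * (x * y * z * Y) * (x * y * z * Z)
      + (x * y * z * X) * (z * x * (z * Z - x * X)) * (x * y * z * Z)
      + (x * y * z * X) * (x * y * z * Y) * (x * y * (x * X - y * Y))
      + (y * z * (y * Y - z * Z)) * (z * x * (z * Z - x * X)) * (x * y * (x * X - y * Y))"
      using False by (simp only: cubic_C_def Let_def if_False pull_hom pull_var pull_numeral H G)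
    also have "\<dots> = 0" by (simp add: algebra_simps)
    finally show ?thesis .
  qed
qed

lemma cubic_C_form: assumes "m \<ge> 1" shows "cubic_C m \<in> forms (coords m) 3"
proof -
  have H: "coordH m v \<in> coords m" for v
    by (simp add: coordH_def CoordL_in_coords bnd_vertex)
  have 3: "var a * var b * var c \<in> forms (coords m) 3"
    if "a \<in> coords m" "b \<in> coords m" "c \<in> coords m" for a b c
    using forms_mult [OF forms_mult [OF var_in_forms [OF that(1)] var_in_forms [OF that(2)]] var_in_forms [OF that(3)]]
    by (simp add: numeral_3_eq_3)
  have 2: "2 * var a * var b * var c = cnst 2 * (var a * var b * var c)" for a b c :: coord
    by (simp add: cnst_def algebra_simps)
  show ?thesis
    unfolding cubic_C_def Let_def 2
    by (auto intro!: mpv.subspace_add mpv.subspace_diff mpv.subspace_scale forms_subspace 3 H)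
qed

section \<open>Reduction to normal forms modulo an ideal containing the quadrics and the
  cubic\<close>

locale presentation =
  fixes m :: nat and J :: "coord mpoly set"
  assumes m: "m \<ge> 2"
    and J: "ideal J (cring_of m)"
    and quadrics: "\<And>F. F \<in> forms (coords m) 2 \<Longrightarrow> (\<And>a. pull m F a = 0) \<Longrightarrow> F \<in> J"
    and cubic: "cubic_C m \<in> J"
begin

definition normalizable :: "nat \<Rightarrow> coord mpoly set" where
  "normalizable d = {p. \<exists>q\<in>mpspan (nrep m d ` nkeys m d). p - q \<in> J}"

lemma normalizable_subspace: "mpv.subspace (normalizable d)"
  unfolding mpv.subspace_def
proof (intro conjI ballI allI)
  show "0 \<in> normalizable d"
    using mpoly_ideal_zero [OF J] mpv.span_zero by (force simp: normalizable_def)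
next
  fix p q assume "p \<in> normalizable d" "q \<in> normalizable d"
  then obtain p' q' where pq: "p' \<in> mpspan (nrep m d ` nkeys m d)" "q' \<in> mpspan (nrep m d ` nkeys m d)"
      "p - p' \<in> J" "q - q' \<in> J" by (auto simp: normalizable_def)
  have "p + q - (p' + q') \<in> J"
    using mpoly_ideal_add [OF J pq(3,4)] by (simp add: algebra_simps)
  then show "p + q \<in> normalizable d"
    using mpv.span_add [OF pq(1,2)] by (auto simp: normalizable_def)
next
  fix c p assume "p \<in> normalizable d"
  then obtain p' where p: "p' \<in> mpspan (nrep m d ` nkeys m d)" "p - p' \<in> J"
    by (auto simp: normalizable_def)
  have "cnst c * p - cnst c * p' \<in> J"
    using mpoly_ideal_cnst [OF J p(2), of c] by (simp add: algebra_simps)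
  then show "cnst c * p \<in> normalizable d"
    using mpv.span_scale [OF p(1), of c] by (auto simp: normalizable_def)
qed

lemma normalizable_cong: "p - q \<in> J \<Longrightarrow> q \<in> normalizable d \<Longrightarrow> p \<in> normalizable d"
proof -
  assume pq: "p - q \<in> J" "q \<in> normalizable d"
  then obtain r where r: "r \<in> mpspan (nrep m d ` nkeys m d)" "q - r \<in> J"
    by (auto simp: normalizable_def)
  have "p - r \<in> J" using mpoly_ideal_add [OF J pq(1) r(2)] by simp
  then show ?thesis using r by (auto simp: normalizable_def)
qed

text \<open>Each exchange changes the product by a multiple of a binomial quadric, which the
  parametrization kills because a + b = c + d.\<close>

lemma lmon_conn: "conn (m - 1) A B \<Longrightarrow> (\<forall>t\<in>#A. bnd (m - 1) t) \<Longrightarrow> lmon A - lmon B \<in> J"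
proof (induction rule: conn.induct)
  case (conn_refl A)
  then show ?case using mpoly_ideal_zero [OF J] by simp
next
  case (conn_swap a b c d X B)
  have f: "lmon {#a, b#} \<in> forms (coords m) 2" "lmon {#c, d#} \<in> forms (coords m) 2"
    using lmon_form [of "{#a, b#}" m] lmon_form [of "{#c, d#}" m] conn_swap.hyps
    by (auto simp: numeral_2_eq_2)
  have "lmon {#a, b#} - lmon {#c, d#} \<in> J"
    using f conn_swap.hyps(5)
    by (intro quadrics mpv.subspace_diff [OF forms_subspace]) (auto simp: pull_hom pull_lmon simp del: lmon_simps)
  moreover have "lmon X \<in> carrier (cring_of m)"
    using conn_swap.prems lmon_form [of X m] forms_carrier by auto
  ultimately have "lmon X * (lmon {#a, b#} - lmon {#c, d#}) \<in> J"
    using mpoly_ideal_mult [OF J] by blast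
  moreover have "lmon (add_mset c (add_mset d X)) - lmon B \<in> J"
    using conn_swap by auto
  ultimately have "lmon X * (lmon {#a, b#} - lmon {#c, d#}) + (lmon (add_mset c (add_mset d X)) - lmon B) \<in> J"
    by (rule mpoly_ideal_add [OF J])
  then show ?case by (simp add: algebra_simps)
qed

text \<open>If \<open>x_v\<close> divides \<open>\<lambda>\<close>, both terms of \<open>G_v \<sqdot> xyz\<lambda>\<close> are divisible by \<open>(xyz)\<^sup>2\<close>.\<close>

lemma straighten_GL:
  assumes "bnd (m - 1) t" "lkp t v > 0"
  obtains B C c where "size B = 2" "size C = 2" "\<forall>t\<in>#B. bnd (m - 1) t" "\<forall>t\<in>#C. bnd (m - 1) t"
    "var (CoordG v) * var (CoordL t) - (lmon B - cnst c * lmon C) \<in> J"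
proof -
  define w u where "w = nxt v" and "u = nxt w"
  have d: "distinct [v, w, u]" unfolding u_def w_def by (rule distinct_nxt)
  define t' where "t' = t - sg v 1"
  have t: "t = sg v 1 + t'"
    using assms(2) by (intro poly_mapping_eqI) (auto simp: t'_def lookup_add lookup_minus lookup_single when_def)
  \<comment> \<open>The two terms of the product are, up to sign, (xyz)^2 x_k^m t' with k = w and k
    = u; the degree m + (m - 2) is exactly that of two boundary monomials.\<close>
  have deg: "mdegree (t' + sg k m) = 2 * (m - 1)" for k
    using assms(1) t m by (auto simp: mdegree_add bnd_def)
  obtain b1 b2 where b: "bnd (m - 1) b1" "bnd (m - 1) b2" "b1 + b2 = t' + sg w m"
    using decompose_two [OF deg] by blast
  obtain c1 c2 where c: "bnd (m - 1) c1" "bnd (m - 1) c2" "c1 + c2 = t' + sg u m"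
    using decompose_two [OF deg] by blast
  show thesis
  proof (rule that [of "{#b1, b2#}" "{#c1, c2#}" "(-1) ^ m"])
    have 1: "var (CoordG v) * var (CoordL t) \<in> forms (coords m) 2"
      using forms_mult [OF var_in_forms [OF CoordG_in_coords [of v m]] var_in_forms [of "CoordL t" "coords m"]]
      assms by (simp add: CoordL_in_coords numeral_2_eq_2)
    have 2: "lmon {#b1, b2#} \<in> forms (coords m) 2" "lmon {#c1, c2#} \<in> forms (coords m) 2"
      using lmon_form [of "{#b1, b2#}" m] lmon_form [of "{#c1, c2#}" m] b c by (auto simp: numeral_2_eq_2)
    show "var (CoordG v) * var (CoordL t) - (lmon {#b1, b2#} - cnst ((- 1) ^ m) * lmon {#c1, c2#}) \<in> J" (is "?q \<in> J")
    proof (rule quadrics)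
      show "?q \<in> forms (coords m) 2"
        using 1 2 by (intro mpv.subspace_diff mpv.subspace_scale forms_subspace)
      fix a :: "axis \<Rightarrow> complex"
      have P: "(\<Prod>v\<in>UNIV. a v) = a v * a w * a u" by (rule axis_prod [OF d])
      have "pull m (var (CoordG v) * var (CoordL t)) a =
          a w * a u * (a w ^ m - (- a u) ^ m) * ((a v * a w * a u) * (a v * mval a t'))"
        unfolding t by (simp add: pull_hom mval_add P flip: w_def u_def)
      moreover have "pull m (lmon {#b1, b2#}) a = (a v * a w * a u) ^ 2 * (mval a t' * a w ^ m)"
        using b(3) by (simp add: pull_lmon P mval_add numeral_2_eq_2 flip: mval_add [of a b1 b2] del: lmon_simps)
      moreover have "pull m (lmon {#c1, c2#}) a = (a v * a w * a u) ^ 2 * (mval a t' * a u ^ m)"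
        using c(3) by (simp add: pull_lmon P mval_add numeral_2_eq_2 flip: mval_add [of a c1 c2] del: lmon_simps)
      ultimately show "pull m (?q) a = 0"
        unfolding pull_hom(1-3) pull_cnst
        by (simp add: power2_eq_square power_minus [of "a u"] algebra_simps del: lmon_simps)
    qed
  qed (use b c in auto)
qed

text \<open>The cubic solved for G_x G_y G_z, in one shape for both parities: (e, f) is (2, 1) for
  odd m and (0, -1) for even m.\<close>

lemma cubic_relation:
  obtains e f where
    "gmon {#Vx, Vy, Vz#} - (cnst e * lmon {#sg Vx (m-1), sg Vy (m-1), sg Vz (m-1)#}
      + cnst f * (gmon {#Vx#} * lmon {#sg Vy (m-1), sg Vz (m-1)#})
      + cnst f * (gmon {#Vy#} * lmon {#sg Vx (m-1), sg Vz (m-1)#})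
      + cnst f * (gmon {#Vz#} * lmon {#sg Vx (m-1), sg Vy (m-1)#})) \<in> J"
proof (cases "odd m")
  case True
  have "gmon {#Vx, Vy, Vz#} - (cnst 2 * lmon {#sg Vx (m-1), sg Vy (m-1), sg Vz (m-1)#}
      + cnst 1 * (gmon {#Vx#} * lmon {#sg Vy (m-1), sg Vz (m-1)#})
      + cnst 1 * (gmon {#Vy#} * lmon {#sg Vx (m-1), sg Vz (m-1)#})
      + cnst 1 * (gmon {#Vz#} * lmon {#sg Vx (m-1), sg Vy (m-1)#})) = - cubic_C m"
    using True by (simp add: cubic_C_def Let_def coordH_def cnst_def algebra_simps)
  then show ?thesis using that mpoly_ideal_uminus [OF J cubic] by metis
next
  case False
  have "gmon {#Vx, Vy, Vz#} - (cnst 0 * lmon {#sg Vx (m-1), sg Vy (m-1), sg Vz (m-1)#}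
      + cnst (-1) * (gmon {#Vx#} * lmon {#sg Vy (m-1), sg Vz (m-1)#})
      + cnst (-1) * (gmon {#Vy#} * lmon {#sg Vx (m-1), sg Vz (m-1)#})
      + cnst (-1) * (gmon {#Vz#} * lmon {#sg Vx (m-1), sg Vy (m-1)#})) = cubic_C m"
    using False by (simp add: cubic_C_def Let_def coordH_def cnst_uminus algebra_simps)
  then show ?thesis using that cubic by metis
qed

text \<open>Both rewriting rules preserve the degree and replace G-factors by factors xyz lambda, so
  the number of G's decreases. A product to which neither rule applies has a key in
  \<open>nkeys\<close> and differs from the chosen representative only by exchanges.\<close>

lemma glmon_normalizable:
  "(\<forall>t\<in>#A. bnd (m - 1) t) \<Longrightarrow> gmon g * lmon A \<in> normalizable (size g + size A)"
proof (induction "size g" arbitrary: g A rule: less_induct)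
  case less
  have carr: "gmon g' * lmon A' \<in> carrier (cring_of m)" if "\<forall>t\<in>#A'. bnd (m - 1) t" for g' A'
    using glmon_form [OF that] forms_carrier by blast
  note sub = normalizable_subspace
  consider (GL) v t where "v \<in># g" "t \<in># A" "lkp t v > 0"
    | (GGG) "Vx \<in># g" "Vy \<in># g" "Vz \<in># g"
    | (normal) "\<forall>v\<in>#g. \<forall>t\<in>#A. lkp t v = 0" "\<exists>v. v \<notin># g"
    by blast
  then show ?case
  proof cases
    case GL
    obtain g' A' where gA: "g = add_mset v g'" "A = add_mset t A'"
      using GL by (metis multi_member_split)
    obtain B C c where BC: "size B = 2" "size C = 2" "\<forall>t\<in>#B. bnd (m - 1) t" "\<forall>t\<in>#C. bnd (m - 1) t"
      "var (CoordG v) * var (CoordL t) - (lmon B - cnst c * lmon C) \<in> J"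
      using straighten_GL [of t v] less.prems GL by blast
    have B: "gmon g' * lmon (B + A') \<in> normalizable (size g + size A)"
      and C: "gmon g' * lmon (C + A') \<in> normalizable (size g + size A)"
      using less.hyps [of g' "B + A'"] less.hyps [of g' "C + A'"] BC less.prems gA by auto
    have "(gmon g' * lmon A') * (var (CoordG v) * var (CoordL t) - (lmon B - cnst c * lmon C)) \<in> J"
      using less.prems gA by (intro mpoly_ideal_mult [OF J BC(5)] carr) auto
    then have "gmon g * lmon A - (gmon g' * lmon (B + A') - cnst c * (gmon g' * lmon (C + A'))) \<in> J"
      by (simp add: gA algebra_simps lmon_def)
    then show ?thesis
      by (rule normalizable_cong) (intro mpv.subspace_diff [OF sub] mpv.subspace_scale [OF sub] B C)
  next
    case GGG
    obtain g1 where g1: "g = add_mset Vx g1" using GGG by (metis multi_member_split)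
    obtain g2 where g2: "g1 = add_mset Vy g2" using GGG g1 by (metis axis.distinct(1) insert_noteq_member multi_member_split)
    obtain g' where g': "g2 = add_mset Vz g'"
      using GGG g1 g2 by (metis axis.distinct(3) axis.distinct(5) insert_noteq_member multi_member_split)
    have g: "g = add_mset Vx (add_mset Vy (add_mset Vz g'))" by (simp add: g1 g2 g')
    define h where "h v = sg v (m - 1)" for v :: axis
    have h: "bnd (m - 1) (h v)" for v by (simp add: h_def bnd_vertex)
    obtain e f where ef: "gmon {#Vx, Vy, Vz#} - (cnst e * lmon {#h Vx, h Vy, h Vz#}
      + cnst f * (gmon {#Vx#} * lmon {#h Vy, h Vz#})
      + cnst f * (gmon {#Vy#} * lmon {#h Vx, h Vz#})
      + cnst f * (gmon {#Vz#} * lmon {#h Vx, h Vy#})) \<in> J"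
      using cubic_relation unfolding h_def by metis
    have N: "gmon g' * lmon (add_mset (h Vx) (add_mset (h Vy) (add_mset (h Vz) A))) \<in> normalizable (size g + size A)"
      using less.hyps [of g' "add_mset (h Vx) (add_mset (h Vy) (add_mset (h Vz) A))"] less.prems h
      by (simp add: g)
    have N1: "gmon (add_mset a g') * lmon (add_mset (h b) (add_mset (h c) A)) \<in> normalizable (size g + size A)"
      for a b c
      using less.hyps [of "add_mset a g'" "add_mset (h b) (add_mset (h c) A)"] less.prems h
      by (simp add: g)
    have "(gmon g' * lmon A) * (gmon {#Vx, Vy, Vz#} - (cnst e * lmon {#h Vx, h Vy, h Vz#}
      + cnst f * (gmon {#Vx#} * lmon {#h Vy, h Vz#})
      + cnst f * (gmon {#Vy#} * lmon {#h Vx, h Vz#})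
      + cnst f * (gmon {#Vz#} * lmon {#h Vx, h Vy#}))) \<in> J"
      using less.prems by (intro mpoly_ideal_mult [OF J ef] carr)
    then have "gmon g * lmon A - (cnst e * (gmon g' * lmon (add_mset (h Vx) (add_mset (h Vy) (add_mset (h Vz) A))))
       + cnst f * (gmon (add_mset Vx g') * lmon (add_mset (h Vy) (add_mset (h Vz) A)))
       + cnst f * (gmon (add_mset Vy g') * lmon (add_mset (h Vx) (add_mset (h Vz) A)))
       + cnst f * (gmon (add_mset Vz g') * lmon (add_mset (h Vx) (add_mset (h Vy) A)))) \<in> J"
      by (simp add: g algebra_simps)
    then show ?thesis
      by (rule normalizable_cong) (intro mpv.subspace_add [OF sub] mpv.subspace_scale [OF sub] N N1)
  next
    case normal
    define d where "d = size g + size A"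
    define s where "s = \<Sum>\<^sub># A"
    have "lkp s v = 0" if "v \<in># g" for v
    proof -
      have "\<forall>t\<in>#A. lkp t v = 0" using normal that by blast
      then show ?thesis unfolding s_def by (induction A) (auto simp: lookup_add)
    qed
    moreover have "mdegree s = size A * (m - 1)"
      unfolding s_def using less.prems by (induction A) (auto simp: mdegree_add bnd_def)
    moreover have "bnd (m - 1) s" if "size A = 1"
      using that size_1_singleton_mset [of A] less.prems by (auto simp: s_def)
    ultimately have k: "(g, s) \<in> nkeys m d"
      using normal by (auto simp: nkeys_def d_def)
    have "conn (m - 1) A (lrep m (d - size g) s)"
      by (rule conn_iff_same_sum) (use less.prems lrep [OF k] in \<open>auto simp: d_def s_def\<close>)
    then have "lmon A - lmon (lrep m (d - size g) s) \<in> J"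
      using less.prems by (intro lmon_conn) auto
    then have "gmon g * (lmon A - lmon (lrep m (d - size g) s)) \<in> J"
      using gmon_form forms_carrier by (intro mpoly_ideal_mult [OF J]) blast+
    then have "gmon g * lmon A - nrep m d (g, s) \<in> J"
      by (simp add: nrep_def algebra_simps)
    moreover have "nrep m d (g, s) \<in> mpspan (nrep m d ` nkeys m d)"
      using k by (intro mpv.span_base imageI)
    ultimately show ?thesis by (auto simp: normalizable_def d_def)
  qed
qed

theorem forms_normalizable: "forms (coords m) d \<subseteq> normalizable d"
proof -
  have "mmonom t \<in> normalizable d" if "kys t \<subseteq> coords m" "mdegree t = d" for t
    using mmonom_as_product [OF that] glmon_normalizable by metis
  then show ?thesis
    unfolding forms_span_mmonom by (intro mpv.span_minimal normalizable_subspace) auto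
qed

end

section \<open>Linear independence of the normal forms\<close>

lemma prod_mset_axis: "(\<Prod>k\<in>#g. f k) = (\<Prod>k\<in>UNIV. f k ^ count g (k::axis))"
proof -
  have "(\<Prod>k\<in>#g. f k) = (\<Prod>k\<in>set_mset g. f k ^ count g k)"
    by (rule image_prod_mset_multiplicity)
  also have "\<dots> = (\<Prod>k\<in>UNIV. f k ^ count g k)"
    by (intro prod.mono_neutral_left) (auto simp: not_in_iff)
  finally show ?thesis .
qed

lemma size_axis: "size g = (\<Sum>k\<in>UNIV. count g (k::axis))"
  unfolding size_multiset_overloaded_eq
  by (intro sum.mono_neutral_left) (auto simp: not_in_iff)

lemma count_le_size_axis: "count g (v::axis) \<le> size g"
  unfolding size_axis by (rule member_le_sum) auto

lemma finite_nkeys: "finite (nkeys m d)"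
proof (rule finite_subset)
  show "nkeys m d \<subseteq> (\<Union>j\<le>d. multisets_of_size UNIV j \<times> {s. kys s \<subseteq> UNIV \<and> mdegree s = (d - j) * (m - 1)})"
    by (auto simp: nkeys_def multisets_of_size_def)
  show "finite (\<Union>j\<le>d. multisets_of_size (UNIV :: axis set) j \<times>
      {s :: axis \<Rightarrow>\<^sub>0 nat. kys s \<subseteq> UNIV \<and> mdegree s = (d - j) * (m - 1)})"
    by (intro finite_UN_I finite_cartesian_product finite_mdegree finite_multisets_of_size) auto
qed

text \<open>The exponent of the second variable in the lowest-order term (in the first one) of a normal
  form containing \<open>G_v\<close>, up to the factor coming from \<open>G_v\<close> itself.\<close>

definition vexp :: "nat \<Rightarrow> nat \<Rightarrow> axis \<Rightarrow> axis multiset \<times> (axis \<Rightarrow>\<^sub>0 nat) \<Rightarrow> nat" where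
  "vexp m d v = (\<lambda>(g, s). (m + 1) * count g (nxt (nxt v)) + (d - size g) + lkp s (nxt v))"

text \<open>For a fixed number of factors G_v, hence fixed e, the values of \<open>vexp\<close> fall
  into three disjoint ranges: below e if G_w occurs, from e to e * m if only G_v does, above e * m
  if G_u does. Within each range the value determines the key, which is what \<open>vexp_inj\<close>
  needs.\<close>

lemma vexp_cases:
  assumes k: "(g, s) \<in> nkeys m d" and v: "v \<in># g" and m: "m \<ge> 1"
  defines "w \<equiv> nxt v" and "u \<equiv> nxt (nxt v)" and "e \<equiv> d - count g v"
  shows "lkp s v = 0 \<and>
    ((count g u = 0 \<and> count g w > 0 \<and> vexp m d v (g, s) + count g w = e \<and>
        lkp s w = 0 \<and> lkp s u = (e - count g w) * (m - 1)) \<or>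
     (count g u = 0 \<and> count g w = 0 \<and> vexp m d v (g, s) = e + lkp s w \<and>
        lkp s w + lkp s u = e * (m - 1)) \<or>
     (count g w = 0 \<and> count g u > 0 \<and> vexp m d v (g, s) = e * (m - 1) + e + count g u \<and>
        lkp s u = 0 \<and> lkp s w = (e - count g u) * (m - 1)))"
proof -
  have d: "distinct [v, w, u]" unfolding w_def u_def by (rule distinct_nxt)
  have sz: "size g = count g v + count g w + count g u"
    unfolding size_axis by (rule axis_sum [OF d])
  have dg: "lkp s v + lkp s w + lkp s u = (d - size g) * (m - 1)"
    using k mdegree_axis [OF d, of s] by (simp add: nkeys_def)
  have z: "lkp s x = 0" if "count g x > 0" for x
    using k that by (auto simp: nkeys_def)
  have sv: "lkp s v = 0" using v z by simp
  have le: "size g \<le> d" using k by (simp add: nkeys_def)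
  have "\<exists>x. count g x = 0" using k by (auto simp: nkeys_def not_in_iff)
  then obtain x where x: "count g x = 0" by blast
  have "x \<noteq> v" using x v by (auto simp: count_eq_zero_iff)
  then have "count g w = 0 \<or> count g u = 0"
    using axis_cases_distinct [OF d, of x] x by auto
  moreover have vx: "vexp m d v (g, s) = (m + 1) * count g u + (d - size g) + lkp s w"
    by (simp add: vexp_def u_def w_def)
  ultimately consider "count g u = 0" "count g w > 0" | "count g u = 0" "count g w = 0"
    | "count g w = 0" "count g u > 0" by fastforce
  then show ?thesis
  proof cases
    case 1
    then show ?thesis using sv z [of w] sz dg le
      by (simp add: vx e_def)
  next
    case 2
    then show ?thesis using sv sz dg le
      by (simp add: vx e_def)
  next
    case 3
    define c where "c = count g u"
    define k where "k = d - size g"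
    have e: "e = k + c" using le sz 3 by (simp add: e_def k_def c_def)
    have "lkp s w = k * (m - 1)" using 3 sv z [of u] dg by (simp add: k_def)
    moreover have "(m + 1) * c + k + k * (m - 1) = e * (m - 1) + e + c"
      using m unfolding e by (cases m) (auto simp: algebra_simps)
    ultimately show ?thesis using 3 sv z [of u] e
      by (simp add: vx flip: c_def k_def)
  qed
qed

lemma vexp_inj:
  assumes k: "(g, s) \<in> nkeys m d" "(g', s') \<in> nkeys m d" and v: "v \<in># g" "v \<in># g'" and m: "m \<ge> 1"
    and eq: "count g v = count g' v" "vexp m d v (g, s) = vexp m d v (g', s')"
  shows "(g, s) = (g', s')"
proof -
  define w u where "w = nxt v" and "u = nxt (nxt v)"
  have d: "distinct [v, w, u]" unfolding w_def u_def by (rule distinct_nxt)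
  note c = vexp_cases [OF k(1) v(1) m, folded w_def u_def]
    and c' = vexp_cases [OF k(2) v(2) m, folded w_def u_def]
  have "count g w = count g' w \<and> count g u = count g' u \<and> lkp s v = lkp s' v \<and> lkp s w = lkp s' w \<and> lkp s u = lkp s' u"
    using c c' unfolding eq by (elim conjE disjE) auto
  moreover from this eq(1) have "count g x = count g' x" for x
    using axis_cases_distinct [OF d, of x] by auto
  then have "g = g'" by (rule multiset_eqI)
  ultimately show ?thesis using axis_ext [OF d, of s s'] by simp
qed

lemma coeff_monom_times: "Polynomial.coeff (Polynomial.monom 1 n * p) i = (if i < n then 0 else Polynomial.coeff p (i - n))"
  for p :: "'a::comm_semiring_1 poly"
  by (simp add: coeff_monom_mult)

text \<open>Under x_v = r, x_w = y, x_u = 1 every coordinate except G_v is divisible by r, so a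
  normal form with n factors G_v has order at least d - n in r. By descending induction on n, those
  with more factors G_v already have coefficient 0; those with fewer have higher order. Hence the
  coefficient of r^(d-n) only sees those with exactly n, each contributing Q(y)^n times a nonzero
  multiple of a power of y, and by \<open>vexp_inj\<close> these powers are distinct.\<close>

lemma independent_axis:
  assumes m: "m \<ge> 1"
    and rel: "\<And>a. (\<Sum>k\<in>nkeys m d. c k * pull m (nrep m d k) a) = 0"
    and k: "k0 \<in> nkeys m d" "count (fst k0) v = n" "n > 0"
  shows "c k0 = 0"
  using k
proof (induction "d - n" arbitrary: k0 n rule: less_induct)
  case (less n k0)
  define w u where "w = nxt v" and "u = nxt w"
  have dist: "distinct [v, w, u]" unfolding w_def u_def by (rule distinct_nxt)
  then have ne: "v \<noteq> w" "w \<noteq> v" "u \<noteq> w" "w \<noteq> u" "u \<noteq> v" "v \<noteq> u" by auto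
  have nu: "nxt u = v" by (cases v) (auto simp: u_def w_def)
  define K where "K = nkeys m d"
  define cv where "cv k = count (fst k) v" for k :: "axis multiset \<times> (axis \<Rightarrow>\<^sub>0 nat)"
  have finK: "finite K" using finite_nkeys by (simp add: K_def)
  have cvd: "cv k \<le> d" if "k \<in> K" for k
    using that le_trans [OF count_le_size_axis] by (auto simp: K_def nkeys_def cv_def)
  have nd: "n \<le> d" using cvd [of k0] less.prems by (simp add: K_def cv_def)
  have high: "c k = 0" if k: "k \<in> K" "cv k > n" for k
  proof -
    have "d - cv k < d - n" using k(2) cvd [OF k(1)] by linarith
    moreover have "k \<in> nkeys m d" "count (fst k) v = cv k"
      using k by (simp_all add: K_def cv_def)
    moreover have "0 < cv k" using k(2) by linarith
    ultimately show ?thesis by (rule less.hyps)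
  qed
  define t :: "complex poly" where "t = [:0, 1:]"
  \<comment> \<open>What is left of a normal form after removing a factor Q(y) for each G_v and a
    factor r for each of the other coordinates.\<close>
  define R where "R y = (\<lambda>(g, s). (1 - (- t) ^ m) ^ count g w * ([:y:] * (t ^ m - [:(- y) ^ m:])) ^ count g u
      * [:y:] ^ (d - size g) * t ^ lkp s v * [:y:] ^ lkp s w)" for y :: complex
  define Q :: "complex poly" where "Q = [:0, 1:] * (Polynomial.monom 1 m - [:(-1) ^ m:])"
  have valQ: "poly Q y = y * (y ^ m - (-1) ^ m)" for y
    by (simp add: Q_def poly_monom)
  have poly_R: "poly (R y (g, s)) r = (1 - (- r) ^ m) ^ count g w * (y * (r ^ m - (- y) ^ m)) ^ count g u
        * y ^ (d - size g) * r ^ lkp s v * y ^ lkp s w" for y g s r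
    by (simp only: R_def t_def prod.case) simp
  have pull_val: "pull m (nrep m d k) (\<lambda>x. if x = v then r else if x = w then y else 1) =
     poly Q y ^ cv k * poly (Polynomial.monom 1 (d - cv k) * R y k) r" if "k \<in> K" for k r y
  proof -
    obtain g s where gs: "k = (g, s)" by (cases k)
    have sz: "size g = count g v + count g w + count g u"
      unfolding size_axis by (rule axis_sum [OF dist])
    have "size g \<le> d" using that by (auto simp: K_def gs nkeys_def)
    then have dcv: "d - cv k = count g w + count g u + (d - size g)" by (simp add: cv_def gs sz)
    define a where "a = (\<lambda>x. if x = v then r else if x = w then y else 1)"
    have a: "a v = r" "a w = y" "a u = 1" using ne by (auto simp: a_def)
    have G: "cval m a (CoordG v) = poly Q y" "cval m a (CoordG w) = r * (1 - (- r) ^ m)"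
      "cval m a (CoordG u) = r * (y * (r ^ m - (- y) ^ m))"
      using a nu by (simp_all add: valQ flip: w_def u_def)
    have "pull m (nrep m d k) a = poly Q y ^ count g v * (r * (1 - (- r) ^ m)) ^ count g w
        * (r * (y * (r ^ m - (- y) ^ m))) ^ count g u * (r * y) ^ (d - size g) * (r ^ lkp s v * y ^ lkp s w)"
      using that by (simp add: gs K_def pull_nrep prod_mset_axis axis_prod [OF dist] mval_axis G a del: cval.simps)
    moreover have "poly (R y k) r = (1 - (- r) ^ m) ^ count g w * (y * (r ^ m - (- y) ^ m)) ^ count g u
        * y ^ (d - size g) * r ^ lkp s v * y ^ lkp s w"
      unfolding gs by (rule poly_R)
    ultimately show ?thesis
      unfolding a_def by (simp only: poly_mult poly_monom dcv [unfolded cv_def gs fst_conv] power_add power_mult_distrib cv_def gs fst_conv mult_1 mult_ac)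
  qed
  have coefR: "Polynomial.coeff (R y k) 0 = (- ((-1) ^ m)) ^ count (fst k) u * y ^ vexp m d v k"
    if "k \<in> K" "cv k = n" for k y
  proof -
    obtain g s where gs: "k = (g, s)" by (cases k)
    have "v \<in># g" using less.prems that by (auto simp: cv_def gs count_greater_zero_iff [symmetric])
    then have "lkp s v = 0" using that by (auto simp: K_def gs nkeys_def)
    have "(- y) ^ m = (-1) ^ m * y ^ m" by (rule power_minus)
    \<comment> \<open>At r = 0 only the second term of G_u survives, because m >= 1; this is the
      origin of the weight m + 1 in \<open>vexp\<close>.\<close>
    then have y: "y * (0 ^ m - (- y) ^ m) = - ((-1) ^ m) * y ^ (m + 1)"
      using m by (simp add: zero_power)
    have "Polynomial.coeff (R y k) 0 = poly (R y k) 0" by (simp add: poly_0_coeff_0)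
    also have "\<dots> = (1 - (- 0) ^ m) ^ count g w * (y * (0 ^ m - (- y) ^ m)) ^ count g u
        * y ^ (d - size g) * 0 ^ lkp s v * y ^ lkp s w"
      unfolding gs by (rule poly_R)
    also have "\<dots> = (- ((-1) ^ m)) ^ count g u * (y ^ (m + 1)) ^ count g u * y ^ (d - size g) * y ^ lkp s w"
      using m unfolding y power_mult_distrib \<open>lkp s v = 0\<close> by (simp add: zero_power)
    also have "\<dots> = (- ((-1) ^ m)) ^ count g u * y ^ vexp m d v k"
      by (simp only: power_mult [symmetric] power_add [symmetric] mult.assoc gs vexp_def prod.case u_def w_def)
    finally show ?thesis by (simp add: gs)
  qed
  define S where "S = (\<Sum>k\<in>{k\<in>K. cv k = n}. Polynomial.monom (c k * (- ((-1) ^ m)) ^ count (fst k) u) (vexp m d v k))"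
  have "poly (Q ^ n * S) y = 0" for y
  proof -
    define P where "P = (\<Sum>k\<in>K. Polynomial.smult (c k * poly Q y ^ cv k) (Polynomial.monom 1 (d - cv k) * R y k))"
    have "poly P r = (\<Sum>k\<in>K. c k * pull m (nrep m d k) (\<lambda>x. if x = v then r else if x = w then y else 1))" for r
      unfolding P_def poly_sum by (intro sum.cong refl) (simp add: pull_val mult.assoc del: poly_mult)
    then have "poly P r = 0" for r using rel by (simp add: K_def)
    then have "P = 0" using poly_all_0_iff_0 by blast
    then have "0 = Polynomial.coeff P (d - n)" by simp
    also have "\<dots> = (\<Sum>k\<in>K. if cv k = n then
        poly Q y ^ n * (c k * (- ((-1) ^ m)) ^ count (fst k) u * y ^ vexp m d v k) else 0)"
      unfolding P_def coeff_sum
    proof (intro sum.cong refl)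
      fix k assume k: "k \<in> K"
      consider "cv k = n" | "cv k < n" | "cv k > n" by linarith
      then show "Polynomial.coeff (Polynomial.smult (c k * poly Q y ^ cv k) (Polynomial.monom 1 (d - cv k) * R y k)) (d - n) =
          (if cv k = n then poly Q y ^ n * (c k * (- ((-1) ^ m)) ^ count (fst k) u * y ^ vexp m d v k) else 0)"
      proof cases
        case 1
        then show ?thesis using coefR [OF k 1] by (simp add: coeff_monom_times)
      next
        case 2
        then show ?thesis using nd by (simp add: coeff_monom_times)
      next
        case 3
        then show ?thesis using high [OF k] by simp
      qed
    qed
    also have "\<dots> = poly (Q ^ n * S) y"
      using finK by (auto simp: S_def poly_sum poly_monom sum_distrib_left sum.inter_filter intro!: sum.cong)
    finally show ?thesis by simp
  qed
  then have "Q ^ n * S = 0" using poly_all_0_iff_0 by blast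
  \<comment> \<open>Q is the restriction of G_v; being nonzero it can be cancelled from Q^n * S =
    0.\<close>
  moreover have "Q \<noteq> 0"
  proof -
    have "Polynomial.coeff (Polynomial.monom 1 m - [:(-1) ^ m:]) m = (1::complex)" using m by (cases m) auto
    then have "Polynomial.monom 1 m - [:(-1) ^ m:] \<noteq> (0 :: complex poly)" by force
    then show ?thesis by (simp add: Q_def)
  qed
  ultimately have S0: "S = 0" by simp
  have k0: "k0 \<in> {k\<in>K. cv k = n}" using less.prems by (simp add: K_def cv_def)
  have "0 = Polynomial.coeff S (vexp m d v k0)" by (simp add: S0)
  also have "\<dots> = (\<Sum>k\<in>{k\<in>K. cv k = n}. if k = k0 then c k * (- ((-1) ^ m)) ^ count (fst k) u else 0)"
    unfolding S_def coeff_sum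
  proof (intro sum.cong refl)
    fix k assume k: "k \<in> {k\<in>K. cv k = n}"
    have v: "v \<in># fst k" "v \<in># fst k0" "count (fst k) v = count (fst k0) v"
      using k k0 less.prems(3) by (simp_all add: cv_def flip: count_greater_zero_iff)
    have "k = k0" if "vexp m d v k = vexp m d v k0"
      using vexp_inj [OF _ _ v(1,2) m v(3), of "snd k" d "snd k0"] k k0 that by (simp add: K_def)
    then show "Polynomial.coeff (Polynomial.monom (c k * (- ((-1) ^ m)) ^ count (fst k) u) (vexp m d v k)) (vexp m d v k0) =
        (if k = k0 then c k * (- ((-1) ^ m)) ^ count (fst k) u else 0)" by auto
  qed
  also have "\<dots> = c k0 * (- ((-1) ^ m)) ^ count (fst k0) u"
    using k0 finK by simp
  finally show ?case by simp
qed

text \<open>Keys containing some G_v are settled by \<open>independent_axis\<close>. The others pull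
  back to distinct monomials in x, y, z, which a Kronecker substitution x = r, y = r^N, z = 1 keeps
  apart.\<close>

theorem nrep_sum_independent:
  assumes m: "m \<ge> 1"
    and rel: "\<And>a. (\<Sum>k\<in>nkeys m d. c k * pull m (nrep m d k) a) = 0"
    and k: "k0 \<in> nkeys m d"
  shows "c k0 = 0"
proof (cases "fst k0 = {#}")
  case False
  then obtain v where "v \<in># fst k0" by (rule multiset_nonemptyE)
  then show ?thesis using independent_axis [OF m rel k, of v "count (fst k0) v"] by auto
next
  case True
  define K where "K = nkeys m d"
  have finK: "finite K" using finite_nkeys by (simp add: K_def)
  have zero: "c k = 0" if k: "k \<in> K" "fst k \<noteq> {#}" for k
  proof -
    obtain v where "v \<in># fst k" using k(2) by (rule multiset_nonemptyE)
    then show ?thesis using independent_axis [OF m rel, of k v "count (fst k) v"] k by (auto simp: K_def)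
  qed
  \<comment> \<open>N exceeds every exponent of x that occurs in \<open>s\<close>, so division with
    remainder by N recovers both exponents from \<open>ex s\<close>, and the total degree gives the
    third.\<close>
  define N where "N = d * (m - 1) + 1"
  define ex where "ex s = (d + lkp s Vx) + N * (d + lkp s Vy)" for s :: "axis \<Rightarrow>\<^sub>0 nat"
  define P where "P = (\<Sum>k\<in>{k\<in>K. fst k = {#}}. Polynomial.monom (c k) (ex (snd k)))"
  have deg: "lkp s Vx + lkp s Vy + lkp s Vz = d * (m - 1)" if "({#}, s) \<in> K" for s
    using that mdegree_axis [of Vx Vy Vz s] by (auto simp: K_def nkeys_def)
  have "poly P r = 0" for r
  proof -
    define a where "a k = (if k = Vx then r else if k = Vy then r ^ N else 1)" for k
    have "poly P r = (\<Sum>k\<in>{k\<in>K. fst k = {#}}. c k * pull m (nrep m d k) a)"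
      unfolding P_def poly_sum poly_monom
    proof (intro sum.cong refl arg_cong2 [of _ _ _ _ "(*)"])
      fix k assume "k \<in> {k\<in>K. fst k = {#}}"
      then obtain s where s: "k = ({#}, s)" "({#}, s) \<in> nkeys m d" by (cases k) (auto simp: K_def)
      show "r ^ ex (snd k) = pull m (nrep m d k) a"
        unfolding s(1) pull_nrep [OF s(2)]
        by (simp add: UNIV_prod_axis mval_axis a_def ex_def power_add power_mult power_mult_distrib algebra_simps)
    qed
    also have "\<dots> = (\<Sum>k\<in>K. c k * pull m (nrep m d k) a)"
      using finK zero by (intro sum.mono_neutral_left) auto
    finally show ?thesis using rel by (simp add: K_def)
  qed
  then have P0: "P = 0" using poly_all_0_iff_0 by blast
  have k0: "k0 \<in> {k\<in>K. fst k = {#}}" using k True by (simp add: K_def)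
  have "0 = Polynomial.coeff P (ex (snd k0))" by (simp add: P0)
  also have "\<dots> = (\<Sum>k\<in>{k\<in>K. fst k = {#}}. if k = k0 then c k else 0)"
    unfolding P_def coeff_sum
  proof (intro sum.cong refl)
    fix k assume k: "k \<in> {k\<in>K. fst k = {#}}"
    obtain s s0 where s: "k = ({#}, s)" "k0 = ({#}, s0)" using k k0 by (cases k, cases k0) auto
    have "s = s0" if "ex s = ex s0"
    proof -
      have 1: "lkp s Vx < N" "lkp s0 Vx < N"
        using deg [of s] deg [of s0] k k0 s by (auto simp: N_def)
      have "lkp s Vx + N * (d + lkp s Vy) = lkp s0 Vx + N * (d + lkp s0 Vy)"
        using that by (simp add: ex_def)
      then have "(lkp s Vx + N * (d + lkp s Vy)) mod N = (lkp s0 Vx + N * (d + lkp s0 Vy)) mod N"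
        "(lkp s Vx + N * (d + lkp s Vy)) div N = (lkp s0 Vx + N * (d + lkp s0 Vy)) div N" by simp_all
      then have 2: "lkp s Vx = lkp s0 Vx" "lkp s Vy = lkp s0 Vy" using 1 by auto
      then show ?thesis
        using deg [of s] deg [of s0] k k0 s by (intro axis_ext [of Vx Vy Vz]) auto
    qed
    then show "Polynomial.coeff (Polynomial.monom (c k) (ex (snd k))) (ex (snd k0)) = (if k = k0 then c k else 0)"
      by (auto simp: s)
  qed
  also have "\<dots> = c k0" using k0 finK by simp
  finally show ?thesis by simp
qed

lemma nrep_inj: assumes "m \<ge> 1" shows "inj_on (nrep m d) (nkeys m d)"
proof (rule inj_onI, rule ccontr)
  fix k l assume kl: "k \<in> nkeys m d" "l \<in> nkeys m d" "nrep m d k = nrep m d l" "k \<noteq> l"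
  define c where "c x = (if x = k then 1 else if x = l then -1 else 0 :: complex)" for x
  have "(\<Sum>x\<in>nkeys m d. c x * pull m (nrep m d x) a) = 0" for a
  proof -
    have "(\<Sum>x\<in>nkeys m d. c x * pull m (nrep m d x) a) = (\<Sum>x\<in>{k, l}. c x * pull m (nrep m d x) a)"
      using kl finite_nkeys by (intro sum.mono_neutral_right) (auto simp: c_def)
    then show ?thesis using kl by (simp add: c_def)
  qed
  then have "c k = 0" by (rule nrep_sum_independent [OF assms _ kl(1)])
  then show False by (simp add: c_def)
qed

lemma nrep_span:
  assumes "m \<ge> 1" "q \<in> mpspan (nrep m d ` nkeys m d)"
  obtains c where "q = (\<Sum>k\<in>nkeys m d. cnst (c k) * nrep m d k)"
proof -
  obtain c where "q = (\<Sum>p\<in>nrep m d ` nkeys m d. cnst (c p) * p)"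
    using assms(2) mpv.span_finite [of "nrep m d ` nkeys m d"] finite_nkeys by auto
  then have "q = (\<Sum>k\<in>nkeys m d. cnst (c (nrep m d k)) * nrep m d k)"
    by (simp add: sum.reindex [OF nrep_inj [OF assms(1)]])
  then show ?thesis by (rule that)
qed

lemma nrep_span_vanishing:
  assumes m: "m \<ge> 1" and q: "q \<in> mpspan (nrep m d ` nkeys m d)" "\<And>a. pull m q a = 0"
  shows "q = 0"
proof -
  obtain c where c: "q = (\<Sum>k\<in>nkeys m d. cnst (c k) * nrep m d k)"
    using nrep_span [OF m q(1)] by blast
  have "c k = 0" if "k \<in> nkeys m d" for k
    by (rule nrep_sum_independent [OF m _ that]) (use q(2) in \<open>simp add: c pull_hom\<close>)
  then show ?thesis by (simp add: c)
qed

lemma nrep_independent: assumes "m \<ge> 1" shows "mpv.independent (nrep m d ` nkeys m d)"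
  unfolding mpv.independent_explicit_finite_subsets
proof (intro allI impI ballI)
  fix S u p
  assume S: "S \<subseteq> nrep m d ` nkeys m d" "finite S" "(\<Sum>v\<in>S. cnst (u v) * v) = 0" and p: "p \<in> S"
  define c where "c k = (if nrep m d k \<in> S then u (nrep m d k) else 0)" for k
  have "(\<Sum>k\<in>nkeys m d. cnst (c k) * nrep m d k) = (\<Sum>p\<in>nrep m d ` nkeys m d. cnst (if p \<in> S then u p else 0) * p)"
    by (simp add: sum.reindex [OF nrep_inj [OF assms]] c_def)
  also have "\<dots> = (\<Sum>p\<in>S. cnst (u p) * p)"
    using S finite_nkeys by (intro sum.mono_neutral_cong_right) auto
  finally have 0: "(\<Sum>k\<in>nkeys m d. cnst (c k) * nrep m d k) = 0" using S by simp
  have "(\<Sum>k\<in>nkeys m d. c k * pull m (nrep m d k) a) = 0" for a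
    using arg_cong [OF 0, of "\<lambda>p. pull m p a"] by (simp add: pull_hom)
  then have "c k = 0" if "k \<in> nkeys m d" for k
    by (rule nrep_sum_independent [OF assms _ that])
  then show "u p = 0" using S p by (force simp: c_def)
qed

section \<open>Homogeneous components\<close>

definition hcomp :: "nat \<Rightarrow> 'v mpoly \<Rightarrow> 'v mpoly" where
  "hcomp d p = Poly_Mapping.mapp (\<lambda>t c. c when mdegree t = d) p"

lemma lookup_hcomp: "lkp (hcomp d p) t = (if mdegree t = d then lkp p t else 0)"
  by (auto simp: hcomp_def lookup_mapp when_def in_keys_iff)

lemma keys_hcomp: "kys (hcomp d p) = {t \<in> kys p. mdegree t = d}"
  by (auto simp: in_keys_iff lookup_hcomp split: if_splits)

lemma hcomp_add: "hcomp d (p + q) = hcomp d p + hcomp d q"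
  by (intro poly_mapping_eqI) (simp add: lookup_hcomp lookup_add)

lemma hcomp_0 [simp]: "hcomp d 0 = 0"
  by (intro poly_mapping_eqI) (simp add: lookup_hcomp)

lemma hcomp_sum: "hcomp d (\<Sum>i\<in>I. f i) = (\<Sum>i\<in>I. hcomp d (f i))"
  by (induction I rule: infinite_finite_induct) (auto simp: hcomp_add)

lemma hcomp_in_forms: "p \<in> carrier (mpoly_ring V) \<Longrightarrow> hcomp d p \<in> forms V d"
  by (auto simp: forms_iff keys_hcomp carrier_mpoly_iff)

lemma hcomp_of_form: "p \<in> forms V e \<Longrightarrow> hcomp d p = (if d = e then p else 0)"
  by (intro poly_mapping_eqI) (auto simp: lookup_hcomp forms_iff in_keys_iff)

lemma hcomp_single: "hcomp d (sg t c) = (if mdegree t = d then sg t c else 0)"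
  by (intro poly_mapping_eqI) (auto simp: lookup_hcomp lookup_single when_def)

lemma sum_hcomp: "p = (\<Sum>d\<in>mdegree ` kys p. hcomp d p)"
proof (rule poly_mapping_eqI)
  fix t show "lkp p t = lkp (\<Sum>d\<in>mdegree ` kys p. hcomp d p) t"
    by (auto simp: lookup_sum lookup_hcomp sum.delta' in_keys_iff)
qed

lemma sum_single: "(p :: 'v mpoly) = (\<Sum>t\<in>kys p. sg t (lkp p t))"
  using mpoly_expand [of p] by (simp add: single_eq_cnst_mult)

lemma hcomp_cnst_mult: "hcomp d (cnst c * p) = cnst c * hcomp d p"
  by (intro poly_mapping_eqI) (simp add: lookup_hcomp lookup_cnst_mult)

lemma hcomp_single_mult:
  "hcomp d (sg t c * p) = (if mdegree t \<le> d then sg t c * hcomp (d - mdegree t) p else 0)"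
proof -
  have "hcomp d (sg t c * p) = (\<Sum>s\<in>kys p. hcomp d (sg (t + s) (c * lkp p s)))"
    by (subst sum_single [of p]) (simp add: sum_distrib_left mult_single hcomp_sum)
  also have "\<dots> = (\<Sum>s\<in>kys p. if mdegree t \<le> d then sg t c * hcomp (d - mdegree t) (sg s (lkp p s)) else 0)"
    by (intro sum.cong refl) (auto simp: hcomp_single mdegree_add mult_single)
  also have "\<dots> = (if mdegree t \<le> d then sg t c * hcomp (d - mdegree t) (\<Sum>s\<in>kys p. sg s (lkp p s)) else 0)"
    by (simp add: hcomp_sum sum_distrib_left)
  finally show ?thesis by (simp flip: sum_single)
qed

text \<open>Every polynomial is a sum of terms. Ideals described through homogeneous components are
  easier to check this way, because a single term merely shifts the degree.\<close>

lemma mpoly_idealI_terms: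
  assumes "I \<subseteq> carrier (mpoly_ring V)" "0 \<in> I"
    "\<And>p q. p \<in> I \<Longrightarrow> q \<in> I \<Longrightarrow> p + q \<in> I"
    "\<And>p t c. p \<in> I \<Longrightarrow> kys t \<subseteq> V \<Longrightarrow> sg t c * p \<in> I"
  shows "ideal I (mpoly_ring V)"
proof (rule mpoly_idealI [OF assms(1-3)])
  fix p r assume p: "p \<in> I" and r: "r \<in> carrier (mpoly_ring V)"
  have sum: "(\<Sum>x\<in>X. f x) \<in> I" if "\<And>x. x \<in> X \<Longrightarrow> f x \<in> I" for X and f :: "_ \<Rightarrow> 'a mpoly"
    using that by (induction X rule: infinite_finite_induct) (auto intro: assms)
  have "r * p = (\<Sum>t\<in>kys r. sg t (lkp r t) * p)"
    by (subst sum_single [of r]) (simp add: sum_distrib_right)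
  also have "\<dots> \<in> I"
    using r p by (intro sum assms(4)) (auto simp: carrier_mpoly_iff)
  finally show "r * p \<in> I" .
qed

section \<open>The homogeneous ideal\<close>

definition pker :: "nat \<Rightarrow> coord mpoly set" where
  "pker m = {F \<in> carrier (cring_of m). \<forall>a. pull m F a = 0}"

lemma pker_ideal: "ideal (pker m) (cring_of m)"
  by (rule mpoly_idealI) (auto simp: pker_def pull_hom intro: mpoly_closed)

lemma presentation_pker: "m \<ge> 2 \<Longrightarrow> presentation m (pker m)"
  using pker_ideal cubic_C_vanishes [of m] cubic_C_form [of m] forms_carrier
  by (intro presentation.intro) (auto simp: pker_def)

section \<open>Vanishing on the image, on its closure and under the parametrization\<close>

lemma proj_point_scale: "b \<in> proj_point a \<longleftrightarrow> (\<exists>c. c \<noteq> 0 \<and> b = (\<lambda>v. c * a v))"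
  by (auto simp: proj_point_def)

lemma proj_point_self: "a \<in> proj_point a"
  unfolding proj_point_scale by (intro exI [of _ 1]) auto

lemma cval_one_coordL: "cval m (\<lambda>_. 1) (CoordL t) = 1"
  by (simp add: mval_def)

lemma phi_nonzero: "m \<ge> 1 \<Longrightarrow> \<exists>a. \<exists>c\<in>coords m. phi m a c \<noteq> 0"
proof -
  assume "m \<ge> 1"
  have c: "CoordL (sg Vx (m - 1)) \<in> coords m"
    by (simp add: CoordL_in_coords bnd_vertex)
  have "phi m (\<lambda>_. 1) (CoordL (sg Vx (m - 1))) \<noteq> 0"
    unfolding phi_eq [OF c] cval_one_coordL by simp
  then show ?thesis using c by blast
qed

lemma cval_zero: "m \<ge> 1 \<Longrightarrow> cval m (\<lambda>_. 0) c = 0"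
  by (cases c) (auto simp: zero_power finite_UNIV_card_ge_0)

lemma phi_image_subset: "phi_image m \<subseteq> proj_space (coords m)"
proof
  fix P assume "P \<in> phi_image m"
  then obtain a where "P = proj_point (phi m a)" "\<exists>c\<in>coords m. phi m a c \<noteq> 0"
    by (auto simp: phi_image_def)
  then show "P \<in> proj_space (coords m)"
    unfolding proj_space_def by (auto intro!: exI [of _ "phi m a"] simp: phi_def)
qed

lemma vanishes_phi_image:
  assumes m: "m \<ge> 1" and F: "F \<in> forms (coords m) d"
  shows "vanishes_on F (phi_image m) \<longleftrightarrow> (\<forall>a. pull m F a = 0)"
proof
  assume "\<forall>a. pull m F a = 0"
  then show "vanishes_on F (phi_image m)"
    using eval_phi [OF forms_carrier [OF F]]
    by (auto simp: vanishes_on_def phi_image_def proj_point_scale eval_form_scale [OF F])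
next
  assume v: "vanishes_on F (phi_image m)"
  have nz: "eval_mpoly (phi m a) F = 0" if "\<exists>c\<in>coords m. phi m a c \<noteq> 0" for a
  proof -
    have "\<exists>k. a k \<noteq> 0"
    proof (rule ccontr)
      assume "\<not> ?thesis"
      then have "a = (\<lambda>_. 0)" by auto
      then show False using that cval_zero [OF m] by (auto simp: phi_eq)
    qed
    then have "proj_point a \<in> proj_space UNIV"
      unfolding proj_space_def by auto
    then have "proj_point (phi m a) \<in> phi_image m"
      using that by (auto simp: phi_image_def)
    then show ?thesis using v proj_point_self by (auto simp: vanishes_on_def)
  qed
  show "\<forall>a. pull m F a = 0"
  proof
    fix a
    show "pull m F a = 0"
    proof (cases "\<exists>c\<in>coords m. phi m a c \<noteq> 0")
      case True
      then show ?thesis using nz eval_phi [OF forms_carrier [OF F]] by metis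
    next
      case False
      obtain b where b: "\<exists>c\<in>coords m. phi m b c \<noteq> 0" using phi_nonzero [OF m] by blast
      \<comment> \<open>At a base point \<open>F\<close> is evaluated at the origin, written here as
        0 times a point over the image. This also covers d = 0, where \<open>F\<close> is a constant
        that vanishes on a nonempty image.\<close>
      have "eval_mpoly (phi m a) F = eval_mpoly (\<lambda>c. 0 * phi m b c) F"
        using False forms_carrier [OF F] by (intro eval_mpoly_cong [of _ "coords m"]) auto
      also have "\<dots> = 0" unfolding eval_form_scale [OF F] using nz [OF b] by simp
      finally show ?thesis using eval_phi [OF forms_carrier [OF F]] by metis
    qed
  qed
qed

lemma vanishes_Xbar:
  assumes m: "m \<ge> 1" and F: "F \<in> forms (coords m) d"
  shows "vanishes_on F (Xbar m) \<longleftrightarrow> (\<forall>a. pull m F a = 0)"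
proof -
  have "phi_image m \<subseteq> Xbar m"
    using phi_image_subset by (auto simp: Xbar_def zariski_closure_def vanishes_on_def)
  then have "vanishes_on F (Xbar m) \<longleftrightarrow> vanishes_on F (phi_image m)"
    using F by (auto simp: Xbar_def zariski_closure_def vanishes_on_def)
  then show ?thesis using vanishes_phi_image [OF m F] by simp
qed

abbreviation hid :: "nat \<Rightarrow> coord mpoly set" where
  "hid m \<equiv> homogeneous_ideal (coords m) (Xbar m)"

definition kforms :: "nat \<Rightarrow> nat \<Rightarrow> coord mpoly set" where
  "kforms m d = {F \<in> forms (coords m) d. \<forall>a. pull m F a = 0}"

lemma kforms_subspace: "mpv.subspace (kforms m d)"
  using forms_subspace [of "coords m" d]
  by (auto simp: mpv.subspace_def kforms_def pull_hom)

lemma kforms_pker: "kforms m d \<subseteq> pker m"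
  by (auto simp: kforms_def pker_def forms_carrier)

lemma hid_eq_genideal: "m \<ge> 1 \<Longrightarrow> hid m = genideal (cring_of m) (\<Union>d. kforms m d)"
  unfolding homogeneous_ideal_def
  by (rule arg_cong [of _ _ "genideal (cring_of m)"])
     (auto simp: kforms_def vanishes_Xbar)

lemma kforms_carrier: "(\<Union>d. kforms m d) \<subseteq> carrier (cring_of m)"
  by (auto simp: kforms_def forms_carrier)

lemma hid_ideal: "m \<ge> 1 \<Longrightarrow> ideal (hid m) (cring_of m)"
  using mpoly_genideal_ideal [OF kforms_carrier] by (simp add: hid_eq_genideal)

lemma kforms_hid: "m \<ge> 1 \<Longrightarrow> kforms m d \<subseteq> hid m"
  using mpoly_genideal_self [OF kforms_carrier, of m] by (auto simp: hid_eq_genideal)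

section \<open>Homogeneity of the kernel of the parametrization\<close>

lemma cval_scale:
  assumes "c \<in> coords m" "m \<ge> 1"
  shows "cval m (\<lambda>k. s * a k) c = s ^ (m + 2) * cval m a c"
proof (cases c)
  case (CoordG v)
  have neg: "(- (s * x)) ^ m = s ^ m * (- x) ^ m" for x
    by (metis mult_minus_right power_mult_distrib)
  show ?thesis
    unfolding CoordG cval.simps neg by (simp add: power_mult_distrib power_add power2_eq_square right_diff_distrib mult_ac)
next
  case (CoordL t)
  have "mdegree t = m - 1" using assms CoordL by (simp add: CoordL_in_coords bnd_def)
  then have "mval (\<lambda>k. s * a k) t = s ^ (m - 1) * mval a t"
    by (simp add: mval_def mdegree_def power_mult_distrib prod.distrib power_sum [symmetric])
  moreover have "s ^ (m + 2) = s * s * s * s ^ (m - 1)"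
    using assms(2) by (cases m) (auto simp: power_add power2_eq_square)
  ultimately show ?thesis unfolding CoordL
    by (simp add: UNIV_prod_axis algebra_simps)
qed

lemma pull_scale:
  assumes "m \<ge> 1" "F \<in> forms (coords m) d"
  shows "pull m F (\<lambda>k. s * a k) = s ^ ((m + 2) * d) * pull m F a"
proof -
  have "pull m F (\<lambda>k. s * a k) = eval_mpoly (\<lambda>c. s ^ (m + 2) * cval m a c) F"
    unfolding pull_def using cval_scale assms forms_carrier
    by (intro eval_mpoly_cong [of _ "coords m"]) auto
  also have "\<dots> = (s ^ (m + 2)) ^ d * pull m F a"
    unfolding pull_def by (rule eval_form_scale [OF assms(2)])
  finally show ?thesis by (simp only: power_mult)
qed

text \<open>All coordinates have degree m + 2 in x, y, z. Along the ray through a point the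
  components of \<open>F\<close> therefore appear at different powers s^((m+2)d) and vanish
  separately.\<close>

lemma pker_hcomp:
  assumes m: "m \<ge> 1" and F: "F \<in> pker m"
  shows "hcomp d F \<in> kforms m d"
proof -
  have carr: "F \<in> carrier (cring_of m)" using F by (simp add: pker_def)
  note hf = hcomp_in_forms [OF carr]
  have "pull m (hcomp d F) a = 0" for a
  proof (cases "d \<in> mdegree ` kys F")
    case False
    then have "hcomp d F = 0" by (intro poly_mapping_eqI) (auto simp: lookup_hcomp in_keys_iff)
    then show ?thesis by simp
  next
    case True
    have cancel: "(m + 2) * e = (m + 2) * d \<longleftrightarrow> e = d" for e
      by (subst mult_cancel1) simp
    define P where "P = (\<Sum>e\<in>mdegree ` kys F. Polynomial.monom (pull m (hcomp e F) a) ((m + 2) * e))"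
    have "poly P s = pull m F (\<lambda>k. s * a k)" for s
      by (subst sum_hcomp [of F])
         (simp add: P_def poly_sum poly_monom pull_hom pull_scale [OF m hf] mult.commute)
    then have "poly P s = 0" for s using F by (simp add: pker_def)
    then have "P = 0" using poly_all_0_iff_0 by blast
    then have "0 = Polynomial.coeff P ((m + 2) * d)" by simp
    also have "\<dots> = (\<Sum>e\<in>mdegree ` kys F. if e = d then pull m (hcomp e F) a else 0)"
      unfolding P_def coeff_sum by (intro sum.cong refl) (simp only: coeff_monom cancel)
    also have "\<dots> = pull m (hcomp d F) a" using True by simp
    finally show ?thesis by simp
  qed
  then show ?thesis using hf by (simp add: kforms_def)
qed

theorem hid_eq_pker:
  assumes m: "m \<ge> 1" shows "hid m = pker m"
proof
  show "hid m \<subseteq> pker m"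
    unfolding hid_eq_genideal [OF m]
    by (rule mpoly_genideal_minimal [OF pker_ideal]) (use kforms_pker in blast)
  show "pker m \<subseteq> hid m"
  proof
    fix F assume F: "F \<in> pker m"
    have "(\<Sum>d\<in>mdegree ` kys F. hcomp d F) \<in> hid m"
      using pker_hcomp [OF m F] kforms_hid [OF m]
      by (intro mpoly_ideal_sum [OF hid_ideal [OF m]]) blast
    then show "F \<in> hid m" by (simp flip: sum_hcomp)
  qed
qed

lemma hid_forms: "m \<ge> 1 \<Longrightarrow> hid m \<inter> forms (coords m) d = kforms m d"
  by (auto simp: hid_eq_pker pker_def kforms_def forms_carrier)

subsection \<open>Generators\<close>

text \<open>A form in the kernel is congruent modulo \<open>J\<close> to a combination of normal
  forms. As \<open>J\<close> lies in the kernel, so does this combination, and by independence it is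
  0.\<close>

theorem hid_generated:
  assumes m: "m \<ge> 2" and Q: "kforms m 2 \<subseteq> mpspan Q" "Q \<subseteq> kforms m 2"
  shows "genideal (cring_of m) (Q \<union> {cubic_C m}) = hid m"
proof
  have m1: "m \<ge> 1" using m by simp
  have C: "cubic_C m \<in> pker m"
    using cubic_C_vanishes [OF m1] cubic_C_form [OF m1] forms_carrier by (auto simp: pker_def)
  have gens: "Q \<union> {cubic_C m} \<subseteq> pker m" using C Q kforms_pker by blast
  then have carr: "Q \<union> {cubic_C m} \<subseteq> carrier (cring_of m)"
    by (auto simp: pker_def)
  define J where "J = genideal (cring_of m) (Q \<union> {cubic_C m})"
  have J: "ideal J (cring_of m)" unfolding J_def by (rule mpoly_genideal_ideal [OF carr])
  have QJ: "Q \<union> {cubic_C m} \<subseteq> J" unfolding J_def by (rule mpoly_genideal_self [OF carr])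
  have Jk: "J \<subseteq> pker m" unfolding J_def by (rule mpoly_genideal_minimal [OF pker_ideal gens])
  have "mpv.subspace J"
    using mpoly_ideal_zero [OF J] mpoly_ideal_add [OF J] mpoly_ideal_cnst [OF J]
    by (auto simp: mpv.subspace_def)
  then have "mpspan Q \<subseteq> J" using QJ by (intro mpv.span_minimal) auto
  then have "kforms m 2 \<subseteq> J" using Q by blast
  then interpret presentation m J
    using m J QJ by (intro presentation.intro) (auto simp: kforms_def)
  show "J \<subseteq> hid m" using Jk hid_eq_pker [OF m1] by simp
  show "hid m \<subseteq> J"
    unfolding hid_eq_genideal [OF m1]
  proof (intro mpoly_genideal_minimal [OF J] UN_least subsetI)
    fix d F assume F: "F \<in> kforms m d"
    then have "F \<in> normalizable d" using forms_normalizable by (auto simp: kforms_def)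
    then obtain q where q: "q \<in> mpspan (nrep m d ` nkeys m d)" "F - q \<in> J"
      by (auto simp: normalizable_def)
    have "pull m q a = 0" for a
    proof -
      have "pull m (F - q) a = 0" using q(2) Jk by (auto simp: pker_def)
      then show ?thesis using F by (simp add: pull_hom kforms_def)
    qed
    then have "q = 0" using nrep_span_vanishing [OF m1 q(1)] by blast
    then show "F \<in> J" using q(2) by simp
  qed
qed

text \<open>Near the vertex \<open>x = y = 0\<close>, to lowest order only \<open>G_x\<close> and \<open>G_y\<close> survive, so \<open>\<bar>X\<close> contains
  the line spanned by the two corresponding coordinate points.\<close>

definition gpoint :: "(axis \<Rightarrow> complex) \<Rightarrow> coord \<Rightarrow> complex" where
  "gpoint e c = (case c of CoordG v \<Rightarrow> e v | CoordL t \<Rightarrow> 0)"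

lemma kforms_vanish_line:
  assumes m: "m \<ge> 1" and F: "F \<in> kforms m d" and e: "e v = 0"
  shows "eval_mpoly (gpoint e) F = 0"
proof -
  define w u where "w = nxt v" and "u = nxt w"
  have dist: "distinct [v, w, u]" unfolding w_def u_def by (rule distinct_nxt)
  then have ne: "v \<noteq> w" "w \<noteq> v" "u \<noteq> w" "w \<noteq> u" "u \<noteq> v" "v \<noteq> u" by auto
  have nu: "nxt u = v" by (cases v) (auto simp: u_def w_def)
  \<comment> \<open>The points (1, s \<beta>, s \<gamma>) tend to the vertex x_w = x_u = 0. There
    G_u starts with s \<beta> and G_w with -(-1)^m s \<gamma>, so these values give the leading
    coefficients e u and e w; \<open>\<psi>\<close> is the coordinate vector divided by s.\<close>
  define \<beta> \<gamma> where "\<beta> = e u" and "\<gamma> = - ((-1) ^ m) * e w"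
  define t :: "complex poly" where "t = [:0, 1:]"
  define \<psi> where "\<psi> c = (case c of
      CoordG k \<Rightarrow> if k = v then t * [:\<beta> * \<gamma>:] * ((t * [:\<beta>:]) ^ m - (- t * [:\<gamma>:]) ^ m)
        else if k = w then [:\<gamma>:] * ((t * [:\<gamma>:]) ^ m - [:(-1) ^ m:])
        else [:\<beta>:] * (1 - (- t * [:\<beta>:]) ^ m)
    | CoordL k \<Rightarrow> t * [:\<beta> * \<gamma>:] * mval (\<lambda>x. if x = v then 1 else if x = w then t * [:\<beta>:] else t * [:\<gamma>:]) k)" for c
  define a where "a s = (\<lambda>x. if x = v then 1 else if x = w then s * \<beta> else s * \<gamma>)" for s
  have a: "a s v = 1" "a s w = s * \<beta>" "a s u = s * \<gamma>" for s using ne by (auto simp: a_def)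
  have val: "cval m (a s) c = s * poly (\<psi> c) s" for s c
  proof (cases c)
    case (CoordG k)
    consider "k = v" | "k = w" | "k = u" using axis_cases_distinct [OF dist, of k] by blast
    then show ?thesis
    proof cases
      case 1
      then show ?thesis
        by (simp add: CoordG \<psi>_def t_def a mult_ac flip: w_def u_def)
    next
      case 2
      then show ?thesis using ne nu
        by (simp add: CoordG \<psi>_def t_def a mult_ac flip: w_def u_def)
    next
      case 3
      then show ?thesis using ne nu
        by (simp add: CoordG \<psi>_def t_def a mult_ac flip: w_def u_def)
    qed
  next
    case (CoordL k)
    have "poly (mval (\<lambda>x. if x = v then 1 else if x = w then t * [:\<beta>:] else t * [:\<gamma>:]) k) s = mval (a s) k"
      unfolding poly_mval by (rule arg_cong [of _ _ "\<lambda>f. mval f k"]) (auto simp: a_def t_def)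
    then show ?thesis
      by (simp add: CoordL \<psi>_def axis_prod [OF dist] a) (simp add: t_def)
  qed
  have Ff: "F \<in> forms (coords m) d" using F by (simp add: kforms_def)
  have "poly (Polynomial.monom 1 d * peval \<psi> F) s = 0" for s
  proof -
    have "s ^ d * poly (peval \<psi> F) s = pull m F (a s)"
      unfolding poly_peval pull_def val eval_form_scale [OF Ff] ..
    then show ?thesis using F by (simp add: kforms_def poly_monom)
  qed
  then have "Polynomial.monom 1 d * peval \<psi> F = 0" using poly_all_0_iff_0 by blast
  then have "peval \<psi> F = 0" by simp
  then have "poly (peval \<psi> F) 0 = 0" by simp
  moreover have "poly (\<psi> c) 0 = gpoint e c" for c
  proof (cases c)
    case (CoordG k)
    have "e w = (-1) ^ m * ((-1) ^ m * e w)" by (simp flip: mult.assoc power_mult_distrib)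
    moreover have "k = v \<or> k = w \<or> k = u" by (rule axis_cases_distinct [OF dist])
    ultimately show ?thesis using m ne e
      by (elim disjE) (simp_all add: CoordG \<psi>_def t_def gpoint_def \<beta>_def \<gamma>_def zero_power mult_ac)
  qed (simp add: \<psi>_def t_def gpoint_def)
  ultimately show ?thesis by (simp add: poly_peval)
qed

text \<open>Only monomials in the G's survive at these points. A quadratic one involves at most two
  of the three G's, and the full inclusion-exclusion difference kills every function that ignores
  one of the variables; the value at the origin is 0.\<close>

lemma quadric_inclusion_exclusion:
  assumes F: "F \<in> forms (coords m) 2"
  defines "E \<equiv> \<lambda>x y z. eval_mpoly (gpoint (\<lambda>v. case v of Vx \<Rightarrow> x | Vy \<Rightarrow> y | Vz \<Rightarrow> z)) F"
  shows "E 1 1 1 = E 1 1 0 + E 1 0 1 + E 0 1 1 - E 1 0 0 - E 0 1 0 - E 0 0 1"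
proof -
  define e where "e x y z = (\<lambda>v. case v of Vx \<Rightarrow> x | Vy \<Rightarrow> y | Vz \<Rightarrow> z)" for x y z :: complex
  define M where "M t x y z = mval (gpoint (e x y z)) t" for t x y z
  have "M t 1 1 1 = M t 1 1 0 + M t 1 0 1 + M t 0 1 1 - M t 1 0 0 - M t 0 1 0 - M t 0 0 1"
    if t: "t \<in> kys F" for t
  proof -
    have kt: "kys t \<subseteq> coords m" "mdegree t = 2" using F t by (auto simp: forms_iff)
    obtain g A where gA: "mmonom t = gmon g * lmon A" "size g + size A = 2"
      using mmonom_as_product [OF kt] by blast
    have M: "M t x y z = (\<Prod>v\<in>#g. e x y z v) * 0 ^ size A" for x y z
    proof -
      have "M t x y z = eval_mpoly (gpoint (e x y z)) (gmon g * lmon A)"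
        by (simp add: M_def gA(1) flip: eval_mpoly_mmonom)
      also have "\<dots> = (\<Prod>v\<in>#g. e x y z v) * (\<Prod>t\<in>#A. 0)"
        by (simp add: eval_mpoly_hom gmon_def lmon_def gpoint_def)
      finally show ?thesis by simp
    qed
    show ?thesis
    proof (cases "A = {#}")
      case True
      then have "size g = Suc 1" using gA by simp
      then obtain a g' where "g = add_mset a g'" "size g' = 1"
        using size_eq_Suc_imp_eq_union [of g 1] by auto
      then obtain b where "g = {#a, b#}" using size_1_singleton_mset by blast
      then show ?thesis unfolding M True by (cases a; cases b) (simp_all add: e_def)
    next
      case False
      then have z: "0 ^ size A = (0 :: complex)" by (simp add: nonempty_has_size zero_power)
      show ?thesis unfolding M z by simp
    qed
  qed
  then have *: "(\<Sum>t\<in>kys F. lkp F t * M t 1 1 1) = (\<Sum>t\<in>kys F. lkp F t *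
      (M t 1 1 0 + M t 1 0 1 + M t 0 1 1 - M t 1 0 0 - M t 0 1 0 - M t 0 0 1))"
    by simp
  have E: "E x y z = (\<Sum>t\<in>kys F. lkp F t * M t x y z)" for x y z
    by (simp add: E_def eval_mpoly_superset [OF finite_keys order_refl] M_def e_def)
  show ?thesis
    unfolding E * by (simp add: algebra_simps sum.distrib sum_subtractf)
qed

lemma cubic_C_notin:
  assumes m: "m \<ge> 1" and Q: "Q \<subseteq> kforms m 2"
  shows "cubic_C m \<notin> genideal (cring_of m) Q"
proof -
  define I where "I = {P \<in> carrier (cring_of m). eval_mpoly (gpoint (\<lambda>_. 1)) P = 0}"
  have I: "ideal I (cring_of m)"
    by (rule mpoly_idealI) (auto simp: I_def eval_mpoly_hom intro: mpoly_closed)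
  have one: "(\<lambda>v. case v of Vx \<Rightarrow> 1 | Vy \<Rightarrow> 1 | Vz \<Rightarrow> 1) = (\<lambda>_. 1 :: complex)"
    by (auto split: axis.split)
  have "kforms m 2 \<subseteq> I"
  proof
    fix F assume F: "F \<in> kforms m 2"
    then have Ff: "F \<in> forms (coords m) 2" by (simp add: kforms_def)
    have z: "eval_mpoly (gpoint (\<lambda>v. case v of Vx \<Rightarrow> x | Vy \<Rightarrow> y | Vz \<Rightarrow> z)) F = 0"
      if "x = 0 \<or> y = 0 \<or> z = 0" for x y z
      using that kforms_vanish_line [OF m F, of _ Vx] kforms_vanish_line [OF m F, of _ Vy]
        kforms_vanish_line [OF m F, of _ Vz] by auto
    show "F \<in> I"
      using quadric_inclusion_exclusion [OF Ff] forms_carrier [OF Ff] by (simp add: z I_def one)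
  qed
  then have "genideal (cring_of m) Q \<subseteq> I"
    using Q by (intro mpoly_genideal_minimal [OF I]) auto
  moreover have "eval_mpoly (gpoint (\<lambda>_. 1)) (cubic_C m) \<noteq> 0"
    by (simp add: cubic_C_def Let_def eval_mpoly_hom gpoint_def coordH_def)
  ultimately show ?thesis by (auto simp: I_def)
qed

text \<open>In degree 3 the generator C contributes scalar multiples only. The ideal
  \<open>T\<close> makes this precise: modulo the ideal of Q, its elements have no component below
  degree 3 and a scalar multiple of C in degree 3.\<close>

lemma cubic_generator_unique:
  assumes Q: "Q \<subseteq> forms (coords m) 2" and C: "C \<in> forms (coords m) 3" and F: "F \<in> forms (coords m) 3"
    and mem: "F \<in> genideal (cring_of m) (Q \<union> {C})"
  obtains c where "F - cnst c * C \<in> genideal (cring_of m) Q"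
proof -
  define R where "R = cring_of m"
  define I where "I = genideal R Q"
  have Qc: "Q \<subseteq> carrier R" using Q forms_carrier by (auto simp: R_def)
  have I: "ideal I (cring_of m)"
    using mpoly_genideal_ideal [of Q] Qc by (simp add: I_def R_def)
  have QI: "Q \<subseteq> I" using mpoly_genideal_self [of Q] Qc by (simp add: I_def R_def)
  define T where "T = {P \<in> carrier R. (\<forall>d<3. hcomp d P \<in> I) \<and> (\<exists>c. hcomp 3 P - cnst c * C \<in> I)}"
  have T: "ideal T (cring_of m)"
  proof (rule mpoly_idealI_terms)
    show "T \<subseteq> carrier (cring_of m)" by (auto simp: T_def R_def)
    show "0 \<in> T" using mpoly_ideal_zero [OF I] mpoly_zero_closed
      by (auto simp: T_def R_def intro: exI [of _ 0])
  next
    fix p q assume pq: "p \<in> T" "q \<in> T"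
    then obtain b c where bc: "hcomp 3 p - cnst b * C \<in> I" "hcomp 3 q - cnst c * C \<in> I"
      by (auto simp: T_def)
    have "hcomp 3 (p + q) - cnst (b + c) * C \<in> I"
      using mpoly_ideal_add [OF I bc] by (simp add: hcomp_add cnst_add algebra_simps)
    then show "p + q \<in> T"
      using pq mpoly_ideal_add [OF I] by (auto simp: T_def R_def hcomp_add intro: mpoly_closed)
  next
    fix p and t :: "coord \<Rightarrow>\<^sub>0 nat" and c :: complex assume p: "p \<in> T" and t: "kys t \<subseteq> coords m"
    have car: "sg t c \<in> carrier (cring_of m)" using t by (auto simp: carrier_mpoly_iff)
    have low: "hcomp d (sg t c * p) \<in> I" if "d < 3 \<or> d = 3 \<and> mdegree t > 0" for d
    proof -
      have "d - mdegree t < 3 \<or> d < mdegree t" using that by auto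
      then show ?thesis using p mpoly_ideal_zero [OF I] mpoly_ideal_mult [OF I _ car]
        by (auto simp: hcomp_single_mult T_def)
    qed
    have "\<exists>b. hcomp 3 (sg t c * p) - cnst b * C \<in> I"
    proof (cases "mdegree t = 0")
      case False
      then show ?thesis using low [of 3] by (intro exI [of _ 0]) auto
    next
      case True
      obtain b where b: "hcomp 3 p - cnst b * C \<in> I" using p by (auto simp: T_def)
      have "cnst c * (hcomp 3 p - cnst b * C) \<in> I" by (rule mpoly_ideal_cnst [OF I b])
      moreover have "sg t c = cnst c" using True by (simp add: mdegree_eq_0_iff cnst_def)
      moreover have "cnst c * (hcomp 3 p - cnst b * C) = hcomp 3 (cnst c * p) - cnst (c * b) * C"
        by (simp only: hcomp_cnst_mult cnst_mult right_diff_distrib mult.assoc)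
      ultimately have "hcomp 3 (sg t c * p) - cnst (c * b) * C \<in> I" by metis
      then show ?thesis ..
    qed
    then show "sg t c * p \<in> T"
      using low p car by (auto simp: T_def R_def intro: mpoly_closed)
  qed
  have "C \<in> T"
    using C mpoly_ideal_zero [OF I] forms_carrier
    by (auto simp: T_def R_def hcomp_of_form intro!: exI [of _ 1])
  moreover have "Q \<subseteq> T"
  proof
    fix q assume q: "q \<in> Q"
    then have "hcomp d q = (if d = 2 then q else 0)" for d using Q hcomp_of_form by blast
    then show "q \<in> T" using q QI Qc mpoly_ideal_zero [OF I]
      by (auto simp: T_def intro!: exI [of _ 0])
  qed
  ultimately have "genideal (cring_of m) (Q \<union> {C}) \<subseteq> T"
    by (intro mpoly_genideal_minimal [OF T]) auto
  then have "F \<in> T" using mem by auto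
  then show thesis using F that by (auto simp: T_def hcomp_of_form I_def R_def)
qed

text \<open>No generator has degree below 2, so in degree 2 only scalar combinations of Q occur.
  Applied with one basis element removed, this shows that no quadric is redundant.\<close>

lemma genideal_quadrics_part:
  assumes Q: "Q \<subseteq> forms (coords m) 2" and C: "C \<in> forms (coords m) 3"
    and p: "p \<in> genideal (cring_of m) (Q \<union> {C})" "p \<in> forms (coords m) 2"
  shows "p \<in> mpspan Q"
proof -
  define T where "T = {P \<in> carrier (cring_of m). hcomp 0 P = 0 \<and> hcomp 1 P = 0 \<and> hcomp 2 P \<in> mpspan Q}"
  have T: "ideal T (cring_of m)"
  proof (rule mpoly_idealI_terms)
    show "T \<subseteq> carrier (cring_of m)" by (auto simp: T_def)
    show "0 \<in> T" using mpoly_zero_closed mpv.span_zero by (auto simp: T_def)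
    show "p + q \<in> T" if "p \<in> T" "q \<in> T" for p q
      using that by (auto simp: T_def hcomp_add intro: mpoly_closed mpv.span_add)
  next
    fix p and t :: "coord \<Rightarrow>\<^sub>0 nat" and c :: complex assume p: "p \<in> T" and t: "kys t \<subseteq> coords m"
    have car: "sg t c * p \<in> carrier (cring_of m)"
      using t p by (intro mpoly_closed) (auto simp: carrier_mpoly_iff T_def)
    show "sg t c * p \<in> T"
    proof (cases "mdegree t = 0")
      case True
      then have "sg t c = cnst c" by (simp add: mdegree_eq_0_iff cnst_def)
      then show ?thesis using p car True mpv.span_scale [of "hcomp 2 p" Q c]
        by (auto simp: T_def hcomp_cnst_mult)
    next
      case False
      then have "2 - mdegree t = 0 \<or> 2 - mdegree t = 1" by auto
      then show ?thesis using p car False mpv.span_zero [of Q]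
        by (auto simp: T_def hcomp_single_mult)
    qed
  qed
  have "Q \<union> {C} \<subseteq> T"
    using Q C forms_carrier mpv.span_base [of _ Q] mpv.span_zero [of Q]
    by (auto simp: T_def hcomp_of_form)
  then have "p \<in> T" using mpoly_genideal_minimal [OF T] p by blast
  then show ?thesis using p by (auto simp: T_def hcomp_of_form)
qed

subsection \<open>The Hilbert function\<close>

lemma mpv_finite_independent_subset:
  assumes "V \<subseteq> mpspan S" "finite S" "mpv.independent B" "B \<subseteq> V"
  shows "finite B"
  using mpv.independent_span_bound [of S B] assms by blast

text \<open>The normal forms span a complement of the kernel in each degree: reduction modulo the
  kernel itself shows that they span together with it, and independence of their pullbacks that they
  meet it in 0.\<close>

theorem cdim_forms_split:
  assumes m: "m \<ge> 2"
  shows "cdim (forms (coords m) d) = cdim (kforms m d) + card (nkeys m d)"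
proof -
  have m1: "m \<ge> 1" using m by simp
  interpret presentation m "pker m" by (rule presentation_pker [OF m])
  define N where "N = nrep m d ` nkeys m d"
  have Nf: "N \<subseteq> forms (coords m) d" using nrep_form by (auto simp: N_def)
  have finN: "finite N" using finite_nkeys by (simp add: N_def)
  obtain B where B: "B \<subseteq> kforms m d" "mpv.independent B" "kforms m d \<subseteq> mpspan B" "card B = mpv.dim (kforms m d)"
    using mpv.basis_exists [of "kforms m d"] by blast
  have kf: "kforms m d \<subseteq> forms (coords m) d" by (auto simp: kforms_def)
  have finB: "finite B"
  proof (rule mpv_finite_independent_subset)
    show "forms (coords m) d \<subseteq> mpspan (mmonom ` {t. kys t \<subseteq> coords m \<and> mdegree t = d})"
      by (simp add: forms_span_mmonom)
    show "finite (mmonom ` {t. kys t \<subseteq> coords m \<and> mdegree t = d})"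
      by (intro finite_imageI finite_mdegree finite_coords)
  qed (use B kf in auto)
  have disj: "p = 0" if "p \<in> mpspan N" "p \<in> kforms m d" for p
    using nrep_span_vanishing [OF m1, of p d] that by (auto simp: N_def kforms_def)
  have spanB: "mpspan B \<subseteq> kforms m d" by (rule mpv.span_minimal [OF B(1) kforms_subspace])
  have BN: "B \<inter> N = {}"
  proof (rule ccontr)
    assume "\<not> ?thesis"
    then obtain p where p: "p \<in> B" "p \<in> N" by blast
    then have "p = 0" using disj [of p] B(1) mpv.span_base by blast
    then show False using p B(2) mpv.dependent_zero by blast
  qed
  have ind: "mpv.independent (B \<union> N)"
    unfolding mpv.dependent_finite [OF finite_UnI [OF finB finN]]
  proof (rule notI, elim exE conjE)
    fix u assume u: "\<exists>v\<in>B \<union> N. u v \<noteq> 0" and s: "(\<Sum>v\<in>B \<union> N. cnst (u v) * v) = 0"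
    define sB sN where "sB = (\<Sum>v\<in>B. cnst (u v) * v)" and "sN = (\<Sum>v\<in>N. cnst (u v) * v)"
    have "sB + sN = 0" using s by (simp add: sum.union_disjoint [OF finB finN BN] sB_def sN_def)
    have sBk: "sB \<in> kforms m d"
      using spanB mpv.span_sum mpv.span_scale mpv.span_base unfolding sB_def by (metis (no_types, lifting) subsetD)
    have sNs: "sN \<in> mpspan N"
      unfolding sN_def by (intro mpv.span_sum mpv.span_scale mpv.span_base)
    have "sN = cnst (-1) * sB" using \<open>sB + sN = 0\<close> by (simp add: cnst_uminus eq_neg_iff_add_eq_0 add.commute)
    then have "sN \<in> kforms m d" using sBk mpv.subspace_scale [OF kforms_subspace] by metis
    then have 0: "sN = 0" "sB = 0" using disj [OF sNs] \<open>sB + sN = 0\<close> by auto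
    have "\<forall>v\<in>B. u v = 0" using 0(2) B(2) mpv.dependent_finite [OF finB] unfolding sB_def by blast
    moreover have "\<forall>v\<in>N. u v = 0"
      using 0(1) nrep_independent [OF m1, of d] mpv.dependent_finite [OF finN] unfolding sN_def N_def by blast
    ultimately show False using u by blast
  qed
  have span: "mpspan (B \<union> N) = forms (coords m) d"
  proof
    show "mpspan (B \<union> N) \<subseteq> forms (coords m) d"
      using B(1) kf Nf by (intro mpv.span_minimal forms_subspace) auto
    show "forms (coords m) d \<subseteq> mpspan (B \<union> N)"
    proof
      fix F assume F: "F \<in> forms (coords m) d"
      then obtain q where q: "q \<in> mpspan N" "F - q \<in> pker m"
        using forms_normalizable by (auto simp: normalizable_def N_def)
      have "q \<in> forms (coords m) d" using q(1) mpv.span_minimal [OF Nf forms_subspace] by blast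
      then have "F - q \<in> kforms m d"
        using q(2) F mpv.subspace_diff [OF forms_subspace] by (auto simp: kforms_def pker_def)
      then have "F - q \<in> mpspan (B \<union> N)" using B(3) mpv.span_mono [of B "B \<union> N"] by blast
      moreover have "q \<in> mpspan (B \<union> N)" using q(1) mpv.span_mono [of N "B \<union> N"] by blast
      ultimately have "F - q + q \<in> mpspan (B \<union> N)" by (rule mpv.span_add)
      then show "F \<in> mpspan (B \<union> N)" by simp
    qed
  qed
  have "mpv.dim (forms (coords m) d) = card (B \<union> N)"
    using mpv.dim_span_eq_card_independent [OF ind] span by simp
  also have "\<dots> = card B + card N" by (rule card_Un_disjoint [OF finB finN BN])
  also have "card N = card (nkeys m d)" unfolding N_def by (rule card_image [OF nrep_inj [OF m1]])
  finally show ?thesis using B(4) by (simp add: cdim_eq)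
qed

lemma hilbert_function_Xbar:
  "m \<ge> 2 \<Longrightarrow> hilbert_function (coords m) (Xbar m) d = card (nkeys m d)"
  by (simp add: hilbert_function_def hid_forms cdim_forms_split)

section \<open>Counting normal forms\<close>

abbreviation exps :: "'a multiset \<Rightarrow> 'a \<Rightarrow>\<^sub>0 nat" where
  "exps M \<equiv> Abs_poly_mapping (count M)"

lemma mdegree_multiset: "mdegree (exps M) = size M"
    and keys_multiset: "kys (exps M) = set_mset M"
    and lookup_multiset: "lkp (exps M) = count M"
proof -
  have "finite {x. count M x \<noteq> 0}"
    by (rule finite_subset [OF _ finite_set_mset [of M]]) (auto simp: count_eq_zero_iff)
  then show l: "lkp (exps M) = count M" by simp
  show k: "kys (exps M) = set_mset M"
    by (auto simp: in_keys_iff l count_eq_zero_iff)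
  show "mdegree (exps M) = size M"
    by (simp add: mdegree_def l k size_multiset_overloaded_eq)
qed

lemma card_mdegree:
  assumes "finite W"
  shows "card {t. kys t \<subseteq> W \<and> mdegree t = n} = (card W + n - 1) choose n" (is "card ?T = _")
proof -
  have "bij_betw exps (multisets_of_size W n) ?T"
  proof (rule bij_betw_imageI)
    show "inj_on exps (multisets_of_size W n)"
      by (rule inj_onI) (metis lookup_multiset multiset_eqI)
    show "exps ` multisets_of_size W n = ?T"
    proof
      show "exps ` multisets_of_size W n \<subseteq> ?T"
        by (auto simp: multisets_of_size_def mdegree_multiset keys_multiset)
      show "?T \<subseteq> exps ` multisets_of_size W n"
      proof
        fix t assume t: "t \<in> ?T"
        define M where "M = Abs_multiset (lkp t)"
        have "{x. 0 < lkp t x} = kys t" by (auto simp: in_keys_iff)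
        then have "count M = lkp t" unfolding M_def by (intro count_Abs_multiset) simp
        then have M: "t = exps M" by simp
        then have "M \<in> multisets_of_size W n"
          using t mdegree_multiset [of M] keys_multiset [of M] by (simp add: multisets_of_size_def)
        then show "t \<in> exps ` multisets_of_size W n" using M by blast
      qed
    qed
  qed
  then have "card ?T = card (multisets_of_size W n)"
    by (rule bij_betw_same_card [symmetric])
  then show ?thesis using card_multisets_of_size [of W n] assms by simp
qed

lemma card_UNIV_axis: "card (UNIV :: axis set) = 3"
  by (simp add: UNIV_axis)

lemma nxt3 [simp]: "nxt (nxt (nxt v)) = v" by (cases v) auto

text \<open>Each edge is taken half-open, containing its first vertex x_v^D but not the next one, so
  a walk round the triangle meets every boundary vector once.\<close>

lemma card_bnd:
  assumes "D \<ge> 1" shows "card {t. bnd D t} = 3 * D"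
proof -
  define f where "f = (\<lambda>(v, i). sg v (D - i) + sg (nxt v) i)"
  have ne: "v \<noteq> nxt v" "nxt v \<noteq> v" "v \<noteq> nxt (nxt v)" "nxt (nxt v) \<noteq> v" "nxt (nxt v) \<noteq> nxt v" "nxt v \<noteq> nxt (nxt v)" for v
    by (cases v; simp)+
  have "inj_on f (UNIV \<times> {..<D})"
  proof (rule inj_onI, clarify)
    fix v i w j assume ij: "i < D" "j < D" and eq: "f (v, i) = f (w, j)"
    have lf: "lkp (f (v, i)) x = (if x = v then D - i else if x = nxt v then i else 0)" for v i x
      using ne [of v] by (auto simp: f_def lookup_add lookup_single)
    have l: "(if x = v then D - i else if x = nxt v then i else 0) =
       (if x = w then D - j else if x = nxt w then j else 0)" for x
      using arg_cong [OF eq, of "\<lambda>t. lkp t x"] unfolding lf .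
    have "v = w"
      using l [of v] l [of w] l [of "nxt v"] l [of "nxt w"] l [of "nxt (nxt v)"] l [of "nxt (nxt w)"] ij
      by (cases v; cases w) auto
    then show "v = w \<and> i = j" using l [of "nxt v"] ne [of v] by auto
  qed
  moreover have "f ` (UNIV \<times> {..<D}) = {t. bnd D t}"
  proof
    show "f ` (UNIV \<times> {..<D}) \<subseteq> {t. bnd D t}"
      using ne by (auto simp: f_def intro!: bnd_edge)
    show "{t. bnd D t} \<subseteq> f ` (UNIV \<times> {..<D})"
    proof
      fix t assume "t \<in> {t. bnd D t}"
      then have b: "bnd D t" by simp
      then obtain k where k: "lkp t k = 0" by (auto simp: bnd_def)
      define v where "v = nxt k"
      have kv: "nxt (nxt v) = k" by (simp add: v_def)
      have deg: "lkp t v + lkp t (nxt v) = D"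
        using b k mdegree_axis [OF distinct_nxt [of v], of t] by (simp add: bnd_def kv)
      have t: "t = sg v (lkp t v) + sg (nxt v) (lkp t (nxt v))"
        using ne [of v] k kv by (intro axis_ext [OF distinct_nxt [of v]]) (auto simp: lookup_add lookup_single)
      show "t \<in> f ` (UNIV \<times> {..<D})"
      proof (cases "lkp t v = 0")
        case False
        then show ?thesis using t deg
          by (intro image_eqI [of _ _ "(v, lkp t (nxt v))"]) (auto simp: f_def)
      next
        case True
        then have "t = f (nxt v, 0)" using t deg by (simp add: f_def)
        then show ?thesis using assms by (intro image_eqI [of _ _ "(nxt v, 0)"]) auto
      qed
    qed
  qed
  ultimately have "card {t. bnd D t} = card ((UNIV :: axis set) \<times> {..<D})"
    using card_image by metis
  then show ?thesis by (simp add: card_cartesian_product card_UNIV_axis)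
qed

lemma coords_eq: "coords m = CoordG ` UNIV \<union> CoordL ` {t. bnd (m - 1) t}"
  using CoordG_in_coords CoordL_in_coords by (auto, metis coord.exhaust rangeI imageI mem_Collect_eq)

lemma card_coords: assumes "m \<ge> 2" shows "card (coords m) = 3 * m"
proof -
  have fin: "finite (CoordL ` {t. bnd (m - 1) t})"
    using finite_coords [of m] by (simp add: coords_eq)
  have "card (coords m) = card (CoordG ` UNIV) + card (CoordL ` {t. bnd (m - 1) t})"
    unfolding coords_eq by (rule card_Un_disjoint) (use fin in auto)
  also have "card (range CoordG) = 3"
    by (simp add: card_image inj_on_def card_UNIV_axis)
  also have "card (CoordL ` {t. bnd (m - 1) t}) = 3 * (m - 1)"
    using assms by (simp add: card_image inj_on_def card_bnd)
  finally show ?thesis using assms by simp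
qed

lemma cdim_forms_2: assumes "m \<ge> 2" shows "2 * cdim (forms (coords m) 2) = 3 * m * (3 * m + 1)"
proof -
  have "cdim (forms (coords m) 2) = (3 * m + 1) choose 2"
    unfolding cdim_forms card_mdegree [OF finite_coords] card_coords [OF assms] by simp
  then show ?thesis by (simp add: choose_two)
qed

text \<open>From here on counts are doubled to avoid division of natural numbers.\<close>

lemma twice_sum_lessThan: "2 * (\<Sum>i<d. i) = d * (d - 1 :: nat)"
  by (induction d) (auto simp: algebra_simps gr0_conv_Suc split: nat_diff_split)

lemma card_pairs: "2 * card {(i, j). 1 \<le> i \<and> 1 \<le> j \<and> i + j \<le> (d::nat)} = d * (d - 1)"
proof -
  have "{(i, j). 1 \<le> i \<and> 1 \<le> j \<and> i + j \<le> d} = (SIGMA i:{1..d}. {1..d - i})" by auto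
  then have "card {(i, j). 1 \<le> i \<and> 1 \<le> j \<and> i + j \<le> d} = (\<Sum>i=1..d. d - i)" by simp
  also have "2 * (\<Sum>i=1..d. d - i) = d * (d - 1)"
  proof -
    have "(\<Sum>i=1..d. d - i) = (\<Sum>i<d. i)"
      by (rule sum.reindex_bij_witness [of _ "\<lambda>i. d - i" "\<lambda>i. d - i"]) auto
    then show ?thesis by (simp only: twice_sum_lessThan)
  qed
  finally show ?thesis by simp
qed

lemma sum_line_dims: "2 * (\<Sum>j=1..d. (d - j) * D + 1) = D * (d * (d - 1)) + 2 * (d::nat)"
proof -
  have "(\<Sum>j=1..d. (d - j) * D + 1) = D * (\<Sum>j=1..d. d - j) + d"
    by (simp only: sum.distrib sum_distrib_left mult.commute) simp
  moreover have "(\<Sum>j=1..d. d - j) = (\<Sum>i<d. i)"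
    by (rule sum.reindex_bij_witness [of _ "\<lambda>i. d - i" "\<lambda>i. d - i"]) auto
  ultimately have "2 * (\<Sum>j=1..d. (d - j) * D + 1) = D * (2 * (\<Sum>i<d. i)) + 2 * d" by simp
  then show ?thesis by (simp only: twice_sum_lessThan)
qed

section \<open>The possible G-parts of normal forms, sorted by the size of their support\<close>

definition gsets :: "nat \<Rightarrow> axis multiset set" where
  "gsets d = {g. size g \<le> d \<and> (\<exists>v. v \<notin># g)}"

definition gsets1 :: "nat \<Rightarrow> axis multiset set" where
  "gsets1 d = (\<lambda>(v, j). replicate_mset j v) ` (UNIV \<times> {1..d})"

definition gsets2 :: "nat \<Rightarrow> axis multiset set" where
  "gsets2 d = (\<lambda>(v, i, j). replicate_mset i (nxt v) + replicate_mset j (nxt (nxt v))) `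
     (UNIV \<times> {(i, j). 1 \<le> i \<and> 1 \<le> j \<and> i + j \<le> d})"

lemma gsets1I: "1 \<le> j \<Longrightarrow> j \<le> d \<Longrightarrow> replicate_mset j v \<in> gsets1 d"
  unfolding gsets1_def by (rule image_eqI [of _ _ "(v, j)"]) auto

lemma gsets2I:
  "1 \<le> i \<Longrightarrow> 1 \<le> j \<Longrightarrow> i + j \<le> d \<Longrightarrow> replicate_mset i (nxt v) + replicate_mset j (nxt (nxt v)) \<in> gsets2 d"
  unfolding gsets2_def by (rule image_eqI [of _ _ "(v, i, j)"]) auto

lemma gsets_split: "gsets d = insert {#} (gsets1 d \<union> gsets2 d)"
proof
  show "gsets d \<subseteq> insert {#} (gsets1 d \<union> gsets2 d)"
  proof
    fix g assume "g \<in> gsets d"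
    then obtain v where g: "size g \<le> d" "count g v = 0" by (auto simp: gsets_def not_in_iff)
    define w u where "w = nxt v" and "u = nxt w"
    have dist: "distinct [v, w, u]" unfolding w_def u_def by (rule distinct_nxt)
    have sz: "size g = count g w + count g u" unfolding size_axis axis_sum [OF dist] using g by simp
    have geq: "g = replicate_mset (count g w) w + replicate_mset (count g u) u"
    proof (rule multiset_eqI)
      fix x show "count g x = count (replicate_mset (count g w) w + replicate_mset (count g u) u) x"
        using axis_cases_distinct [OF dist, of x] dist g by auto
    qed
    consider "count g w = 0" "count g u = 0" | "count g w = 0" "count g u > 0"
      | "count g w > 0" "count g u = 0" | "count g w > 0" "count g u > 0" by linarith
    then show "g \<in> insert {#} (gsets1 d \<union> gsets2 d)"
    proof cases
      case 1
      then show ?thesis using geq by simp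
    next
      case 2
      then have "g = replicate_mset (count g u) u" using geq by simp
      moreover have "replicate_mset (count g u) u \<in> gsets1 d" using 2 g sz by (intro gsets1I) auto
      ultimately show ?thesis by simp
    next
      case 3
      then have "g = replicate_mset (count g w) w" using geq by simp
      moreover have "replicate_mset (count g w) w \<in> gsets1 d" using 3 g sz by (intro gsets1I) auto
      ultimately show ?thesis by simp
    next
      case 4
      have "replicate_mset (count g w) w + replicate_mset (count g u) u \<in> gsets2 d"
        unfolding w_def u_def by (rule gsets2I) (use 4 g sz in \<open>auto simp flip: w_def u_def\<close>)
      then show ?thesis using geq by simp
    qed
  qed
  have ne: "v \<noteq> nxt v" "v \<noteq> nxt (nxt v)" "nxt v \<noteq> v" for v by (cases v; simp)+
  show "insert {#} (gsets1 d \<union> gsets2 d) \<subseteq> gsets d"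
  proof
    fix g assume "g \<in> insert {#} (gsets1 d \<union> gsets2 d)"
    then consider "g = {#}" | "g \<in> gsets1 d" | "g \<in> gsets2 d" by blast
    then show "g \<in> gsets d"
    proof cases
      case 2
      then obtain v j where "g = replicate_mset j v" "j \<le> d" by (auto simp: gsets1_def)
      then show ?thesis using ne(3) [of v] by (auto simp: gsets_def intro!: exI [of _ "nxt v"] split: if_splits)
    next
      case 3
      then obtain v i j where "g = replicate_mset i (nxt v) + replicate_mset j (nxt (nxt v))" "i + j \<le> d"
        by (auto simp: gsets2_def)
      then show ?thesis using ne(1,2) [of v] by (auto simp: gsets_def intro!: exI [of _ v] split: if_splits)
    qed (simp add: gsets_def)
  qed
qed

lemma set_gsets1: "(v, j) \<in> UNIV \<times> {1..d} \<Longrightarrow> set_mset (replicate_mset j v) = {v}"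
  by auto

lemma set_gsets2:
  "1 \<le> i \<Longrightarrow> 1 \<le> j \<Longrightarrow> set_mset (replicate_mset i (nxt v) + replicate_mset j (nxt (nxt v))) = UNIV - {v}"
proof -
  assume "1 \<le> i" "1 \<le> j"
  then have "set_mset (replicate_mset i (nxt v) + replicate_mset j (nxt (nxt v))) = {nxt v, nxt (nxt v)}" by auto
  also have "\<dots> = UNIV - {v}" by (cases v) (auto simp: UNIV_axis)
  finally show ?thesis .
qed

lemma gsets1_inj: "inj_on (\<lambda>(v, j). replicate_mset j v) ((UNIV :: axis set) \<times> {1..d})"
proof (rule inj_onI)
  fix p q :: "axis \<times> nat"
  assume pq: "p \<in> UNIV \<times> {1..d}" "q \<in> UNIV \<times> {1..d}"
    "(\<lambda>(v, j). replicate_mset j v) p = (\<lambda>(v, j). replicate_mset j v) q"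
  obtain v i w j where e: "p = (v, i)" "q = (w, j)" by (cases p, cases q)
  have eq: "replicate_mset i v = replicate_mset j w" using pq(3) e by simp
  have "{v} = {w}" using pq set_gsets1 [of v i d] set_gsets1 [of w j d] unfolding e eq by simp
  moreover have "i = j" using arg_cong [OF eq, of size] by simp
  ultimately show "p = q" using e by simp
qed

lemma gsets2_inj:
  "inj_on (\<lambda>(v, i, j). replicate_mset i (nxt v) + replicate_mset j (nxt (nxt v)))
     (UNIV \<times> {(i, j). 1 \<le> i \<and> 1 \<le> j \<and> i + j \<le> d})"
proof (rule inj_onI)
  fix p q :: "axis \<times> nat \<times> nat"
  let ?f = "\<lambda>(v, i, j). replicate_mset i (nxt v) + replicate_mset j (nxt (nxt v))"
  assume pq: "p \<in> UNIV \<times> {(i, j). 1 \<le> i \<and> 1 \<le> j \<and> i + j \<le> d}"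
      "q \<in> UNIV \<times> {(i, j). 1 \<le> i \<and> 1 \<le> j \<and> i + j \<le> d}" "?f p = ?f q"
  obtain v i j w k l where e: "p = (v, i, j)" "q = (w, k, l)" by (cases p, cases q)
  have ij: "1 \<le> i" "1 \<le> j" "1 \<le> k" "1 \<le> l" using pq e by auto
  have eq: "replicate_mset i (nxt v) + replicate_mset j (nxt (nxt v)) =
       replicate_mset k (nxt w) + replicate_mset l (nxt (nxt w))" using pq(3) e by simp
  have "UNIV - {v} = UNIV - {w}" using set_gsets2 [OF ij(1,2)] set_gsets2 [OF ij(3,4)] eq by metis
  then have vw: "v = w" by blast
  have ne: "nxt v \<noteq> nxt (nxt v)" by (cases v) auto
  have "i = k" using arg_cong [OF eq, of "\<lambda>g. count g (nxt v)"] vw ne by simp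
  moreover have "j = l" using arg_cong [OF eq, of "\<lambda>g. count g (nxt (nxt v))"] vw ne by simp
  ultimately show "p = q" using vw e by simp
qed

lemma gsets1_set: "g \<in> gsets1 d \<Longrightarrow> card (set_mset g) = 1"
  by (auto simp: gsets1_def)

lemma gsets2_set: assumes "g \<in> gsets2 d" shows "card (set_mset g) = 2"
proof -
  obtain v i j where g: "g = replicate_mset i (nxt v) + replicate_mset j (nxt (nxt v))" "1 \<le> i" "1 \<le> j"
    using assms by (auto simp: gsets2_def)
  have "set_mset g = UNIV - {v}" unfolding g(1) by (rule set_gsets2 [OF g(2,3)])
  then show ?thesis by (simp add: card_Diff_subset card_UNIV_axis)
qed

lemma finite_pairs: "finite {(i, j). 1 \<le> i \<and> 1 \<le> j \<and> i + j \<le> (d::nat)}"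
  by (rule finite_subset [of _ "{..d} \<times> {..d}"]) auto

text \<open>Over a fixed \<open>g\<close> the vector \<open>s\<close> ranges over a triangle, an
  edge or a point, according to whether 0, 1 or 2 different G's occur. The three summands are these
  contributions, the last two once for each choice of axes.\<close>

lemma card_nkeys:
  assumes d: "d \<ge> 2"
  shows "2 * card (nkeys m d) = (d * (m - 1) + 1) * (d * (m - 1) + 2)
    + 3 * ((m - 1) * (d * (d - 1)) + 2 * d) + 3 * (d * (d - 1))"
proof -
  define D where "D = m - 1"
  define S where "S g = {s. kys s \<subseteq> UNIV - set_mset g \<and> mdegree s = (d - size g) * D}" for g :: "axis multiset"
  have nk: "nkeys m d = Sigma (gsets d) S"
  proof -
    have iff: "(kys s \<subseteq> UNIV - set_mset g) = (\<forall>v\<in>#g. lkp s v = 0)" for s :: "axis \<Rightarrow>\<^sub>0 nat" and g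
      by (auto simp: in_keys_iff)
    \<comment> \<open>Here d >= 2 matters: a single factor xyz lambda leaves room for at least one
      G_v, and \<open>s\<close> vanishes at v. Thus the boundary condition follows from the others;
      in degree 1 the empty \<open>g\<close> would be an exception.\<close>
    have "bnd D s" if "d - size g = 1" "mdegree s = (d - size g) * D" "\<forall>v\<in>#g. lkp s v = 0" for g and s :: "axis \<Rightarrow>\<^sub>0 nat"
    proof -
      have "g \<noteq> {#}" using that(1) d by auto
      then obtain v where "v \<in># g" by (rule multiset_nonemptyE)
      then show ?thesis using that by (auto simp: bnd_def)
    qed
    then show ?thesis unfolding nkeys_def gsets_def S_def iff D_def by auto
  qed
  have cS: "card (S g) = (3 - card (set_mset g) + (d - size g) * D - 1) choose ((d - size g) * D)" for g
    unfolding S_def by (subst card_mdegree) (auto simp: card_Diff_subset card_UNIV_axis)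
  have fS: "finite (S g)" for g unfolding S_def by (rule finite_mdegree) simp
  have f1: "finite (gsets1 d)" by (simp add: gsets1_def)
  have f2: "finite (gsets2 d)" unfolding gsets2_def by (intro finite_imageI finite_cartesian_product finite_pairs) simp
  have "card (nkeys m d) = (\<Sum>g\<in>gsets d. card (S g))"
    unfolding nk by (rule card_SigmaI) (use f1 f2 fS in \<open>auto simp: gsets_split\<close>)
  also have "\<dots> = card (S {#}) + (\<Sum>g\<in>gsets1 d \<union> gsets2 d. card (S g))"
    unfolding gsets_split using f1 f2 gsets1_set gsets2_set by (intro sum.insert) fastforce+
  also have "(\<Sum>g\<in>gsets1 d \<union> gsets2 d. card (S g)) = (\<Sum>g\<in>gsets1 d. card (S g)) + (\<Sum>g\<in>gsets2 d. card (S g))"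
    using f1 f2 gsets1_set gsets2_set by (intro sum.union_disjoint) fastforce+
  also have "(\<Sum>g\<in>gsets2 d. card (S g)) = card (gsets2 d)"
    using gsets2_set cS by simp
  also have "card (gsets2 d) = 3 * card {(i, j). 1 \<le> i \<and> 1 \<le> j \<and> i + j \<le> d}"
    unfolding gsets2_def card_image [OF gsets2_inj] by (simp add: card_cartesian_product card_UNIV_axis)
  also have "(\<Sum>g\<in>gsets1 d. card (S g)) = (\<Sum>(v, j)\<in>(UNIV :: axis set) \<times> {1..d}. (d - j) * D + 1)"
    unfolding gsets1_def sum.reindex [OF gsets1_inj]
  proof (rule sum.cong [OF refl])
    fix p :: "axis \<times> nat" assume p: "p \<in> UNIV \<times> {1..d}"
    obtain v j where e: "p = (v, j)" by (cases p)
    have "card (S (replicate_mset j v)) = Suc ((d - j) * D) choose ((d - j) * D)"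
      unfolding cS using p e set_gsets1 [of v j d] by simp
    also have "\<dots> = (d - j) * D + 1" by (subst binomial_symmetric) auto
    finally show "((\<lambda>g. card (S g)) \<circ> (\<lambda>(v, j). replicate_mset j v)) p = (case p of (v, j) \<Rightarrow> (d - j) * D + 1)"
      by (simp add: e)
  qed
  also have "\<dots> = 3 * (\<Sum>j=1..d. (d - j) * D + 1)"
    by (simp only: sum.cartesian_product [symmetric] sum_constant card_UNIV_axis) simp
  finally have "2 * card (nkeys m d) = 2 * card (S {#}) + 3 * (2 * (\<Sum>j=1..d. (d - j) * D + 1))
      + 3 * (2 * card {(i, j). 1 \<le> i \<and> 1 \<le> j \<and> i + j \<le> d})" by simp
  also have "card (S {#}) = (d * D + 2) choose 2"
    unfolding cS by (subst binomial_symmetric) auto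
  also have "2 * ((d * D + 2) choose 2) = (d * D + 1) * (d * D + 2)"
    by (simp add: choose_two)
  finally show ?thesis unfolding sum_line_dims card_pairs D_def .
qed

section \<open>Degree\<close>

text \<open>In the doubled count the coefficient of d^2 collects (m-1)^2 from products without G,
  3(m-1) from those with one kind of G and 3 from those with two kinds, altogether m^2 + m +
  1.\<close>

theorem hilbert_polynomial_Xbar:
  assumes m: "m \<ge> 2"
  shows "hilbert_polynomial (coords m) (Xbar m) = [:1, 3/2, of_nat (m ^ 2 + m + 1) / 2:]"
proof -
  define P :: "rat poly" where "P = [:1, 3/2, of_nat (m ^ 2 + m + 1) / 2:]"
  have val: "of_nat (hilbert_function (coords m) (Xbar m) d) = poly P (of_nat d)" if d: "d \<ge> 2" for d
  proof -
    obtain D where D: "m = Suc D" using m by (cases m) auto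
    obtain e where e: "d = Suc e" using d by (cases d) auto
    have "2 * (of_nat (card (nkeys m d)) :: rat) = of_nat (2 * card (nkeys m d))" by simp
    also have "\<dots> = of_nat ((d * (m - 1) + 1) * (d * (m - 1) + 2)
      + 3 * ((m - 1) * (d * (d - 1)) + 2 * d) + 3 * (d * (d - 1)))"
      by (simp only: card_nkeys [OF d])
    also have "\<dots> = 2 * poly P (of_nat d)"
      by (simp add: P_def D e power2_eq_square field_simps)
    finally show ?thesis using hilbert_function_Xbar [OF m] by simp
  qed
  have "hilbert_polynomial (coords m) (Xbar m) = P"
    unfolding hilbert_polynomial_def
  proof (rule the_equality)
    show ev: "\<forall>\<^sub>F d in sequentially. of_nat (hilbert_function (coords m) (Xbar m) d) = poly P (of_nat d)"
      using val eventually_sequentially by blast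
    fix R :: "rat poly"
    assume "\<forall>\<^sub>F d in sequentially. of_nat (hilbert_function (coords m) (Xbar m) d) = poly R (of_nat d)"
    with ev have "\<forall>\<^sub>F d in sequentially. poly (R - P) (of_nat d) = 0"
      by eventually_elim simp
    then obtain N where N: "\<And>d. d \<ge> N \<Longrightarrow> poly (R - P) (of_nat d) = 0"
      by (auto simp: eventually_sequentially)
    have "infinite (of_nat ` {N..} :: rat set)"
      by (subst finite_image_iff) (auto simp: inj_on_def infinite_Ici)
    moreover have "of_nat ` {N..} \<subseteq> {x. poly (R - P) x = 0}" using N by auto
    ultimately have "R - P = 0" using poly_roots_finite finite_subset by metis
    then show "R = P" by simp
  qed
  then show ?thesis by (simp add: P_def)
qed

theorem proj_degree_Xbar:
  assumes m: "m \<ge> 2"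
  shows "proj_degree (coords m) (Xbar m) = of_nat (m ^ 2 + m + 1)"
proof -
  have "(of_nat (m ^ 2 + m + 1) :: rat) \<noteq> 0" by (simp only: of_nat_eq_0_iff)
  then show ?thesis
    unfolding proj_degree_def hilbert_polynomial_Xbar [OF m]
    by (simp del: of_nat_add of_nat_Suc of_nat_power add: fact_2)
qed

section \<open>Equations\<close>

text \<open>Q is a vector space basis of the quadrics in the kernel. The cubic is indispensable by
  \<open>cubic_C_notin\<close>, and each quadric by independence and
  \<open>genideal_quadrics_part\<close>. In the uniqueness claim c = 0 is impossible, since then Q
  alone would generate.\<close>

theorem equations_Xbar:
  assumes m: "m \<ge> 2"
  shows "\<exists>Q. finite Q \<and> Q \<subseteq> forms (coords m) 2 \<and>
            real (card Q) = (5 * real m ^ 2 - real m - 12) / 2 \<and>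
            cubic_C m \<in> forms (coords m) 3 \<and> cubic_C m \<notin> Q \<and>
            minimally_generates (cring_of m) (Q \<union> {cubic_C m})
              (hid m) \<and>
            (\<forall>F \<in> forms (coords m) 3.
               genideal (cring_of m) (Q \<union> {F})
                 = hid m \<longrightarrow>
               (\<exists>c. c \<noteq> 0 \<and> F - cnst c * cubic_C m \<in> genideal (cring_of m) Q))"
proof -
  define R where "R = cring_of m"
  define C where "C = cubic_C m"
  have m1: "m \<ge> 1" using m by simp
  obtain Q where Q: "Q \<subseteq> kforms m 2" "mpv.independent Q" "kforms m 2 \<subseteq> mpspan Q" "card Q = mpv.dim (kforms m 2)"
    using mpv.basis_exists [of "kforms m 2"] by blast
  have Qf: "Q \<subseteq> forms (coords m) 2" using Q(1) by (auto simp: kforms_def)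
  have fin: "finite Q"
  proof (rule mpv_finite_independent_subset)
    show "forms (coords m) 2 \<subseteq> mpspan (mmonom ` {t. kys t \<subseteq> coords m \<and> mdegree t = 2})"
      by (simp add: forms_span_mmonom)
    show "finite (mmonom ` {t. kys t \<subseteq> coords m \<and> mdegree t = 2})"
      by (intro finite_imageI finite_mdegree finite_coords)
  qed (use Q Qf in auto)
  have card: "real (card Q) = (5 * real m ^ 2 - real m - 12) / 2"
  proof -
    obtain D where D: "m = Suc D" using m by (cases m) auto
    have "2 * cdim (forms (coords m) 2) = 2 * card Q + 2 * card (nkeys m 2)"
      using cdim_forms_split [OF m, of 2] Q(4) by (simp add: cdim_eq)
    then have "3 * m * (3 * m + 1) = 2 * card Q + ((2 * (m - 1) + 1) * (2 * (m - 1) + 2)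
      + 3 * ((m - 1) * (2 * (2 - 1)) + 2 * 2) + 3 * (2 * (2 - 1)))"
      by (simp only: cdim_forms_2 [OF m] card_nkeys [OF order_refl])
    then have "real (3 * m * (3 * m + 1)) = real (2 * card Q + ((2 * (m - 1) + 1) * (2 * (m - 1) + 2)
      + 3 * ((m - 1) * (2 * (2 - 1)) + 2 * 2) + 3 * (2 * (2 - 1))))" by (rule arg_cong)
    then show ?thesis unfolding D by (simp add: power2_eq_square algebra_simps)
  qed
  have Cf: "C \<in> forms (coords m) 3" using cubic_C_form [OF m1] by (simp add: C_def)
  have Qcar: "Q \<subseteq> carrier R" and Ccar: "C \<in> carrier R"
    using Qf Cf forms_carrier by (auto simp: R_def)
  have Cn: "C \<notin> genideal R Q" using cubic_C_notin [OF m1 Q(1)] by (simp add: C_def R_def)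
  have gen: "genideal R (Q \<union> {C}) = hid m"
    using hid_generated [OF m Q(3,1)] by (simp add: R_def C_def)
  have QC: "Q \<union> {C} \<subseteq> carrier R" using Qcar Ccar by simp
  have Cid: "C \<in> hid m" "Q \<subseteq> hid m"
    using mpoly_genideal_self [OF QC [unfolded R_def]] gen by (auto simp: R_def)
  have CQ: "C \<notin> Q" using Cn mpoly_genideal_self [OF Qcar [unfolded R_def]] by (auto simp: R_def)
  have "minimally_generates R (Q \<union> {C}) (hid m)"
    unfolding minimally_generates_def
  proof (intro conjI QC gen allI impI)
    fix B assume B: "B \<subset> Q \<union> {C}"
    show "genideal R B \<noteq> hid m"
    proof (cases "C \<in> B")
      case False
      then have BQ: "B \<subseteq> Q" using B by blast
      have "genideal R B \<subseteq> genideal R Q"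
        using mpoly_genideal_minimal [OF mpoly_genideal_ideal [OF Qcar [unfolded R_def]], of B]
          mpoly_genideal_self [OF Qcar [unfolded R_def]] BQ by (auto simp: R_def)
      then show ?thesis using Cn Cid by blast
    next
      case True
      then obtain q where q: "q \<in> Q" "B \<subseteq> (Q - {q}) \<union> {C}" using B by blast
      have sub: "(Q - {q}) \<union> {C} \<subseteq> carrier R" using QC by blast
      have B: "genideal R B \<subseteq> genideal R ((Q - {q}) \<union> {C})"
        using mpoly_genideal_minimal [OF mpoly_genideal_ideal [OF sub [unfolded R_def]], of B]
          mpoly_genideal_self [OF sub [unfolded R_def]] q(2) by (auto simp: R_def)
      have "q \<notin> genideal R ((Q - {q}) \<union> {C})"
      proof
        assume "q \<in> genideal R ((Q - {q}) \<union> {C})"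
        then have "q \<in> mpspan (Q - {q})"
          using Qf Cf q(1) by (intro genideal_quadrics_part [of _ m C]) (auto simp: R_def)
        then show False using Q(2) q(1) unfolding mpv.dependent_def by blast
      qed
      then show ?thesis using B Cid q(1) by blast
    qed
  qed
  moreover have "\<exists>c. c \<noteq> 0 \<and> F - cnst c * C \<in> genideal R Q"
    if F: "F \<in> forms (coords m) 3" "genideal R (Q \<union> {F}) = hid m" for F
  proof -
    have Fcar: "Q \<union> {F} \<subseteq> carrier R" using Qcar F(1) forms_carrier by (auto simp: R_def)
    then have "F \<in> genideal R (Q \<union> {C})"
      using mpoly_genideal_self [of "Q \<union> {F}" "coords m"] F(2) gen by (auto simp: R_def)
    then obtain c where c: "F - cnst c * C \<in> genideal R Q"
      using cubic_generator_unique [OF Qf Cf F(1)] by (auto simp: R_def)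
    have "c \<noteq> 0"
    proof
      assume "c = 0"
      then have "Q \<union> {F} \<subseteq> genideal R Q"
        using c mpoly_genideal_self [OF Qcar [unfolded R_def]] by (auto simp: R_def)
      then have "genideal R (Q \<union> {F}) \<subseteq> genideal R Q"
        using mpoly_genideal_minimal [OF mpoly_genideal_ideal [OF Qcar [unfolded R_def]], of "Q \<union> {F}"]
        by (auto simp: R_def)
      then show False using Cn Cid F(2) by blast
    qed
    then show ?thesis using c by blast
  qed
  ultimately show ?thesis
    using fin Qf card Cf CQ unfolding R_def C_def by (intro exI [of _ Q]) simp
qed

section \<open>Ideals of quotient rings\<close>

lemma (in cring) carrier_quot: "X \<in> carrier (R Quot I) \<longleftrightarrow> (\<exists>a\<in>carrier R. X = I +> a)"
  unfolding FactRing_def using A_RCOSETS_def' [of R I] by auto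

lemma (in cring) carrier_quotI: "a \<in> carrier R \<Longrightarrow> I +> a \<in> carrier (R Quot I)"
  using carrier_quot by blast

lemma (in cring) carrier_quotE:
  assumes "X \<in> carrier (R Quot I)" obtains a where "a \<in> carrier R" "X = I +> a"
  using assms carrier_quot by blast

lemma (in cring) mult_quot:
  "ideal I R \<Longrightarrow> a \<in> carrier R \<Longrightarrow> b \<in> carrier R \<Longrightarrow> (I +> a) \<otimes>\<^bsub>R Quot I\<^esub> (I +> b) = I +> (a \<otimes> b)"
  using ring_hom_mult [OF ideal.rcos_ring_hom] by metis

text \<open>An ideal above I is a union of cosets of I, so membership of a coset is decided by any
  representative.\<close>

lemma (in cring) mem_quot_image:
  assumes I: "ideal I R" and J: "ideal J R" "I \<subseteq> J" and a: "a \<in> carrier R"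
  shows "I +> a \<in> (+>) I ` J \<longleftrightarrow> a \<in> J"
proof -
  have sub: "(+>) I ` J \<subseteq> carrier (R Quot I)"
    by (rule subsetI) (rule ideal.Icarr [OF ring_ideal_imp_quot_ideal [OF I J(1)]])
  have eq: "J = (\<Union>j\<in>J. I +> j)" by (rule iffD1 [OF ideal_incl_iff [OF I J(1)] J(2)])
  show ?thesis
    using canonical_proj_vimage_mem_iff [OF I sub a] unfolding eq [symmetric] by (rule sym)
qed

lemma (in cring) primeideal_quot:
  assumes I: "ideal I R" and J: "primeideal J R" "I \<subseteq> J"
  shows "primeideal ((+>) I ` J) (R Quot I)"
proof -
  interpret J: primeideal J R by fact
  note mem = mem_quot_image [OF I J.is_ideal J(2)]
  show ?thesis
  proof (rule primeidealI)
    show "ideal ((+>) I ` J) (R Quot I)" by (rule ring_ideal_imp_quot_ideal [OF I J.is_ideal])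
    show "cring (R Quot I)" using ideal.quotient_is_cring [OF I] is_cring by blast
    show "carrier (R Quot I) \<noteq> (+>) I ` J"
    proof
      assume eq: "carrier (R Quot I) = (+>) I ` J"
      have "a \<in> J" if "a \<in> carrier R" for a
        using carrier_quotI [OF that, of I] unfolding eq mem [OF that] .
      then have "carrier R = J" using J.Icarr by (intro equalityI subsetI)
      then show False using J.I_notcarr by simp
    qed
    fix X Y assume XY: "X \<in> carrier (R Quot I)" "Y \<in> carrier (R Quot I)" "X \<otimes>\<^bsub>R Quot I\<^esub> Y \<in> (+>) I ` J"
    obtain a where a: "a \<in> carrier R" "X = I +> a" using XY(1) by (rule carrier_quotE)
    obtain b where b: "b \<in> carrier R" "Y = I +> b" using XY(2) by (rule carrier_quotE)
    have "I +> (a \<otimes> b) \<in> (+>) I ` J"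
      using XY(3) unfolding a(2) b(2) mult_quot [OF I a(1) b(1)] .
    then have "a \<otimes> b \<in> J" using mem [of "a \<otimes> b"] a b by simp
    then have "a \<in> J \<or> b \<in> J" using J.I_prime a b by simp
    then show "X \<in> (+>) I ` J \<or> Y \<in> (+>) I ` J" unfolding a(2) b(2) mem [OF a(1)] mem [OF b(1)] .
  qed
qed

lemma (in cring) maximalideal_quot:
  assumes I: "ideal I R" and J: "maximalideal J R" "I \<subseteq> J"
  shows "maximalideal ((+>) I ` J) (R Quot I)"
proof -
  interpret J: maximalideal J R by fact
  note mem = mem_quot_image [OF I J.is_ideal J(2)]
  show ?thesis
  proof (rule maximalidealI)
    show "ideal ((+>) I ` J) (R Quot I)" by (rule ring_ideal_imp_quot_ideal [OF I J.is_ideal])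
    show "carrier (R Quot I) \<noteq> (+>) I ` J"
    proof
      assume eq: "carrier (R Quot I) = (+>) I ` J"
      have "a \<in> J" if "a \<in> carrier R" for a
        using carrier_quotI [OF that, of I] unfolding eq mem [OF that] .
      then have "carrier R = J" using J.Icarr by (intro equalityI subsetI)
      then show False using J.I_notcarr by simp
    qed
    fix K assume K: "ideal K (R Quot I)" "(+>) I ` J \<subseteq> K" "K \<subseteq> carrier (R Quot I)"
    define K' where "K' = \<Union> K"
    have K': "ideal K' R" unfolding K'_def by (rule quot_ideal_imp_ring_ideal [OF I K(1)])
    have memK: "a \<in> K' \<longleftrightarrow> I +> a \<in> K" if "a \<in> carrier R" for a
      unfolding K'_def by (rule canonical_proj_vimage_mem_iff [OF I K(3) that])
    have "J \<subseteq> K'"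
    proof
      fix a assume "a \<in> J"
      then show "a \<in> K'" using memK [of a] K(2) J.Icarr [of a] by auto
    qed
    moreover have "K' \<subseteq> carrier R" using ideal.Icarr [OF K'] by (intro subsetI)
    ultimately have "K' = J \<or> K' = carrier R"
      using J.I_maximal [OF K'] by simp
    then show "K = (+>) I ` J \<or> K = carrier (R Quot I)"
    proof
      assume "K' = J"
      have "X \<in> (+>) I ` J" if X: "X \<in> K" for X
      proof -
        have "X \<in> carrier (R Quot I)" using X K(3) by (rule subsetD [rotated])
        then obtain a where a: "a \<in> carrier R" "X = I +> a" by (rule carrier_quotE)
        then show ?thesis using X memK [OF a(1)] \<open>K' = J\<close> by simp
      qed
      then show ?thesis using K(2) by auto
    next
      assume "K' = carrier R"
      have "X \<in> K" if X: "X \<in> carrier (R Quot I)" for X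
      proof -
        obtain a where a: "a \<in> carrier R" "X = I +> a" using X by (rule carrier_quotE)
        then show ?thesis using memK [OF a(1)] \<open>K' = carrier R\<close> by simp
      qed
      then show ?thesis using K(3) by auto
    qed
  qed
qed

section \<open>Failure of the Cohen--Macaulay property\<close>

subsection \<open>A chain of prime ideals\<close>

text \<open>Any two points of the parametrized set lie on a polynomially parametrized line, and
  univariate polynomials form a domain.\<close>

lemma vanishing_primeideal:
  fixes \<alpha> :: "'x \<Rightarrow> 'v \<Rightarrow> complex"
  assumes line: "\<And>x y. \<exists>\<psi>. (\<forall>s. \<exists>z. (\<lambda>c. poly (\<psi> c) s) = \<alpha> z) \<and>
      (\<lambda>c. poly (\<psi> c) 0) = \<alpha> x \<and> (\<lambda>c. poly (\<psi> c) 1) = \<alpha> y"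
  shows "primeideal {F \<in> carrier (mpoly_ring V). \<forall>x. eval_mpoly (\<alpha> x) F = 0} (mpoly_ring V)"
proof (rule primeidealI)
  let ?I = "{F \<in> carrier (mpoly_ring V). \<forall>x. eval_mpoly (\<alpha> x) F = 0}"
  show "ideal ?I (mpoly_ring V)"
    by (rule mpoly_idealI) (auto simp: eval_mpoly_hom intro: mpoly_closed)
  show "cring (mpoly_ring V)" by (rule mpoly_cring)
  have "1 \<notin> ?I" by simp
  then show "carrier (mpoly_ring V) \<noteq> ?I" using mpoly_one_closed by blast
  fix F G assume FG: "F \<in> carrier (mpoly_ring V)" "G \<in> carrier (mpoly_ring V)"
    "F \<otimes>\<^bsub>mpoly_ring V\<^esub> G \<in> ?I"
  show "F \<in> ?I \<or> G \<in> ?I"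
  proof (rule ccontr)
    assume "\<not> ?thesis"
    then obtain x y where xy: "eval_mpoly (\<alpha> x) F \<noteq> 0" "eval_mpoly (\<alpha> y) G \<noteq> 0"
      using FG by blast
    obtain \<psi> where \<psi>: "\<And>s. \<exists>z. (\<lambda>c. poly (\<psi> c) s) = \<alpha> z"
      "(\<lambda>c. poly (\<psi> c) 0) = \<alpha> x" "(\<lambda>c. poly (\<psi> c) 1) = \<alpha> y"
      using line [of x y] by blast
    have "poly (peval \<psi> F * peval \<psi> G) s = 0" for s
      using \<psi>(1) [of s] FG(3) by (auto simp: poly_peval eval_mpoly_mult simp flip: eval_mpoly_mult)
    then have "peval \<psi> F * peval \<psi> G = 0" using poly_all_0_iff_0 by blast
    then have "poly (peval \<psi> F) 0 = 0 \<or> poly (peval \<psi> G) 1 = 0" by auto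
    then show False using xy \<psi>(2,3) by (simp add: poly_peval)
  qed
qed

lemma poly_cval: "poly (cval m A c) s = cval m (\<lambda>v. poly (A v) s) c"
  by (cases c) (auto simp: poly_mval poly_prod)

definition linepoly :: "(axis \<Rightarrow> complex) \<Rightarrow> (axis \<Rightarrow> complex) \<Rightarrow> axis \<Rightarrow> complex poly" where
  "linepoly a b v = [:a v, b v - a v:]"

lemma linepoly_0: "(\<lambda>v. poly (linepoly a b v) 0) = a"
  and linepoly_1: "(\<lambda>v. poly (linepoly a b v) 1) = b"
  by (auto simp: linepoly_def)

lemma pker_primeideal: "primeideal (pker m) (cring_of m)"
  unfolding pker_def pull_def
proof (rule vanishing_primeideal)
  fix a b :: "axis \<Rightarrow> complex"
  show "\<exists>\<psi>. (\<forall>s. \<exists>z. (\<lambda>c. poly (\<psi> c) s) = cval m z) \<and>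
      (\<lambda>c. poly (\<psi> c) 0) = cval m a \<and> (\<lambda>c. poly (\<psi> c) 1) = cval m b"
    by (rule exI [of _ "cval m (linepoly a b)"]) (auto simp: poly_cval linepoly_0 linepoly_1)
qed

definition xpoint :: "complex \<Rightarrow> coord \<Rightarrow> complex" where
  "xpoint w = gpoint (\<lambda>v. if v = Vx then w else 0)"

text \<open>Prime ideal of the coordinate axis of G_x in affine space. This axis lies in the cone
  over the projective surface, which places \<open>pline\<close> between the kernel and
  \<open>pmax\<close>.\<close>

definition pline :: "nat \<Rightarrow> coord mpoly set" where
  "pline m = {F \<in> carrier (cring_of m). \<forall>w. eval_mpoly (xpoint w) F = 0}"

definition pmax :: "nat \<Rightarrow> coord mpoly set" where
  "pmax m = {F \<in> carrier (cring_of m). eval_mpoly (\<lambda>_. 0) F = 0}"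

lemma pline_primeideal: "primeideal (pline m) (cring_of m)"
  unfolding pline_def
proof (rule vanishing_primeideal)
  fix x y :: complex
  show "\<exists>\<psi>. (\<forall>s. \<exists>z. (\<lambda>c. poly (\<psi> c) s) = xpoint z) \<and>
      (\<lambda>c. poly (\<psi> c) 0) = xpoint x \<and> (\<lambda>c. poly (\<psi> c) 1) = xpoint y"
  proof (intro exI conjI allI)
    show "(\<lambda>c. poly (if c = CoordG Vx then [:x, y - x:] else 0) s) = xpoint (x + s * (y - x))" for s
      by (auto simp: xpoint_def gpoint_def fun_eq_iff split: coord.split)
  qed (auto simp: xpoint_def gpoint_def fun_eq_iff split: coord.split)
qed

lemma pmax_maximalideal: "maximalideal (pmax m) (cring_of m)"
proof (rule maximalidealI)
  show "ideal (pmax m) (cring_of m)"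
    by (rule mpoly_idealI) (auto simp: pmax_def eval_mpoly_hom intro: mpoly_closed)
  have "1 \<notin> pmax m" by (simp add: pmax_def)
  then show "carrier (cring_of m) \<noteq> pmax m" using mpoly_one_closed by blast
  fix J assume J: "ideal J (cring_of m)" "pmax m \<subseteq> J" "J \<subseteq> carrier (cring_of m)"
  show "J = pmax m \<or> J = carrier (cring_of m)"
  proof (cases "J = pmax m")
    case False
    then obtain F where F: "F \<in> J" "F \<notin> pmax m" using J(2) by blast
    define c where "c = eval_mpoly (\<lambda>_. 0) F"
    have c: "c \<noteq> 0" using F J(3) by (auto simp: pmax_def c_def)
    have "F - cnst c \<in> pmax m"
      using F J(3) by (auto simp: pmax_def eval_mpoly_hom c_def intro!: mpoly_diff_closed mpoly_cnst_closed)
    then have "F - (F - cnst c) \<in> J" using F(1) J(2) mpoly_ideal_diff [OF J(1)] by blast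
    then have "cnst (1 / c) * cnst c \<in> J" using mpoly_ideal_cnst [OF J(1)] by simp
    then have one: "1 \<in> J" using c by (simp flip: cnst_mult)
    have "r \<in> J" if "r \<in> carrier (cring_of m)" for r
      using mpoly_ideal_mult [OF J(1) one that] by simp
    then show ?thesis using J(3) by blast
  qed simp
qed

lemma pker_pline: assumes "m \<ge> 1" shows "pker m \<subset> pline m"
proof
  show "pker m \<subseteq> pline m"
  proof
    fix F assume F: "F \<in> pker m"
    \<comment> \<open>\<open>kforms_vanish_line\<close> applies to homogeneous elements only, hence
      the passage through components; the axis of G_x belongs to the line on which the coordinate
      G_y vanishes.\<close>
    have "eval_mpoly (xpoint w) (hcomp d F) = 0" for w d
      unfolding xpoint_def using pker_hcomp [OF assms F] by (rule kforms_vanish_line [OF assms, of _ _ _ Vy]) simp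
    then have "eval_mpoly (xpoint w) F = 0" for w
      by (subst sum_hcomp [of F]) (simp add: eval_mpoly_sum)
    then show "F \<in> pline m" using F by (simp add: pline_def pker_def)
  qed
  have c: "CoordL (sg Vx (m - 1)) \<in> coords m"
    by (simp add: CoordL_in_coords bnd_vertex)
  have "var (CoordL (sg Vx (m - 1))) \<in> pline m"
    using mpoly_var_closed [OF c] by (simp add: pline_def xpoint_def gpoint_def)
  moreover have "pull m (var (CoordL (sg Vx (m - 1)))) (\<lambda>_. 1) = 1"
    unfolding pull_var by (rule cval_one_coordL)
  then have "var (CoordL (sg Vx (m - 1))) \<notin> pker m"
    unfolding pker_def by (metis (mono_tags, lifting) mem_Collect_eq zero_neq_one)
  ultimately show "pker m \<noteq> pline m" by blast
qed

lemma pline_pmax: "pline m \<subset> pmax m"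
proof
  have "xpoint 0 = (\<lambda>_. 0)" by (auto simp: xpoint_def gpoint_def fun_eq_iff split: coord.split)
  then show "pline m \<subseteq> pmax m" unfolding pline_def pmax_def by (metis (mono_tags, lifting) Collect_mono)
  have "var (CoordG Vx) \<in> pmax m"
    using mpoly_var_closed [OF CoordG_in_coords] by (simp add: pmax_def)
  moreover have "eval_mpoly (xpoint 1) (var (CoordG Vx)) \<noteq> 0" by (simp add: xpoint_def gpoint_def)
  then have "var (CoordG Vx) \<notin> pline m" unfolding pline_def by blast
  ultimately show "pline m \<noteq> pmax m" by blast
qed

subsection \<open>The missing form\<close>

text \<open>\<open>(xyz)\<^sup>2 x\<^bsup>m-4\<^esup>\<close>, one of the discarded coordinates of \<open>X\<close>.\<close>

definition missing :: "nat \<Rightarrow> (axis \<Rightarrow> 'a::comm_semiring_1) \<Rightarrow> 'a" where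
  "missing m a = a Vx ^ (m - 2) * a Vy ^ 2 * a Vz ^ 2"

lemma missing_eq: "m \<ge> 4 \<Longrightarrow> missing m a = (\<Prod>v\<in>UNIV. a v) ^ 2 * a Vx ^ (m - 4)"
proof -
  assume "m \<ge> 4"
  then have "m - 2 = 2 + (m - 4)" by simp
  then have "a Vx ^ (m - 2) = a Vx ^ 2 * a Vx ^ (m - 4)" by (metis power_add)
  then show ?thesis by (simp add: missing_def UNIV_prod_axis power_mult_distrib mult_ac)
qed

text \<open>Even an interior exponent vector of degree 2(m-1) is a sum of two boundary vectors. This
  is why the gap at the missing form closes after multiplication by a coordinate.\<close>

lemma square_times_monomial:
  assumes "mdegree s = 2 * (m - 1)"
  obtains q where "q \<in> carrier (cring_of m)" "\<And>a. pull m q a = (\<Prod>v\<in>UNIV. a v) ^ 2 * mval a s"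
proof -
  obtain b c where bc: "bnd (m - 1) b" "bnd (m - 1) c" "b + c = s"
    using decompose_two [OF assms] by blast
  show thesis
  proof (rule that)
    show "lmon {#b, c#} \<in> carrier (cring_of m)"
      using lmon_form [of "{#b, c#}" m] bc forms_carrier by auto
    show "pull m (lmon {#b, c#}) a = (\<Prod>v\<in>UNIV. a v) ^ 2 * mval a s" for a
      using bc(3) by (simp add: pull_lmon numeral_2_eq_2 del: lmon_simps)
  qed
qed

text \<open>The conductor of the missing form into the coordinate ring, taken back to the polynomial
  ring.\<close>

definition absorbs :: "nat \<Rightarrow> coord mpoly set" where
  "absorbs m = {p \<in> carrier (cring_of m).
     \<exists>q\<in>carrier (cring_of m). \<forall>a. pull m q a = pull m p a * missing m a}"

lemma absorbs_ideal: "ideal (absorbs m) (cring_of m)"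
proof (rule mpoly_idealI)
  show "absorbs m \<subseteq> carrier (cring_of m)" by (auto simp: absorbs_def)
  show "0 \<in> absorbs m" using mpoly_zero_closed by (auto simp: absorbs_def intro!: bexI [of _ 0])
next
  fix p q assume "p \<in> absorbs m" "q \<in> absorbs m"
  then obtain p' q' where "p' \<in> carrier (cring_of m)" "\<forall>a. pull m p' a = pull m p a * missing m a"
    "q' \<in> carrier (cring_of m)" "\<forall>a. pull m q' a = pull m q a * missing m a"
    "p \<in> carrier (cring_of m)" "q \<in> carrier (cring_of m)"
    by (auto simp: absorbs_def)
  then show "p + q \<in> absorbs m"
    unfolding absorbs_def
    by (auto simp: pull_hom algebra_simps intro!: bexI [of _ "p' + q'"] mpoly_add_closed)
next
  fix p r assume "p \<in> absorbs m" and r: "r \<in> carrier (cring_of m)"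
  then obtain p' where "p' \<in> carrier (cring_of m)" "\<forall>a. pull m p' a = pull m p a * missing m a"
    "p \<in> carrier (cring_of m)"
    by (auto simp: absorbs_def)
  then show "r * p \<in> absorbs m"
    unfolding absorbs_def using r
    by (auto simp: pull_hom algebra_simps intro!: bexI [of _ "r * p'"] mpoly_mult_closed)
qed

lemma var_absorbs:
  assumes m: "m \<ge> 4" and c: "c \<in> coords m"
  shows "var c \<in> absorbs m"
proof (cases c)
  case (CoordL t)
  \<comment> \<open>The product is (xyz)^3 x^(m-4) times the monomial of \<open>t\<close>; one of
    the three factors xyz is moved into the exponent vector, which then has degree 2(m-1).\<close>
  define s where "s = t + (sg Vx (m - 3) + sg Vy 1 + sg Vz 1)"
  have "mdegree s = 2 * (m - 1)"
    using c m CoordL by (auto simp: s_def mdegree_add CoordL_in_coords bnd_def)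
  then obtain q where q: "q \<in> carrier (cring_of m)"
    "\<And>a. pull m q a = (\<Prod>v\<in>UNIV. a v) ^ 2 * mval a s"
    using square_times_monomial by blast
  have "pull m q a = pull m (var c) a * missing m a" for a
  proof -
    have "m - 3 = Suc (m - 4)" using m by simp
    then have "a Vx ^ (m - 3) = a Vx * a Vx ^ (m - 4)" by simp
    then show ?thesis
      unfolding q(2) missing_eq [OF m]
      by (simp add: CoordL s_def mval_add UNIV_prod_axis power2_eq_square mult_ac)
  qed
  then show ?thesis using q(1) mpoly_var_closed [OF c] by (auto simp: absorbs_def)
next
  case (CoordG v)
  define w u where "w = nxt v" and "u = nxt w"
  \<comment> \<open>The terms of G_v are x_w x_u x_k^m for k = w and k = u; the missing form
    supplies (xyz)^2 and x^(m-4).\<close>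
  define s where "s k = sg w 1 + sg u 1 + sg k m + sg Vx (m - 4)" for k :: axis
  have deg: "mdegree (s k) = 2 * (m - 1)" for k using m by (simp add: s_def mdegree_add)
  obtain q where q: "q \<in> carrier (cring_of m)"
    "\<And>a. pull m q a = (\<Prod>v\<in>UNIV. a v) ^ 2 * mval a (s w)"
    using square_times_monomial [OF deg] by blast
  obtain r where r: "r \<in> carrier (cring_of m)"
    "\<And>a. pull m r a = (\<Prod>v\<in>UNIV. a v) ^ 2 * mval a (s u)"
    using square_times_monomial [OF deg] by blast
  have "pull m (q - cnst ((-1) ^ m) * r) a = pull m (var c) a * missing m a" for a
    unfolding pull_hom pull_cnst q(2) r(2) missing_eq [OF m] CoordG
    by (simp add: s_def mval_add power_minus [of "a u"] right_diff_distrib left_diff_distrib mult_ac flip: w_def u_def)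
  moreover have "q - cnst ((-1) ^ m) * r \<in> carrier (cring_of m)"
    using q(1) r(1) by (intro mpoly_diff_closed mpoly_mult_closed mpoly_cnst_closed)
  ultimately show ?thesis using mpoly_var_closed [OF c] by (auto simp: absorbs_def)
qed

lemma pmax_absorbs:
  assumes m: "m \<ge> 4" shows "pmax m \<subseteq> absorbs m"
proof
  fix p assume p: "p \<in> pmax m"
  note I = absorbs_ideal [of m]
  have mval0: "mval (\<lambda>_. 0) t = (if t = 0 then 1 else (0::complex))" for t :: "coord \<Rightarrow>\<^sub>0 nat"
  proof (cases "t = 0")
    case False
    then obtain c where "c \<in> kys t" by (rule split_key)
    then show ?thesis using False by (auto simp: mval_def prod_zero_iff in_keys_iff)
  qed simp
  have "eval_mpoly (\<lambda>_. 0) p = (\<Sum>t\<in>insert 0 (kys p). lkp p t * mval (\<lambda>_. 0) t)"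
    by (rule eval_mpoly_superset) auto
  also have "\<dots> = lkp p 0" by (simp add: mval0 sum.delta if_distrib [of "\<lambda>x. _ * x"] cong: if_cong)
  finally have p0: "lkp p 0 = 0" using p by (simp add: pmax_def)
  have "cnst (lkp p t) * mmonom t \<in> absorbs m" if t: "t \<in> kys p" for t
  proof -
    have kt: "kys t \<subseteq> coords m" using p t by (auto simp: pmax_def carrier_mpoly_iff)
    have "t \<noteq> 0" using t p0 by (auto simp: in_keys_iff)
    then obtain c t' where c: "c \<in> kys t" "kys t' \<subseteq> kys t" and tt: "t = sg c 1 + t'"
      by (rule split_key)
    then have "mmonom t' \<in> carrier (cring_of m)" using kt by (intro mpoly_mmonom_closed) auto
    then have "mmonom t' * var c \<in> absorbs m"
      using var_absorbs [OF m] c kt by (intro mpoly_ideal_mult [OF I]) auto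
    moreover have "mmonom t = mmonom t' * var c" by (subst tt) (simp add: mmonom_add var_def mult.commute)
    ultimately have "mmonom t \<in> absorbs m" by simp
    then show ?thesis by (rule mpoly_ideal_cnst [OF I])
  qed
  then have "(\<Sum>t\<in>kys p. cnst (lkp p t) * mmonom t) \<in> absorbs m" by (rule mpoly_ideal_sum [OF I])
  then show "p \<in> absorbs m" unfolding mpoly_expand [symmetric] .
qed

text \<open>On the curve \<open>(s, s\<^sup>2, r s\<^sup>2)\<close> the missing form is \<open>r\<^sup>2 s\<^bsup>m+6\<^esup>\<close>.  Coordinates have order at least
  \<open>m + 3\<close> in \<open>s\<close>, so only linear forms contribute to \<open>s\<^bsup>m+6\<^esup>\<close>, and there the coefficient
  \<open>r\<^sup>2\<close> could only come from the interior monomial with exponents \<open>(m-3, 1, 1)\<close>.\<close>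

definition curve :: "complex \<Rightarrow> axis \<Rightarrow> complex poly" where
  "curve r v = (case v of Vx \<Rightarrow> Polynomial.monom 1 1 | Vy \<Rightarrow> Polynomial.monom 1 2 | Vz \<Rightarrow> Polynomial.monom r 2)"

lemma curve_simps [simp]:
  "curve r Vx = Polynomial.monom 1 1" "curve r Vy = Polynomial.monom 1 2" "curve r Vz = Polynomial.monom r 2"
  by (simp_all add: curve_def)

lemma cval_curve_L:
  assumes "CoordL t \<in> coords m" "m \<ge> 1"
  shows "cval m (curve r) (CoordL t) = Polynomial.monom (r ^ (1 + lkp t Vz)) (m + 4 + lkp t Vy + lkp t Vz)"
proof -
  have d: "lkp t Vx + lkp t Vy + lkp t Vz = m - 1"
    using assms mdegree_axis [of Vx Vy Vz t] by (simp add: CoordL_in_coords bnd_def)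
  have "cval m (curve r) (CoordL t) =
      Polynomial.monom (1 * 1 * r * (1 ^ lkp t Vx * 1 ^ lkp t Vy * r ^ lkp t Vz))
        (1 + 2 + 2 + (1 * lkp t Vx + 2 * lkp t Vy + 2 * lkp t Vz))"
    by (simp only: cval.simps UNIV_prod_axis mval_axis curve_simps monom_power mult_monom)
  also have "\<dots> = Polynomial.monom (r ^ (1 + lkp t Vz)) (m + 4 + lkp t Vy + lkp t Vz)"
    by (rule arg_cong2 [of _ _ _ _ Polynomial.monom]) (use d assms(2) in simp_all)
  finally show ?thesis .
qed

lemma cval_curve_G:
  "cval m (curve r) (CoordG Vx) = Polynomial.monom r (2 * m + 4) - Polynomial.monom (r * (- r) ^ m) (2 * m + 4)"
  "cval m (curve r) (CoordG Vy) = Polynomial.monom (r * r ^ m) (2 * m + 3) - Polynomial.monom (r * (- 1) ^ m) (m + 3)"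
  "cval m (curve r) (CoordG Vz) = Polynomial.monom 1 (m + 3) - Polynomial.monom ((- 1) ^ m) (2 * m + 3)"
  by (simp_all only: cval.simps nxt.simps curve_simps minus_monom monom_power mult_monom right_diff_distrib)
     (intro arg_cong2 [of _ _ _ _ minus] arg_cong2 [of _ _ _ _ Polynomial.monom]; simp)+

lemma cval_curve_dvd:
  assumes c: "c \<in> coords m" and m: "m \<ge> 1"
  shows "Polynomial.monom 1 (m + 3) dvd cval m (curve r) c"
proof -
  have dvd: "Polynomial.monom 1 (m + 3) dvd Polynomial.monom a n" if "n \<ge> m + 3" for a :: complex and n
  proof -
    have "Polynomial.monom a n = Polynomial.monom 1 (m + 3) * Polynomial.monom a (n - (m + 3))"
      using that by (simp add: mult_monom)
    then show ?thesis by simp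
  qed
  show ?thesis
  proof (cases c)
    case (CoordL t)
    then show ?thesis using c m cval_curve_L [of t m r] by (auto intro: dvd)
  next
    case (CoordG v)
    then show ?thesis
      by (cases v) (simp_all only: cval_curve_G, auto intro!: dvd_diff dvd)
  qed
qed

text \<open>At order m + 6 only odd powers of r occur. A coordinate xyz lambda contributes r^(1+j),
  with j the z-exponent of lambda, only if its y- and z-exponents sum to 2, and both being 1 would
  make lambda interior. The exponents m + 3, 2m + 3, 2m + 4 in the G's all differ from m + 6 when m
  >= 4.\<close>

lemma coeff_curve_var:
  assumes m: "m \<ge> 4" and c: "c \<in> coords m"
  shows "\<exists>\<alpha> \<beta>. \<forall>r. Polynomial.coeff (cval m (curve r) c) (m + 6) = \<alpha> * r + \<beta> * r ^ 3"
proof (cases c)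
  case (CoordG v)
  then show ?thesis using m
    by (cases v) (simp_all only: cval_curve_G, auto simp: coeff_diff intro!: exI [of _ 0])
next
  case (CoordL t)
  have b: "bnd (m - 1) t" using c CoordL by (simp add: CoordL_in_coords)
  have d: "lkp t Vx + lkp t Vy + lkp t Vz = m - 1"
    using b mdegree_axis [of Vx Vy Vz t] by (simp add: bnd_def)
  have L: "cval m (curve r) c = Polynomial.monom (r ^ (1 + lkp t Vz)) (m + 4 + lkp t Vy + lkp t Vz)" for r
    using c m CoordL cval_curve_L [of t m r] by simp
  consider "lkp t Vy + lkp t Vz \<noteq> 2" | "lkp t Vy + lkp t Vz = 2" "lkp t Vz = 0"
    | "lkp t Vy + lkp t Vz = 2" "lkp t Vz = 2" | "lkp t Vy = 1" "lkp t Vz = 1" by linarith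
  then show ?thesis
  proof cases
    case 1
    then show ?thesis unfolding L by (auto intro!: exI [of _ 0])
  next
    case 2
    then show ?thesis unfolding L by (intro exI [of _ 1] exI [of _ 0]) auto
  next
    case 3
    then show ?thesis unfolding L by (intro exI [of _ 0] exI [of _ 1]) (auto simp: power3_eq_cube)
  next
    case 4
    then have "lkp t Vx \<noteq> 0" using d m by simp
    then have "lkp t k \<noteq> 0" for k using 4 by (cases k) auto
    then have False using b unfolding bnd_def by blast
    then show ?thesis ..
  qed
qed

lemma coeff_curve:
  assumes m: "m \<ge> 4" and F: "F \<in> carrier (cring_of m)"
  shows "\<exists>\<alpha> \<beta>. \<forall>r. Polynomial.coeff (peval (cval m (curve r)) F) (m + 6) = \<alpha> * r + \<beta> * r ^ 3"
proof -
  have mono: "\<exists>\<alpha> \<beta>. \<forall>r. Polynomial.coeff (mval (cval m (curve r)) t) (m + 6) = \<alpha> * r + \<beta> * r ^ 3"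
    if t: "kys t \<subseteq> coords m" for t :: "coord \<Rightarrow>\<^sub>0 nat"
  proof (cases "t = 0")
    case True
    then show ?thesis by (auto intro!: exI [of _ 0])
  next
    case False
    then obtain c t' where ct0: "c \<in> kys t" "kys t' \<subseteq> kys t" "t = sg c 1 + t'" by (rule split_key)
    then have ct: "c \<in> coords m" "kys t' \<subseteq> coords m" "t = sg c 1 + t'" using t by auto
    show ?thesis
    proof (cases "t' = 0")
      case True
      then show ?thesis using coeff_curve_var [OF m ct(1)] ct(3) by (simp add: mval_add)
    next
      case False
      then obtain c' t'' where "c' \<in> kys t'" and ct'2: "t' = sg c' 1 + t''" by (rule split_key)
      then have ct': "c' \<in> coords m" "t' = sg c' 1 + t''" using ct(2) by auto
      have "Polynomial.coeff (mval (cval m (curve r)) t) (m + 6) = 0" for r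
      proof -
        have "Polynomial.monom 1 (m + 3) * Polynomial.monom 1 (m + 3) dvd cval m (curve r) c * cval m (curve r) c'"
          using m ct(1) ct'(1) by (intro mult_dvd_mono cval_curve_dvd) auto
        moreover have MM: "Polynomial.monom 1 (m + 3) * Polynomial.monom 1 (m + 3) = Polynomial.monom (1::complex) (2 * m + 6)"
          unfolding mult_monom by (rule arg_cong2 [of _ _ _ _ Polynomial.monom]) simp_all
        ultimately obtain P where P: "cval m (curve r) c * cval m (curve r) c' =
            Polynomial.monom 1 (m + 3) * Polynomial.monom 1 (m + 3) * P" by (elim dvdE)
        have "mval (cval m (curve r)) t = cval m (curve r) c * cval m (curve r) c' * mval (cval m (curve r)) t''"
          unfolding ct(3) ct'(2) mval_add mval_single power_one_right by (rule mult.assoc [symmetric])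
        also have "\<dots> = Polynomial.monom 1 (2 * m + 6) * (P * mval (cval m (curve r)) t'')"
          unfolding P MM by (rule mult.assoc)
        finally show ?thesis using m by (simp add: coeff_monom_times)
      qed
      then show ?thesis by (intro exI [of _ 0]) auto
    qed
  qed
  define \<alpha> where "\<alpha> t = (SOME p. \<forall>r. Polynomial.coeff (mval (cval m (curve r)) t) (m + 6) = fst p * r + snd p * r ^ 3)" for t
  have \<alpha>: "Polynomial.coeff (mval (cval m (curve r)) t) (m + 6) = fst (\<alpha> t) * r + snd (\<alpha> t) * r ^ 3" if "t \<in> kys F" for t r
  proof -
    have "\<exists>p. \<forall>r. Polynomial.coeff (mval (cval m (curve r)) t) (m + 6) = fst p * r + snd p * r ^ 3"
      using mono [of t] that F by (auto simp: carrier_mpoly_iff)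
    then show ?thesis unfolding \<alpha>_def by (rule someI_ex [THEN spec])
  qed
  have "Polynomial.coeff (peval (cval m (curve r)) F) (m + 6) =
      (\<Sum>t\<in>kys F. lkp F t * fst (\<alpha> t)) * r + (\<Sum>t\<in>kys F. lkp F t * snd (\<alpha> t)) * r ^ 3" for r
    by (simp add: peval_def coeff_sum \<alpha> sum_distrib_left sum_distrib_right algebra_simps flip: sum.distrib)
  then show ?thesis by blast
qed

lemma missing_not_pull:
  assumes m: "m \<ge> 4" and F: "F \<in> carrier (cring_of m)"
  shows "\<exists>a. pull m F a \<noteq> missing m a"
proof (rule ccontr)
  assume "\<not> ?thesis"
  then have eq: "pull m F a = missing m a" for a by simp
  obtain \<alpha> \<beta> where ab: "\<And>r. Polynomial.coeff (peval (cval m (curve r)) F) (m + 6) = \<alpha> * r + \<beta> * r ^ 3"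
    using coeff_curve [OF m F] by blast
  have "poly (peval (cval m (curve r)) F) s = poly (Polynomial.monom (r ^ 2) (m + 6)) s" for r s
  proof -
    have e: "m + 6 = (m - 2) + 2 * 2 + 2 * 2" using m by simp
    have "poly (peval (cval m (curve r)) F) s = missing m (\<lambda>v. poly (curve r v) s)"
      unfolding poly_peval poly_cval eq [symmetric] pull_def ..
    also have "\<dots> = r ^ 2 * s ^ (m + 6)"
      unfolding e by (simp add: missing_def poly_monom power_mult_distrib power_add power_mult mult_ac del: numeral_times_numeral)
    finally show ?thesis by (simp add: poly_monom)
  qed
  then have "peval (cval m (curve r)) F = Polynomial.monom (r ^ 2) (m + 6)" for r
    using poly_eq_poly_eq_iff by blast
  then have r: "r ^ 2 = \<alpha> * r + \<beta> * r ^ 3" for r using ab [of r] by simp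
  \<comment> \<open>The right-hand side is odd in r while r^2 is even, so the values at 1 and -1 are
    contradictory.\<close>
  have r1: "\<alpha> + \<beta> = 1" using r [of 1] by simp
  have r2: "- \<alpha> - \<beta> = 1" using r [of "- 1"] by simp
  have "(\<alpha> + \<beta>) + (- \<alpha> - \<beta>) = 0" by simp
  then show False unfolding r1 r2 by simp
qed

subsection \<open>Depth and height\<close>

theorem not_cohen_macaulay:
  assumes m: "m \<ge> 4"
  shows "\<not> arithmetically_cohen_macaulay (coords m) (Xbar m)"
proof
  define R where "R = cring_of m"
  define I where "I = pker m"
  define S where "S = R Quot I"
  assume "arithmetically_cohen_macaulay (coords m) (Xbar m)"
  then have CM: "cohen_macaulay S"
    using m by (simp add: arithmetically_cohen_macaulay_def coordinate_ring_def hid_eq_pker S_def R_def I_def)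
  interpret R: cring R unfolding R_def by (rule mpoly_cring)
  have I: "ideal I R" unfolding I_def R_def by (rule pker_ideal)
  have Rops: "a \<otimes>\<^bsub>R\<^esub> b = a * b" "\<one>\<^bsub>R\<^esub> = 1" for a b by (simp_all add: R_def)
  interpret S: cring S unfolding S_def using ideal.quotient_is_cring [OF I R.is_cring] .
  define cl where "cl p = I +>\<^bsub>R\<^esub> p" for p
  have cl_eq: "cl p = cl q \<longleftrightarrow> (\<forall>a. pull m p a = pull m q a)" if "p \<in> carrier R" "q \<in> carrier R" for p q
  proof -
    have "p \<ominus>\<^bsub>R\<^esub> q = p - q"
      using mpoly_a_inv [of q "coords m"] that(2) by (simp add: a_minus_def R_def)
    moreover have "p - q \<in> carrier R" using that mpoly_diff_closed by (simp add: R_def)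
    ultimately have "cl p = cl q \<longleftrightarrow> p - q \<in> pker m"
      using R.quotient_eq_iff_same_a_r_cos [OF I that] by (simp add: cl_def I_def)
    then show ?thesis using \<open>p - q \<in> carrier R\<close> by (simp add: pker_def R_def pull_hom)
  qed
  have cl_mult: "cl p \<otimes>\<^bsub>S\<^esub> cl q = cl (p * q)" if "p \<in> carrier R" "q \<in> carrier R" for p q
    using R.mult_quot [OF I that] by (simp add: cl_def S_def Rops)
  have clS: "X \<in> carrier S \<longleftrightarrow> (\<exists>p\<in>carrier R. X = cl p)" for X
    unfolding S_def R.carrier_quot cl_def ..
  have one: "\<one>\<^bsub>S\<^esub> = cl 1" by (simp add: S_def cl_def FactRing_def Rops)
  have c01: "0 \<in> carrier R" "1 \<in> carrier R" by (simp_all add: R_def mpoly_closed)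
  have zero: "\<zero>\<^bsub>S\<^esub> = cl 0"
    using ring_hom_zero [OF ideal.rcos_ring_hom [OF I] R.ring_axioms S.ring_axioms [unfolded S_def]]
    by (simp add: S_def cl_def R_def)
  define M where "M = cl ` pmax m"
  have sub: "I \<subseteq> pline m" "I \<subseteq> pmax m" using pker_pline [of m] pline_pmax [of m] m by (auto simp: I_def)
  have cl_fun: "cl = (+>\<^bsub>R\<^esub>) I" by (auto simp: cl_def)
  have maxM: "maximalideal M S"
    unfolding M_def cl_fun S_def
    by (rule R.maximalideal_quot [OF I _ sub(2)]) (simp add: R_def pmax_maximalideal)
  \<comment> \<open>For p0, p1 in M and W the missing form, q0 = p0 W and q1 = p1 W come from the
    ring, and p1 q0 = q1 p0. Regularity of p1 modulo p0 puts q0 into the ideal of p0, and cancelling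
    p0 would put W into the ring.\<close>
  have depth: "ideal_depth S M \<le> 1"
    unfolding ideal_depth_def
  proof (rule Sup_least, clarify)
    fix xs assume xs: "set xs \<subseteq> M" "regular_sequence S xs"
    have "length xs \<le> 1"
    proof (rule ccontr)
      assume "\<not> length xs \<le> 1"
      then have len: "0 < length xs" "1 < length xs" by auto
      then have "xs ! 0 \<in> M" "xs ! 1 \<in> M" using xs(1) nth_mem by blast+
      then obtain p0 p1 where p: "p0 \<in> pmax m" "xs ! 0 = cl p0" "p1 \<in> pmax m" "xs ! 1 = cl p1"
        by (auto simp: M_def)
      obtain q0 where q0: "q0 \<in> carrier R" "\<And>a. pull m q0 a = pull m p0 a * missing m a"
        using pmax_absorbs [OF m] p(1) unfolding absorbs_def R_def by blast
      obtain q1 where q1: "q1 \<in> carrier R" "\<And>a. pull m q1 a = pull m p1 a * missing m a"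
        using pmax_absorbs [OF m] p(3) unfolding absorbs_def R_def by blast
      have pc: "p0 \<in> carrier R" "p1 \<in> carrier R" using p by (auto simp: pmax_def R_def)
      have clc: "cl p \<in> carrier S" if "p \<in> carrier R" for p using clS that by blast
      have reg: "\<And>i r. i < length xs \<Longrightarrow> r \<in> carrier S \<Longrightarrow>
         xs ! i \<otimes>\<^bsub>S\<^esub> r \<in> genideal S (set (take i xs)) \<Longrightarrow> r \<in> genideal S (set (take i xs))"
        using xs(2) by (simp add: regular_sequence_def)
      have t1: "set (take 1 xs) = {cl p0}"
        using len p(2) by (cases xs) auto
      \<comment> \<open>A regular sequence cannot start with 0: regularity applied to 1 would give 1
        in the ideal generated by the empty set, the zero ideal.\<close>
      obtain a0 where a0: "pull m p0 a0 \<noteq> 0"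
      proof (rule ccontr)
        assume "\<not> thesis"
        then have "\<forall>a. pull m p0 a = 0" using that by blast
        then have z: "cl p0 = cl 0" using cl_eq [OF pc(1) c01(1)] by simp
        have e: "ideal (genideal S {}) S" "genideal S {} \<subseteq> {\<zero>\<^bsub>S\<^esub>}"
          using S.genideal_ideal [of "{}"] S.genideal_minimal [OF S.zeroideal] by auto
        have "xs ! 0 = \<zero>\<^bsub>S\<^esub>" unfolding p(2) z zero ..
        then have "xs ! 0 \<otimes>\<^bsub>S\<^esub> \<one>\<^bsub>S\<^esub> = \<zero>\<^bsub>S\<^esub>"
          by (simp only: S.l_null S.one_closed)
        moreover have "\<zero>\<^bsub>S\<^esub> \<in> genideal S {}"
          using additive_subgroup.zero_closed [OF ideal.axioms(1) [OF e(1)]] .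
        ultimately have "xs ! 0 \<otimes>\<^bsub>S\<^esub> \<one>\<^bsub>S\<^esub> \<in> genideal S (set (take 0 xs))" by (simp only: take_0 list.set)
        then have "\<one>\<^bsub>S\<^esub> \<in> genideal S (set (take 0 xs))" by (rule reg [OF len(1) S.one_closed])
        then have "\<one>\<^bsub>S\<^esub> = \<zero>\<^bsub>S\<^esub>" using e(2) by (auto simp only: take_0 list.set)
        then have "cl 1 = cl 0" unfolding one zero .
        then show False using cl_eq [OF c01(2,1)] by simp
      qed
      have "cl p1 \<otimes>\<^bsub>S\<^esub> cl q0 = cl q1 \<otimes>\<^bsub>S\<^esub> cl p0"
      proof -
        have "cl (p1 * q0) = cl (q1 * p0)"
          using pc q0 q1 by (subst cl_eq) (auto simp: R_def pull_hom intro: mpoly_mult_closed)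
        then show ?thesis using cl_mult pc q0(1) q1(1) by simp
      qed
      moreover have PI: "genideal S {cl p0} = PIdl\<^bsub>S\<^esub> cl p0"
        using S.cgenideal_eq_genideal [OF clc [OF pc(1)]] by simp
      ultimately have "xs ! 1 \<otimes>\<^bsub>S\<^esub> cl q0 \<in> genideal S (set (take 1 xs))"
        unfolding t1 p(4) using clc [OF q1(1)] by (auto simp: cgenideal_def)
      then have "cl q0 \<in> PIdl\<^bsub>S\<^esub> cl p0"
        using reg [OF len(2) clc [OF q0(1)]] unfolding t1 PI by simp
      then obtain h where h: "h \<in> carrier R" "cl q0 = cl h \<otimes>\<^bsub>S\<^esub> cl p0"
        unfolding cgenideal_def using clS by auto
      then have "cl q0 = cl (h * p0)" using cl_mult pc by simp
      moreover have "h * p0 \<in> carrier R" using h(1) pc by (simp add: R_def mpoly_mult_closed)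
      ultimately have prod: "pull m p0 a * missing m a = pull m h a * pull m p0 a" for a
        using cl_eq [OF q0(1)] q0(2) by (simp add: pull_hom)
      \<comment> \<open>p0 is cancelled on the line from \<open>a0\<close>, where it does not
        vanish, to \<open>b\<close>; there everything is a univariate polynomial and a product is 0
        only if a factor is.\<close>
      have "pull m h b = missing m b" for b
      proof -
        define A where "A = linepoly a0 b"
        define U W where "U = peval (cval m A) p0" and "W = missing m A - peval (cval m A) h"
        have U: "poly U s = pull m p0 (\<lambda>v. poly (A v) s)"
          and W: "poly W s = missing m (\<lambda>v. poly (A v) s) - pull m h (\<lambda>v. poly (A v) s)" for s
          by (simp_all add: U_def W_def poly_peval poly_cval pull_def missing_def)
        have "poly (U * W) s = 0" for s
          using prod [of "\<lambda>v. poly (A v) s"] by (simp add: U W algebra_simps)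
        then have "U * W = 0" using poly_all_0_iff_0 by blast
        moreover have "poly U 0 \<noteq> 0" using a0 by (simp add: U A_def linepoly_0)
        ultimately have "W = 0" by auto
        then show ?thesis using W [of 1] by (simp add: A_def linepoly_1)
      qed
      then show False using missing_not_pull [OF m, of h] h(1) by (auto simp: R_def)
    qed
    then show "enat (length xs) \<le> 1" by (simp add: one_enat_def)
  qed
  \<comment> \<open>The chain is the zero ideal, the ideal of the axis of G_x and the irrelevant
    ideal, as images of \<open>pker m\<close>, \<open>pline m\<close> and \<open>pmax m\<close>. Its
    length 2 already exceeds the depth.\<close>
  have height: "prime_height S M \<ge> 2"
  proof -
    define P where "P = (\<lambda>i::nat. cl ` (if i = 0 then pker m else if i = 1 then pline m else pmax m))"
    have id: "ideal (pline m) R" "ideal (pmax m) R"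
      unfolding R_def by (rule primeideal.axioms(1) [OF pline_primeideal], rule maximalideal.axioms(1) [OF pmax_maximalideal])
    have "primeideal (cl ` pker m) S" "primeideal (cl ` pline m) S"
      unfolding cl_fun S_def
      by (rule R.primeideal_quot [OF I]; simp add: I_def [symmetric] R_def pline_primeideal sub(1),
          (simp add: I_def pker_primeideal)?)+
    moreover have "primeideal M S" using S.maximalideal_prime [OF maxM] .
    ultimately have prime: "\<forall>i\<le>2. primeideal (P i) S" by (auto simp: P_def M_def)
    have mem: "cl p \<in> cl ` J \<longleftrightarrow> p \<in> J" if "ideal J R" "I \<subseteq> J" "p \<in> carrier R" for J p
      using R.mem_quot_image [OF I that] by (simp add: cl_fun)
    have strict: "cl ` J \<subset> cl ` K" if JK: "J \<subset> K" "ideal J R" "I \<subseteq> J" "ideal K R" for J K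
    proof -
      obtain p where p: "p \<in> K" "p \<notin> J" using JK(1) by blast
      then have "p \<in> carrier R" using ideal.Icarr [OF JK(4)] by blast
      then have "cl p \<in> cl ` K" "cl p \<notin> cl ` J" using p mem [OF JK(2,3)] by auto
      then show ?thesis using JK(1) by blast
    qed
    have P01: "P 0 \<subset> P 1" "P 1 \<subset> P 2"
      using strict [of "pker m" "pline m"] strict [of "pline m" "pmax m"] pker_pline [of m] pline_pmax [of m]
        I id sub m by (auto simp: P_def I_def)
    have chain: "\<forall>i<2. P i \<subset> P (Suc i)"
    proof (intro allI impI)
      fix i :: nat assume "i < 2"
      then have "i = 0 \<or> i = 1" by linarith
      then show "P i \<subset> P (Suc i)" using P01 unfolding numeral_2_eq_2 One_nat_def by (elim disjE) simp_all
    qed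
    have "P 2 = M" by (simp add: P_def M_def)
    then have "enat 2 \<in> {enat n | n. \<exists>p :: nat \<Rightarrow> coord mpoly set set.
        (\<forall>i\<le>n. primeideal (p i) S) \<and> (\<forall>i<n. p i \<subset> p (Suc i)) \<and> p n = M}"
      using prime chain by (intro CollectI exI [of _ 2] exI [of _ P] conjI refl)
    then have "enat 2 \<le> prime_height S M" unfolding prime_height_def by (rule Sup_upper)
    then show ?thesis by (metis numeral_eq_enat)
  qed
  have "ideal_depth S M = prime_height S M"
    using CM maxM unfolding cohen_macaulay_def by blast
  then have "2 \<le> ideal_depth S M" using height by (simp only:)
  then have "(2::enat) \<le> 1" using depth by (rule order_trans)
  then show False by simp
qed

theorem mainTheorem5:
  fixes m :: nat
  assumes "m \<ge> 4"
  shows "(\<exists>Q. finite Q \<and> Q \<subseteq> forms (coords m) 2 \<and>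
            real (card Q) = (5 * real m ^ 2 - real m - 12) / 2 \<and>
            cubic_C m \<in> forms (coords m) 3 \<and> cubic_C m \<notin> Q \<and>
            minimally_generates (mpoly_ring (coords m)) (Q \<union> {cubic_C m})
              (homogeneous_ideal (coords m) (Xbar m)) \<and>
            (\<forall>F \<in> forms (coords m) 3.
               genideal (mpoly_ring (coords m)) (Q \<union> {F})
                 = homogeneous_ideal (coords m) (Xbar m) \<longrightarrow>
               (\<exists>c. c \<noteq> 0 \<and> F - cnst c * cubic_C m \<in> genideal (mpoly_ring (coords m)) Q)))
       \<and> proj_degree (coords m) (Xbar m) = of_nat (m ^ 2 + m + 1)
       \<and> \<not> arithmetically_cohen_macaulay (coords m) (Xbar m)"
  using equations_Xbar [of m] proj_degree_Xbar [of m] not_cohen_macaulay [of m] assms by simp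

end
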